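(* Let $k$ be a field of characteristic zero, let $n,m,p\ge 1$, let $X=\{x_1,\dots,x_n\}$ and $Y=\{y_1,\dots,y_m\}$ be two sets of (noncommuting) indeterminates, let $\mathfrak g$ be the free Lie algebra over $k$ on the disjoint union $X\amalg Y$, and let $B_p:S\mathfrak g\otimes_k S\mathfrak g\to S\mathfrak g$ be the operator for $\mathfrak g$ defined in the context. Then $$B_p(x_1\cdots x_n,\;y_1\cdots y_m)=\sum_{\pi} w(\pi_1^X,\pi_1^Y)\cdots w(\pi_{n+m-p}^X,\pi_{n+m-p}^Y),$$ where the products are taken in $S\mathfrak g$, the elements $w(A,B)\in\mathfrak g$ are those defined in the context, and the sum runs over all special bipartitions $\pi=\{(\pi_1^X,\pi_1^Y),\dots,(\pi_{n+m-p}^X,\pi_{n+m-p}^Y)\}$ of $(X,Y)$ of cardinality $n+m-p$. In particular, $$B_{n+m-1}(x_1\cdots x_n,\;y_1\cdots y_m)=w(X,Y).$$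
   Context: **The operators $B_p$.** Let $k$ be a field of characteristic zero and $\mathfrak g$ a (possibly infinite dimensional) Lie algebra over $k$, with symmetric algebra $S=S\mathfrak g=\bigoplus_{d\ge0}S^d$ and universal enveloping algebra $U=U\mathfrak g$. The symmetrization map is the $k$-linear isomorphism $e:S\to U$ given by $e(g_1\cdots g_d)=\frac1{d!}\sum_{\sigma} g_{\sigma(1)}\cdots g_{\sigma(d)}$ for $g_1,\dots,g_d\in\mathfrak g$, where $\sigma$ runs over all permutations of $\{1,\dots,d\}$ (and $e(1)=1$). Define $B:S\otimes_kS\to S$ by $B(x,y)=e^{-1}(e(x)e(y))$. Then $B=\sum_{p\ge0}B_p$, where $B_p$ is the homogeneous component of degree $-p$ of $B$, i.e. $B_p$ maps $S^a\otimes S^b$ to $S^{a+b-p}$ (with $S^d=0$ for $d<0$). **Multi-indices.** For a multi-index $\alpha=(\alpha(1),\dots,\alpha(s))\in\{1,\dots,n\}^s$ write $|\alpha|=s$, $\operatorname{Im}\alpha=\{\alpha(1),\dots,\alpha(s)\}$ and $ad(x)^\alpha=ad(x_{\alpha(1)})\circ\cdots\circ ad(x_{\alpha(s)})$; similarly $ad(y)^\beta$ for $\beta\in\{1,\dots,m\}^s$. Empty multi-indices ($s=0$) are allowed except where a condition below excludes them, and for them $ad(x)^\alpha$ and $ad(y)^\beta$ are the identity. A multi-index is injective if its entries are pairwise distinct. **The elements $w$.** For $n,m\ge1$ and $X=\{x_1,\dots,x_n\}$, $Y=\{y_1,\dots,y_m\}$ define, in the free Lie algebra on $X\amalg Y$,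 $$w(X,Y)=\frac1{n+m}\bigl(w'(X,Y)+w''(X,Y)\bigr),$$ $$w'(X,Y)=\sum\frac{(-1)^{r+1}}{r}\,\frac{ad(x)^{\alpha_1}\circ ad(y)^{\beta_1}\circ\cdots\circ ad(x)^{\alpha_{r-1}}\circ ad(y)^{\beta_{r-1}}\circ ad(x)^{\alpha_r}(y_l)}{|\alpha_1|!\,|\beta_1|!\cdots|\alpha_{r-1}|!\,|\beta_{r-1}|!\,|\alpha_r|!},$$ $$w''(X,Y)=\sum\frac{(-1)^{r+1}}{r}\,\frac{ad(x)^{\alpha_1}\circ ad(y)^{\beta_1}\circ\cdots\circ ad(x)^{\alpha_{r-1}}\circ ad(y)^{\beta_{r-1}}(x_l)}{|\alpha_1|!\,|\beta_1|!\cdots|\alpha_{r-1}|!\,|\beta_{r-1}|!}.$$ The sum for $w'$ is over all $r\ge1$, all $l\in\{1,\dots,m\}$ and all injective multi-indices $\alpha_i\in\{1,\dots,n\}^{|\alpha_i|}$ ($1\le i\le r$), $\beta_j\in\{1,\dots,m\}^{|\beta_j|}$ ($1\le j\le r-1$) such that $|\alpha_1|+\dots+|\alpha_r|=n$, $|\beta_1|+\dots+|\beta_{r-1}|=m-1$, $|\alpha_i|+|\beta_i|\ge1$ for $1\le i\le r-1$, $|\alpha_r|\ge1$, $\bigcup_{i=1}^r\operatorname{Im}\alpha_i=\{1,\dots,n\}$ and $\{l\}\cup\bigcup_{j=1}^{r-1}\operatorname{Im}\beta_j=\{1,\dots,m\}$. The sum for $w''$ is over all $r\ge1$, all $l\in\{1,\dots,n\}$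 and all injective multi-indices $\alpha_i\in\{1,\dots,n\}^{|\alpha_i|}$, $\beta_j\in\{1,\dots,m\}^{|\beta_j|}$ ($1\le i,j\le r-1$) such that $|\alpha_1|+\dots+|\alpha_{r-1}|=n-1$, $|\beta_1|+\dots+|\beta_{r-1}|=m$, $|\alpha_i|+|\beta_i|\ge1$ for $1\le i\le r-1$, $\{l\}\cup\bigcup_{i=1}^{r-1}\operatorname{Im}\alpha_i=\{1,\dots,n\}$ and $\bigcup_{j=1}^{r-1}\operatorname{Im}\beta_j=\{1,\dots,m\}$. For nonempty subsets $A\subset X$, $B\subset Y$ the element $w(A,B)$ is defined by the same formula with $A,B$ (and their cardinalities) in place of $X,Y$ (and $n,m$). Further, $w(\{a\},\emptyset)=w(\emptyset,\{a\})=a$ for $a\in X\amalg Y$. **Special bipartitions.** Let $A_1,A_2$ be sets and $\mathcal P(A_i)$ the set of all subsets of $A_i$. A bipartition of $(A_1,A_2)$ is a subset $\pi\subset\mathcal P(A_1)\times\mathcal P(A_2)$ such that (i) if $S=(S_1,S_2)$ and $T=(T_1,T_2)$ are distinct elements of $\pi$, then $S_i\cap T_i=\emptyset$ for $i=1,2$; (ii) $A_i=\bigcup_{S\in\pi}S_i$ for $i=1,2$. A bipartition $\pi$ of $(X,Y)$ is special if $w(S,T)$ is defined for all $(S,T)\in\pi$; that is, if whenever $(\emptyset,S)\in\pi$ or $(S,\emptyset)\in\pi$, the set $S$ has exactly one element.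
   Formalization: The condition |α_r| ≥ 1 in the sum for w'(X,Y) is dropped, so α_r may be empty: with it the formula already fails for n=m=p=1, where it gives w({x},{y}) = 3/4 [x,y] although B_1(x,y) = 1/2 [x,y]. *)

theory Defs
  imports
    "HOL-Library.Poly_Mapping"
    "HOL-Combinatorics.Permutations"
    "HOL-Algebra.QuotRing"
    "HOL-Algebra.Algebraic_Closure_Type"
begin

section \<open>Free associative algebras\<close>

datatype 'g free_monoid = Free_Monoid (letters: "'g list")

instantiation free_monoid :: (type) monoid_add
begin

definition zero_free_monoid :: "'a free_monoid"
  where "0 = Free_Monoid []"

definition plus_free_monoid :: "'a free_monoid \<Rightarrow> 'a free_monoid \<Rightarrow> 'a free_monoid"
  where "u + v = Free_Monoid (letters u @ letters v)"

instance
  by standard (auto simp: zero_free_monoid_def plus_free_monoid_def)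

end

text \<open>The convolution product of \<^typ>\<open>'g free_monoid \<Rightarrow>\<^sub>0 'k\<close> makes it the free unital associative
  \<open>'k\<close>-algebra on the set of all elements of \<open>'g\<close> (no linear structure of \<open>'g\<close> is used yet).\<close>

type_synonym ('g, 'k) free_alg = "'g free_monoid \<Rightarrow>\<^sub>0 'k"

definition mon_word :: "'g list \<Rightarrow> ('g, 'k::field) free_alg"
  where "mon_word gs = Poly_Mapping.single (Free_Monoid gs) 1"

definition scal :: "'k \<Rightarrow> ('g, 'k::field) free_alg"
  where "scal c = Poly_Mapping.single 0 c"

definition hom_part :: "nat \<Rightarrow> ('g, 'k::field) free_alg \<Rightarrow> ('g, 'k) free_alg"
  where "hom_part d f =
    (\<Sum>u \<in> {u \<in> Poly_Mapping.keys f. length (letters u) = d}.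
       Poly_Mapping.single u (Poly_Mapping.lookup f u))"

definition symmetrize :: "('g, 'k::field_char_0) free_alg \<Rightarrow> ('g, 'k) free_alg"
  where "symmetrize f =
    (\<Sum>u \<in> Poly_Mapping.keys f. scal (Poly_Mapping.lookup f u / fact (length (letters u))) *
       (\<Sum>\<sigma> | \<sigma> permutes {..<length (letters u)}. mon_word (permute_list \<sigma> (letters u))))"


section \<open>Special bipartitions\<close>

definition bipartition :: "'a set \<Rightarrow> 'b set \<Rightarrow> ('a set \<times> 'b set) set \<Rightarrow> bool"
  where "bipartition A1 A2 \<pi> \<longleftrightarrow>
    \<pi> \<subseteq> Pow A1 \<times> Pow A2 \<and>
    (\<forall>S\<in>\<pi>. \<forall>T\<in>\<pi>. S \<noteq> T \<longrightarrow> fst S \<inter> fst T = {} \<and> snd S \<inter> snd T = {}) \<and>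
    A1 = (\<Union>S\<in>\<pi>. fst S) \<and> A2 = (\<Union>S\<in>\<pi>. snd S)"

definition special_bipartition :: "'a set \<Rightarrow> 'b set \<Rightarrow> ('a set \<times> 'b set) set \<Rightarrow> bool"
  where "special_bipartition A1 A2 \<pi> \<longleftrightarrow>
    bipartition A1 A2 \<pi> \<and>
    (\<forall>S. ({}, S) \<in> \<pi> \<longrightarrow> card S = 1) \<and> (\<forall>S. (S, {}) \<in> \<pi> \<longrightarrow> card S = 1)"


section \<open>Lie algebras\<close>

locale lie_algebra = vector_space scale
  for scale :: "'k::field_char_0 \<Rightarrow> 'g::ab_group_add \<Rightarrow> 'g" (infixr \<open>*s\<close> 75) +
  fixes bracket :: "'g \<Rightarrow> 'g \<Rightarrow> 'g"
  assumes bracket_add_left: "bracket (x + y) z = bracket x z + bracket y z"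
    and bracket_add_right: "bracket x (y + z) = bracket x y + bracket x z"
    and bracket_scale_left: "bracket (c *s x) y = c *s bracket x y"
    and bracket_scale_right: "bracket x (c *s y) = c *s bracket x y"
    and bracket_self: "bracket x x = 0"
    and jacobi: "bracket x (bracket y z) + bracket y (bracket z x) + bracket z (bracket x y) = 0"
begin

subsection \<open>Symmetric and universal enveloping algebra\<close>

abbreviation FA :: "('g, 'k) free_alg ring"
  where "FA \<equiv> ring_of_type_algebra"

text \<open>The quotient of the free algebra by these relations is the tensor algebra of \<open>'g\<close>.\<close>

definition linear_relations :: "('g, 'k) free_alg set"
  where "linear_relations =
    {mon_word [g + h] - mon_word [g] - mon_word [h] | g h. True} \<union> {mon_word [c *s g] - scal c * mon_word [g] | c g. True}"

definition sym_ideal :: "('g, 'k) free_alg set"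
  where "sym_ideal = Idl\<^bsub>FA\<^esub> (linear_relations \<union> {mon_word [g, h] - mon_word [h, g] | g h. True})"

definition env_ideal :: "('g, 'k) free_alg set"
  where "env_ideal =
    Idl\<^bsub>FA\<^esub> (linear_relations \<union> {mon_word [g, h] - mon_word [h, g] - mon_word [bracket g h] | g h. True})"

definition Sym :: "('g, 'k) free_alg set ring"
  where "Sym = FA Quot sym_ideal"

definition Env :: "('g, 'k) free_alg set ring"
  where "Env = FA Quot env_ideal"

definition sym_embed :: "'g \<Rightarrow> ('g, 'k) free_alg set"
  where "sym_embed g = sym_ideal +>\<^bsub>FA\<^esub> mon_word [g]"

text \<open>The projection of \<open>Sym\<close> onto its degree \<open>d\<close> component. Here and in \<open>symmetrization\<close>, a map of
  cosets is induced from a linear map of the free algebra respecting the ideals, so the union is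
  over equal cosets; see the lemmas \<open>sym_part_mon\<close> and \<open>symmetrization_mon\<close> below.\<close>

definition sym_part :: "nat \<Rightarrow> ('g, 'k) free_alg set \<Rightarrow> ('g, 'k) free_alg set"
  where "sym_part d \<xi> = (\<Union>f\<in>\<xi>. sym_ideal +>\<^bsub>FA\<^esub> hom_part d f)"

definition symmetrization :: "('g, 'k) free_alg set \<Rightarrow> ('g, 'k) free_alg set"
  where "symmetrization \<xi> = (\<Union>f\<in>\<xi>. env_ideal +>\<^bsub>FA\<^esub> symmetrize f)"

subsection \<open>The operators \<open>B\<close> and \<open>B\<^sub>p\<close>\<close>

text \<open>Bilinear maps in curried form instead of linear maps on the tensor square of \<open>Sym\<close>.\<close>

definition B_op :: "('g, 'k) free_alg set \<Rightarrow> ('g, 'k) free_alg set \<Rightarrow> ('g, 'k) free_alg set"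
  where "B_op \<xi> \<eta> =
    inv_into (carrier Sym) symmetrization (symmetrization \<xi> \<otimes>\<^bsub>Env\<^esub> symmetrization \<eta>)"

definition B_part :: "nat \<Rightarrow> ('g, 'k) free_alg set \<Rightarrow> ('g, 'k) free_alg set \<Rightarrow> ('g, 'k) free_alg set"
  where "B_part p \<xi> \<eta> =
    finsum Sym (\<lambda>(a, b). sym_part (a + b - p) (B_op (sym_part a \<xi>) (sym_part b \<eta>)))
      {(a, b). sym_part a \<xi> \<noteq> \<zero>\<^bsub>Sym\<^esub> \<and> sym_part b \<eta> \<noteq> \<zero>\<^bsub>Sym\<^esub> \<and> p \<le> a + b}"

subsection \<open>The elements \<open>w\<close>\<close>

text \<open>Multi-indices are lists of elements of the sets \<open>A\<close>, \<open>B\<close> themselves, rather than of indices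
  enumerating them.\<close>

definition ad_list :: "'g list \<Rightarrow> 'g \<Rightarrow> 'g"
  where "ad_list \<alpha> v = foldr bracket \<alpha> v"

definition ad_alternating :: "'g list list \<Rightarrow> 'g list list \<Rightarrow> 'g \<Rightarrow> 'g"
  where "ad_alternating \<alpha>s \<beta>s v = foldr (\<lambda>(\<alpha>, \<beta>) u. ad_list \<alpha> (ad_list \<beta> u)) (zip \<alpha>s \<beta>s) v"

definition w_coeff :: "nat \<Rightarrow> 'g list list \<Rightarrow> 'g list list \<Rightarrow> 'k"
  where "w_coeff r \<alpha>s \<beta>s =
    ((- 1) ^ (r + 1) / of_nat r) /
      ((\<Prod>\<alpha>\<leftarrow>\<alpha>s. fact (length \<alpha>)) * (\<Prod>\<beta>\<leftarrow>\<beta>s. fact (length \<beta>)))"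

text \<open>As in Dynkin's formula, the last multi-index \<open>last \<alpha>s\<close> may be empty. An additional
  condition \<open>length (last \<alpha>s) \<ge> 1\<close> would be wrong: for \<open>A = {x}\<close>, \<open>B = {y}\<close>
  the term \<open>r = 2\<close>, \<open>\<alpha>s = [[x], []]\<close>, \<open>\<beta>s = [[]]\<close> contributes \<open>- 1/2 [x, y]\<close>, and without it one
  would get \<open>w A B = 3/4 [x, y]\<close> in place of \<open>1/2 [x, y]\<close>, the degree \<open>- 1\<close> part of
  \<open>x y = (x y + y x) / 2 + [x, y] / 2\<close>.\<close>

definition w1_indices :: "'g set \<Rightarrow> 'g set \<Rightarrow> (nat \<times> 'g list list \<times> 'g list list \<times> 'g) set"
  where "w1_indices A B = {(r, \<alpha>s, \<beta>s, l).
    r \<ge> 1 \<and> length \<alpha>s = r \<and> length \<beta>s = r - 1 \<and> l \<in> B \<and>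
    (\<forall>\<alpha>\<in>set \<alpha>s. distinct \<alpha> \<and> set \<alpha> \<subseteq> A) \<and> (\<forall>\<beta>\<in>set \<beta>s. distinct \<beta> \<and> set \<beta> \<subseteq> B) \<and>
    (\<Sum>\<alpha>\<leftarrow>\<alpha>s. length \<alpha>) = card A \<and> (\<Sum>\<beta>\<leftarrow>\<beta>s. length \<beta>) = card B - 1 \<and>
    (\<forall>i<r - 1. length (\<alpha>s ! i) + length (\<beta>s ! i) \<ge> 1) \<and>
    (\<Union>\<alpha>\<in>set \<alpha>s. set \<alpha>) = A \<and> {l} \<union> (\<Union>\<beta>\<in>set \<beta>s. set \<beta>) = B}"

definition w1 :: "'g set \<Rightarrow> 'g set \<Rightarrow> 'g"
  where "w1 A B = (\<Sum>(r, \<alpha>s, \<beta>s, l) \<in> w1_indices A B.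
    w_coeff r \<alpha>s \<beta>s *s ad_alternating (butlast \<alpha>s) \<beta>s (ad_list (last \<alpha>s) l))"

definition w2_indices :: "'g set \<Rightarrow> 'g set \<Rightarrow> (nat \<times> 'g list list \<times> 'g list list \<times> 'g) set"
  where "w2_indices A B = {(r, \<alpha>s, \<beta>s, l).
    r \<ge> 1 \<and> length \<alpha>s = r - 1 \<and> length \<beta>s = r - 1 \<and> l \<in> A \<and>
    (\<forall>\<alpha>\<in>set \<alpha>s. distinct \<alpha> \<and> set \<alpha> \<subseteq> A) \<and> (\<forall>\<beta>\<in>set \<beta>s. distinct \<beta> \<and> set \<beta> \<subseteq> B) \<and>
    (\<Sum>\<alpha>\<leftarrow>\<alpha>s. length \<alpha>) = card A - 1 \<and> (\<Sum>\<beta>\<leftarrow>\<beta>s. length \<beta>) = card B \<and>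
    (\<forall>i<r - 1. length (\<alpha>s ! i) + length (\<beta>s ! i) \<ge> 1) \<and>
    {l} \<union> (\<Union>\<alpha>\<in>set \<alpha>s. set \<alpha>) = A \<and> (\<Union>\<beta>\<in>set \<beta>s. set \<beta>) = B}"

definition w2 :: "'g set \<Rightarrow> 'g set \<Rightarrow> 'g"
  where "w2 A B = (\<Sum>(r, \<alpha>s, \<beta>s, l) \<in> w2_indices A B.
    w_coeff r \<alpha>s \<beta>s *s ad_alternating \<alpha>s \<beta>s l)"

definition w :: "'g set \<Rightarrow> 'g set \<Rightarrow> 'g"
  where "w A B =
    (if A \<noteq> {} \<and> B \<noteq> {} then (1 / of_nat (card A + card B)) *s (w1 A B + w2 A B)
     else if is_singleton A \<and> B = {} then the_elem A
     else if A = {} \<and> is_singleton B then the_elem B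
     else undefined)"

end


section \<open>Free Lie algebras\<close>

datatype ('k, 'a) lie_term =
    Gen 'a
  | Zero
  | Add "('k, 'a) lie_term" "('k, 'a) lie_term"
  | Scale 'k "('k, 'a) lie_term"
  | Bracket "('k, 'a) lie_term" "('k, 'a) lie_term"

text \<open>The congruence generated by the axioms of a Lie algebra.\<close>

inductive lie_eq :: "('k::field, 'a) lie_term \<Rightarrow> ('k, 'a) lie_term \<Rightarrow> bool"
  where
    lie_refl: "lie_eq s s"
  | lie_sym: "lie_eq s t \<Longrightarrow> lie_eq t s"
  | lie_trans: "lie_eq s t \<Longrightarrow> lie_eq t u \<Longrightarrow> lie_eq s u"
  | Add_cong: "lie_eq s s' \<Longrightarrow> lie_eq t t' \<Longrightarrow> lie_eq (Add s t) (Add s' t')"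
  | Scale_cong: "lie_eq s s' \<Longrightarrow> lie_eq (Scale c s) (Scale c s')"
  | Bracket_cong: "lie_eq s s' \<Longrightarrow> lie_eq t t' \<Longrightarrow> lie_eq (Bracket s t) (Bracket s' t')"
  | Add_assoc: "lie_eq (Add (Add s t) u) (Add s (Add t u))"
  | Add_comm: "lie_eq (Add s t) (Add t s)"
  | Add_Zero: "lie_eq (Add Zero s) s"
  | Add_inverse: "lie_eq (Add (Scale (- 1) s) s) Zero"
  | Scale_Add: "lie_eq (Scale c (Add s t)) (Add (Scale c s) (Scale c t))"
  | Scale_add: "lie_eq (Scale (c + d) s) (Add (Scale c s) (Scale d s))"
  | Scale_Scale: "lie_eq (Scale c (Scale d s)) (Scale (c * d) s)"
  | Scale_one: "lie_eq (Scale 1 s) s"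
  | Bracket_Add_left: "lie_eq (Bracket (Add s t) u) (Add (Bracket s u) (Bracket t u))"
  | Bracket_Add_right: "lie_eq (Bracket s (Add t u)) (Add (Bracket s t) (Bracket s u))"
  | Bracket_Scale_left: "lie_eq (Bracket (Scale c s) t) (Scale c (Bracket s t))"
  | Bracket_Scale_right: "lie_eq (Bracket s (Scale c t)) (Scale c (Bracket s t))"
  | Bracket_self: "lie_eq (Bracket s s) Zero"
  | Jacobi: "lie_eq (Add (Add (Bracket s (Bracket t u)) (Bracket t (Bracket u s)))
      (Bracket u (Bracket s t))) Zero"

quotient_type (overloaded) ('k, 'a) free_lie = "('k::field, 'a) lie_term" / lie_eq
  by (intro equivpI reflpI sympI transpI) (auto intro: lie_eq.lie_refl lie_eq.lie_sym lie_eq.lie_trans)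

instantiation free_lie :: (field, type) ab_group_add
begin

lift_definition zero_free_lie :: "('a, 'b) free_lie" is Zero .

lift_definition plus_free_lie :: "('a, 'b) free_lie \<Rightarrow> ('a, 'b) free_lie \<Rightarrow> ('a, 'b) free_lie" is Add
  by (rule lie_eq.Add_cong)

lift_definition uminus_free_lie :: "('a, 'b) free_lie \<Rightarrow> ('a, 'b) free_lie" is "Scale (- 1)"
  by (rule lie_eq.Scale_cong)

definition minus_free_lie :: "('a, 'b) free_lie \<Rightarrow> ('a, 'b) free_lie \<Rightarrow> ('a, 'b) free_lie"
  where "x - y = x + - (y :: ('a, 'b) free_lie)"

instance
proof
  fix x y z :: "('a, 'b) free_lie"
  show "x + y + z = x + (y + z)" by transfer (rule lie_eq.Add_assoc)
  show "x + y = y + x" by transfer (rule lie_eq.Add_comm)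
  show "0 + x = x" by transfer (rule lie_eq.Add_Zero)
  show "- x + x = 0" by transfer (rule lie_eq.Add_inverse)
qed (simp add: minus_free_lie_def)

end

lift_definition gen :: "'a \<Rightarrow> ('k::field, 'a) free_lie" is Gen .

lift_definition fl_scale :: "'k \<Rightarrow> ('k::field, 'a) free_lie \<Rightarrow> ('k, 'a) free_lie" is Scale
  by (rule lie_eq.Scale_cong)

lift_definition fl_bracket :: "('k::field, 'a) free_lie \<Rightarrow> ('k, 'a) free_lie \<Rightarrow> ('k, 'a) free_lie"
  is Bracket
  by (rule lie_eq.Bracket_cong)

global_interpretation free_lie:
  lie_algebra "fl_scale :: 'k::field_char_0 \<Rightarrow> ('k, 'a) free_lie \<Rightarrow> ('k, 'a) free_lie" fl_bracket
proof (unfold_locales, goal_cases)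
  case 1 show ?case by transfer (rule lie_eq.Scale_Add)
next
  case 2 show ?case by transfer (rule lie_eq.Scale_add)
next
  case 3 show ?case by transfer (rule lie_eq.Scale_Scale)
next
  case 4 show ?case by transfer (rule lie_eq.Scale_one)
next
  case 5 show ?case by transfer (rule lie_eq.Bracket_Add_left)
next
  case 6 show ?case by transfer (rule lie_eq.Bracket_Add_right)
next
  case 7 show ?case by transfer (rule lie_eq.Bracket_Scale_left)
next
  case 8 show ?case by transfer (rule lie_eq.Bracket_Scale_right)
next
  case 9 show ?case by transfer (rule lie_eq.Bracket_self)
next
  case 10 show ?case by transfer (rule lie_eq.Jacobi)
qed


section \<open>Well-definedness of the maps on quotients, universal property of the free Lie algebra\<close>

lemma ring_FA: "ring (ring_of_type_algebra :: ('g, 'k::field) free_alg ring)"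
proof -
  have "\<exists>y. x + y = 0" for x :: "('g, 'k) free_alg"
    using add.right_inverse by blast
  thus ?thesis
    unfolding ring_of_type_algebra_def using add.right_inverse
    by unfold_locales (auto simp: algebra_simps Units_def)
qed

lemma ideal_FA_iff:
  fixes I :: "('g, 'k::field) free_alg set"
  shows "ideal I ring_of_type_algebra \<longleftrightarrow>
    0 \<in> I \<and> (\<forall>f\<in>I. \<forall>g\<in>I. f - g \<in> I) \<and> (\<forall>f\<in>I. \<forall>a. a * f \<in> I \<and> f * a \<in> I)"
  (is "_ \<longleftrightarrow> ?R")
proof
  let ?F = "ring_of_type_algebra :: ('g, 'k) free_alg ring"
  interpret F: ring ?F by (rule ring_FA)
  have neg: "\<ominus>\<^bsub>?F\<^esub> x = - x" for x
    by (rule F.minus_equality) (auto simp: ring_of_type_algebra_def)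
  {
    assume I: "ideal I ?F"
    interpret ideal I ?F by (rule I)
    show ?R
    proof (intro conjI ballI allI)
      show "0 \<in> I" using zero_closed by (simp add: ring_of_type_algebra_def)
    next
      fix f g assume "f \<in> I" "g \<in> I"
      hence "f \<oplus>\<^bsub>?F\<^esub> (\<ominus>\<^bsub>?F\<^esub> g) \<in> I" by (intro a_closed a_inv_closed)
      thus "f - g \<in> I" unfolding neg by (simp add: ring_of_type_algebra_def)
    next
      fix f a assume "f \<in> I"
      thus "a * f \<in> I" "f * a \<in> I"
        using I_l_closed[of f a] I_r_closed[of f a] by (auto simp: ring_of_type_algebra_def)
    qed
  next
    assume R: ?R
    hence z: "0 \<in> I" and s: "\<And>f g. f \<in> I \<Longrightarrow> g \<in> I \<Longrightarrow> f - g \<in> I" by auto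
    have n: "- f \<in> I" if "f \<in> I" for f using s[OF z that] by simp
    have p: "f + g \<in> I" if "f \<in> I" "g \<in> I" for f g using s[OF that(1) n[OF that(2)]] by simp
    show "ideal I ?F"
    proof (rule idealI[OF ring_FA])
      show "subgroup I (add_monoid ?F)"
      proof (rule group.subgroupI)
        show "Group.group (add_monoid ?F)" by (rule F.add.group_axioms)
        fix a assume "a \<in> I"
        have "inv\<^bsub>add_monoid ?F\<^esub> a = - a" using neg[of a] by (simp add: a_inv_def)
        thus "inv\<^bsub>add_monoid ?F\<^esub> a \<in> I" using n[OF \<open>a \<in> I\<close>] by simp
      qed (use z p in \<open>auto simp: ring_of_type_algebra_def\<close>)
    qed (use R in \<open>auto simp: ring_of_type_algebra_def\<close>)
  }
qed

lemma coset_FA: "I +>\<^bsub>(ring_of_type_algebra :: ('g, 'k::field) free_alg ring)\<^esub> f = (\<lambda>h. h + f) ` I"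
  by (auto simp: a_r_coset_def' ring_of_type_algebra_def)

lemma induced_map:
  fixes I J :: "('g, 'k::field) free_alg set"
  assumes "ideal I ring_of_type_algebra" "ideal J ring_of_type_algebra"
    and add: "\<And>f g. \<phi> (f + g) = \<phi> f + \<phi> g" and sub: "\<And>f. f \<in> I \<Longrightarrow> \<phi> f \<in> J"
  shows "(\<Union>f\<in>I +>\<^bsub>ring_of_type_algebra\<^esub> f0. J +>\<^bsub>ring_of_type_algebra\<^esub> \<phi> f) =
    J +>\<^bsub>ring_of_type_algebra\<^esub> \<phi> f0"
proof -
  have J0: "0 \<in> J" and Jm: "\<And>f g. f \<in> J \<Longrightarrow> g \<in> J \<Longrightarrow> f - g \<in> J" and I0: "0 \<in> I"
    using assms(1,2) by (auto simp: ideal_FA_iff)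
  have Jp: "f + g \<in> J" if "f \<in> J" "g \<in> J" for f g
    using Jm[OF that(1) Jm[OF J0 that(2)]] by simp
  show ?thesis
    unfolding coset_FA
  proof (intro equalityI subsetI)
    fix z assume "z \<in> (\<lambda>h. h + \<phi> f0) ` J"
    thus "z \<in> (\<Union>f\<in>(\<lambda>h. h + f0) ` I. (\<lambda>h. h + \<phi> f) ` J)" using I0 by force
  next
    fix z assume "z \<in> (\<Union>f\<in>(\<lambda>h. h + f0) ` I. (\<lambda>h. h + \<phi> f) ` J)"
    then obtain h j where "h \<in> I" "j \<in> J" "z = j + \<phi> (h + f0)" by auto
    hence "z = (j + \<phi> h) + \<phi> f0" "j + \<phi> h \<in> J" using sub Jp by (auto simp: add algebra_simps)
    thus "z \<in> (\<lambda>h. h + \<phi> f0) ` J" by blast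
  qed
qed

lemma mon_mult: "mon_word us * mon_word vs = mon_word (us @ vs)"
  by (simp add: mon_word_def mult_single plus_free_monoid_def)

lemma const_mult_single: "scal c * Poly_Mapping.single u d = Poly_Mapping.single u (c * d)"
  by (simp add: scal_def mult_single)

lemma const_mult_const: "scal c * scal d = scal (c * d)"
  by (simp add: scal_def mult_single)

lemma const_add: "scal (c + d) = scal c + scal d"
  by (simp add: scal_def single_add)

lemma const_comm: "scal c * f = f * (scal c :: ('g, 'k::field) free_alg)"
proof (induction f rule: update_induct)
  case const
  thus ?case by simp
next
  case (update f a b)
  have "Poly_Mapping.update a b f = f + Poly_Mapping.single a b"
    using update(1) by (intro poly_mapping_eqI) (auto simp: lookup_update lookup_add lookup_single when_def in_keys_iff)
  thus ?case using update(3)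
    by (simp add: distrib_left distrib_right scal_def mult_single mult.commute)
qed

lemma poly_sum_mon:
  fixes f :: "('g, 'k::field) free_alg"
  shows "f = (\<Sum>u\<in>Poly_Mapping.keys f. scal (Poly_Mapping.lookup f u) * mon_word (letters u))"
  by (intro poly_mapping_eqI)
    (auto simp: mon_word_def const_mult_single lookup_sum lookup_single when_def in_keys_iff)

text \<open>Maps given by a monomialwise formula.\<close>

definition linext :: "('g list \<Rightarrow> ('g, 'k::field) free_alg) \<Rightarrow> ('g, 'k) free_alg \<Rightarrow> ('g, 'k) free_alg"
  where "linext F f = (\<Sum>u\<in>Poly_Mapping.keys f. scal (Poly_Mapping.lookup f u) * F (letters u))"

lemma linext_superset:
  assumes "finite U" "Poly_Mapping.keys f \<subseteq> U"
  shows "linext F f = (\<Sum>u\<in>U. scal (Poly_Mapping.lookup f u) * F (letters u))"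
  unfolding linext_def using assms
  by (intro sum.mono_neutral_left) (auto simp: in_keys_iff scal_def)

lemma linext_add: "linext F (f + g) = linext F f + linext F g"
proof -
  let ?U = "Poly_Mapping.keys f \<union> Poly_Mapping.keys g"
  have "Poly_Mapping.keys (f + g) \<subseteq> ?U" by (rule keys_add)
  thus ?thesis
    by (subst (1 2 3) linext_superset[of ?U])
      (auto simp: lookup_add const_add distrib_right sum.distrib)
qed

lemma linext_const: "linext F (scal c * f) = scal c * linext F f"
proof -
  have l: "Poly_Mapping.lookup (scal c * f) u = c * Poly_Mapping.lookup f u" for u
  proof -
    have "Poly_Mapping.lookup (scal c * (\<Sum>v\<in>V. scal (h v) * mon_word (letters v))) u =
        c * Poly_Mapping.lookup (\<Sum>v\<in>V. scal (h v) * mon_word (letters v)) u"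
      for h and V :: "'a free_monoid set"
      by (auto simp: sum_distrib_left lookup_sum mon_word_def const_mult_single lookup_single when_def
        intro!: sum.cong)
    from this[of "Poly_Mapping.lookup f" "Poly_Mapping.keys f"] show ?thesis
      unfolding poly_sum_mon[of f, symmetric] .
  qed
  hence "Poly_Mapping.keys (scal c * f) \<subseteq> Poly_Mapping.keys f" by (auto simp: in_keys_iff)
  thus ?thesis
    by (subst (1 2) linext_superset[of "Poly_Mapping.keys f"])
      (auto simp: l sum_distrib_left const_mult_const[symmetric] mult.assoc)
qed

lemma linext_mon: "linext F (mon_word us) = F us"
  by (simp add: linext_def mon_word_def scal_def)

lemma linext_uminus: "linext F (- f) = - linext F f"
  using linext_add[of F f "- f"] by (simp add: eq_neg_iff_add_eq_0 add.commute linext_def)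

lemma linext_diff: "linext F (f - g) = linext F f - linext F g"
  using linext_add[of F f "- g"] by (simp add: linext_uminus)

lemma linext_sum: "linext F (\<Sum>i\<in>A. h i) = (\<Sum>i\<in>A. linext F (h i))"
  by (induction A rule: infinite_finite_induct) (auto simp: linext_add, simp_all add: linext_def)

lemma linext_ideal:
  fixes J :: "('g, 'k::field) free_alg set"
  assumes J: "ideal J ring_of_type_algebra"
    and R: "\<And>us r vs. r \<in> R \<Longrightarrow> linext F (mon_word us * r * mon_word vs) \<in> J"
    and f: "f \<in> Idl\<^bsub>ring_of_type_algebra\<^esub> R"
  shows "linext F f \<in> J"
proof -
  have J0: "0 \<in> J" and Jm: "\<And>f g. f \<in> J \<Longrightarrow> g \<in> J \<Longrightarrow> f - g \<in> J"
    and Jl: "\<And>a f. f \<in> J \<Longrightarrow> a * f \<in> J"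
    using J by (auto simp: ideal_FA_iff)
  have Jp: "f + g \<in> J" if "f \<in> J" "g \<in> J" for f g
    using Jm[OF that(1) Jm[OF J0 that(2)]] by simp
  have Js: "(\<And>i. i \<in> A \<Longrightarrow> h i \<in> J) \<Longrightarrow> sum h A \<in> J" for h and A :: "'z set"
    by (induction A rule: infinite_finite_induct) (auto simp: J0 Jp)
  define K where "K = {f. \<forall>a b. linext F (a * f * b) \<in> J}"
  have "ideal K ring_of_type_algebra"
    unfolding ideal_FA_iff
  proof (intro conjI ballI allI)
    show "0 \<in> K" using J0 by (simp add: K_def linext_def)
    fix f assume f: "f \<in> K"
    show "f - g \<in> K" if "g \<in> K" for g
      using f that Jm by (simp add: K_def linext_diff left_diff_distrib right_diff_distrib)
    show "a * f \<in> K" for a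
      unfolding K_def
    proof (intro CollectI allI)
      fix c d
      have "c * (a * f) * d = (c * a) * f * d" by (simp add: mult.assoc)
      thus "linext F (c * (a * f) * d) \<in> J" using f by (simp only: K_def mem_Collect_eq)
    qed
    show "f * a \<in> K" for a
      unfolding K_def
    proof (intro CollectI allI)
      fix c d
      have "c * (f * a) * d = c * f * (a * d)" by (simp add: mult.assoc)
      thus "linext F (c * (f * a) * d) \<in> J" using f by (simp only: K_def mem_Collect_eq)
    qed
  qed
  moreover have "R \<subseteq> K"
  proof
    fix r assume r: "r \<in> R"
    have "linext F (a * r * b) \<in> J" for a b
    proof -
      have "a * r * b = (\<Sum>u\<in>Poly_Mapping.keys a. scal (Poly_Mapping.lookup a u) * mon_word (letters u)) * r *
          (\<Sum>v\<in>Poly_Mapping.keys b. scal (Poly_Mapping.lookup b v) * mon_word (letters v))"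
        by (simp flip: poly_sum_mon)
      also have "\<dots> = (\<Sum>u\<in>Poly_Mapping.keys a. \<Sum>v\<in>Poly_Mapping.keys b.
          scal (Poly_Mapping.lookup a u) * (scal (Poly_Mapping.lookup b v) *
            (mon_word (letters u) * r * mon_word (letters v))))"
        unfolding sum_distrib_right sum_distrib_left
      proof (subst sum.swap, rule sum.cong[OF refl], rule sum.cong[OF refl])
        fix u v
        show "scal (Poly_Mapping.lookup a u) * mon_word (letters u) * r *
            (scal (Poly_Mapping.lookup b v) * mon_word (letters v)) =
          scal (Poly_Mapping.lookup a u) * (scal (Poly_Mapping.lookup b v) *
            (mon_word (letters u) * r * mon_word (letters v)))"
          using const_comm[of "Poly_Mapping.lookup b v" "mon_word (letters u) * r"]
          unfolding mult.assoc[symmetric] by (simp add: mult.assoc)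
      qed
      finally show ?thesis
        by (simp only: linext_sum linext_const) (intro Js Jl R r)
    qed
    thus "r \<in> K" by (simp add: K_def)
  qed
  ultimately have "Idl\<^bsub>ring_of_type_algebra\<^esub> R \<subseteq> K" by (auto simp: genideal_def)
  hence "linext F (1 * f * 1) \<in> J" using f unfolding K_def by blast
  thus ?thesis by simp
qed

lemma hom_part_linext: "hom_part d = linext (\<lambda>us. if length us = d then mon_word us else 0)"
proof
  fix f :: "('g, 'k::field) free_alg"
  show "hom_part d f = linext (\<lambda>us. if length us = d then mon_word us else 0) f"
    unfolding hom_part_def linext_def
    by (intro sum.mono_neutral_cong_left) (auto simp: mon_word_def const_mult_single)
qed

lemma symmetrize_linext: "symmetrize = linext (\<lambda>us. scal (1 / fact (length us)) *
   (\<Sum>\<sigma> | \<sigma> permutes {..<length us}. mon_word (permute_list \<sigma> us)))"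
proof
  fix f :: "('g, 'k::field_char_0) free_alg"
  show "symmetrize f = linext (\<lambda>us. scal (1 / fact (length us)) *
   (\<Sum>\<sigma> | \<sigma> permutes {..<length us}. mon_word (permute_list \<sigma> us))) f"
    unfolding symmetrize_def linext_def
    by (simp add: const_mult_const flip: mult.assoc)
qed

lemma permute_list_update:
  assumes "\<sigma> permutes {..<length xs}" "k < length xs"
  shows "permute_list \<sigma> (xs[k := v]) = (permute_list \<sigma> xs)[inv_into UNIV \<sigma> k := v]"
proof -
  have "inv_into UNIV \<sigma> k = i \<longleftrightarrow> k = \<sigma> i" for i
    using permutes_inverses[OF assms(1)] by metis
  moreover have "inv_into UNIV \<sigma> (\<sigma> i) = i" for i
    using permutes_inverses[OF assms(1)] by metis
  ultimately show ?thesis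
    using assms permutes_in_image[OF assms(1)]
    by (intro nth_equalityI) (auto simp: permute_list_def nth_list_update)
qed

context lie_algebra begin

lemma ideal_sym_ideal: "ideal sym_ideal FA" and ideal_env_ideal: "ideal env_ideal FA"
  unfolding sym_ideal_def env_ideal_def
  by (rule ring.genideal_ideal[OF ring_FA], simp add: ring_of_type_algebra_def)+

lemma env_ideal_contains: "linear_relations \<subseteq> env_ideal"
  unfolding env_ideal_def genideal_def by auto

lemma mid_relation:
  assumes "ideal I FA" "linear_relations \<subseteq> I"
  shows "mon_word (us @ [g + h] @ vs) - mon_word (us @ [g] @ vs) - mon_word (us @ [h] @ vs) \<in> I"
    "mon_word (us @ [c *s g] @ vs) - scal c * mon_word (us @ [g] @ vs) \<in> I"
proof -
  have I: "a * r * b \<in> I" if "r \<in> linear_relations" for a b r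
    using assms that unfolding ideal_FA_iff by blast
  have "mon_word us * (mon_word [g + h] - mon_word [g] - mon_word [h]) * mon_word vs \<in> I"
    by (rule I) (auto simp: linear_relations_def)
  thus "mon_word (us @ [g + h] @ vs) - mon_word (us @ [g] @ vs) - mon_word (us @ [h] @ vs) \<in> I"
    by (simp add: left_diff_distrib right_diff_distrib mon_mult)
  have "mon_word us * (mon_word [c *s g] - scal c * mon_word [g]) * mon_word vs \<in> I"
    by (rule I) (auto simp: linear_relations_def)
  moreover have "mon_word us * (scal c * mon_word [g]) * mon_word vs = scal c * mon_word (us @ [g] @ vs)"
    by (metis const_comm mon_mult mult.assoc append.assoc)
  ultimately show "mon_word (us @ [c *s g] @ vs) - scal c * mon_word (us @ [g] @ vs) \<in> I"
    by (simp add: left_diff_distrib right_diff_distrib mon_mult)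
qed

lemma symmetrize_sym_ideal:
  assumes "f \<in> sym_ideal" shows "symmetrize f \<in> env_ideal"
proof -
  define P where "P us = (\<Sum>\<sigma> | \<sigma> permutes {..<length us}. mon_word (permute_list \<sigma> us) :: ('g,'k) free_alg)" for us
  have J0: "0 \<in> env_ideal" and Jm: "\<And>f g. f \<in> env_ideal \<Longrightarrow> g \<in> env_ideal \<Longrightarrow> f - g \<in> env_ideal"
    and Jl: "\<And>a f. f \<in> env_ideal \<Longrightarrow> a * f \<in> env_ideal"
    using ideal_env_ideal by (auto simp: ideal_FA_iff)
  have Jp: "f + g \<in> env_ideal" if "f \<in> env_ideal" "g \<in> env_ideal" for f g
    using Jm[OF that(1) Jm[OF J0 that(2)]] by simp
  have Js: "(\<And>i. i \<in> A \<Longrightarrow> h i \<in> env_ideal) \<Longrightarrow> sum h A \<in> env_ideal" for h and A :: "'z set"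
    by (induction A rule: infinite_finite_induct) (auto simp: J0 Jp)
  have mid: "\<exists>as bs. \<forall>v. permute_list \<sigma> (us @ [v] @ vs) = as @ [v] @ bs"
    if \<sigma>: "\<sigma> permutes {..<Suc (length us + length vs)}" for \<sigma> and us vs :: "'g list"
  proof (intro exI allI)
    let ?x = "us @ [0] @ vs" and ?k = "length us"
    let ?y = "permute_list \<sigma> ?x" and ?j = "inv_into UNIV \<sigma> (length us)"
    fix v
    have \<sigma>': "\<sigma> permutes {..<length ?x}" using \<sigma> by simp
    have "?j \<in> {..<length ?x}"
      using permutes_in_image[OF permutes_inv[OF \<sigma>'], of "length us"] by simp
    hence j: "?j < length ?y" by simp
    have "us @ [v] @ vs = ?x[?k := v]" by simp
    hence "permute_list \<sigma> (us @ [v] @ vs) = ?y[?j := v]"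
      using permute_list_update[OF \<sigma>', of ?k v] by simp
    also have "\<dots> = take ?j ?y @ [v] @ drop (Suc ?j) ?y"
      using upd_conv_take_nth_drop[OF j] by simp
    finally show "permute_list \<sigma> (us @ [v] @ vs) = take ?j ?y @ [v] @ drop (Suc ?j) ?y" .
  qed
  have Pperm: "P us = P vs" if ms: "mset us = mset vs" for us vs
  proof -
    obtain \<tau> where \<tau>: "\<tau> permutes {..<length vs}" "permute_list \<tau> vs = us"
      by (rule mset_eq_permutation[OF ms])
    have len: "length us = length vs" using ms mset_eq_length by blast
    have "P us = (\<Sum>\<sigma> | \<sigma> permutes {..<length vs}. mon_word (permute_list (\<tau> \<circ> \<sigma>) vs))"
      unfolding P_def len
      by (intro sum.cong refl) (auto simp: permute_list_compose \<tau>(2)[symmetric])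
    also have "\<dots> = P vs"
      unfolding P_def
      by (rule setum_permutations_compose_left[OF \<tau>(1), symmetric])
    finally show ?thesis .
  qed
  show ?thesis
    unfolding symmetrize_linext
  proof (rule linext_ideal[OF ideal_env_ideal _ assms[unfolded sym_ideal_def]])
    fix us vs :: "'g list" and r :: "('g,'k) free_alg"
    assume "r \<in> linear_relations \<union> {mon_word [g, h] - mon_word [h, g] |g h. True}"
    then consider (a) g h where "r = mon_word [g + h] - mon_word [g] - mon_word [h]"
      | (b) c g where "r = mon_word [c *s g] - scal c * mon_word [g]"
      | (c) g h where "r = mon_word [g, h] - mon_word [h, g]"
      by (auto simp: linear_relations_def)
    thus "linext (\<lambda>us. scal (1 / fact (length us)) * (\<Sum>\<sigma> | \<sigma> permutes {..<length us}. mon_word (permute_list \<sigma> us)))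
        (mon_word us * r * mon_word vs) \<in> env_ideal"
      unfolding P_def[symmetric]
    proof cases
      case a
      have e: "mon_word us * r * mon_word vs = mon_word (us @ [g + h] @ vs) - mon_word (us @ [g] @ vs) - mon_word (us @ [h] @ vs)"
        by (simp add: a left_diff_distrib right_diff_distrib mon_mult)
      have "P (us @ [g + h] @ vs) - P (us @ [g] @ vs) - P (us @ [h] @ vs) \<in> env_ideal"
        unfolding P_def length_append list.size
        unfolding sum_subtractf[symmetric]
      proof (intro Js, goal_cases)
        case (1 \<sigma>)
        then obtain as bs where "\<forall>v. permute_list \<sigma> (us @ [v] @ vs) = as @ [v] @ bs"
          using mid[of \<sigma> us vs] by auto
        thus ?case using mid_relation(1)[OF ideal_env_ideal env_ideal_contains] by simp
      qed
      from Jl[OF this, of "scal (1 / fact (Suc (length us + length vs)))"]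
      show "linext (\<lambda>us. scal (1 / fact (length us)) * P us) (mon_word us * r * mon_word vs) \<in> env_ideal"
        unfolding e linext_diff linext_mon by (simp add: right_diff_distrib)
    next
      case b
      have e: "mon_word us * r * mon_word vs = mon_word (us @ [c *s g] @ vs) - scal c * mon_word (us @ [g] @ vs)"
      proof -
        have "mon_word us * (scal c * mon_word [g]) * mon_word vs = scal c * mon_word (us @ [g] @ vs)"
          by (metis const_comm mon_mult mult.assoc append.assoc)
        thus ?thesis by (simp add: b left_diff_distrib right_diff_distrib mon_mult)
      qed
      have "P (us @ [c *s g] @ vs) - scal c * P (us @ [g] @ vs) \<in> env_ideal"
        unfolding P_def length_append list.size
        unfolding sum_distrib_left sum_subtractf[symmetric]
      proof (intro Js, goal_cases)
        case (1 \<sigma>)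
        then obtain as bs where "\<forall>v. permute_list \<sigma> (us @ [v] @ vs) = as @ [v] @ bs"
          using mid[of \<sigma> us vs] by auto
        thus ?case using mid_relation(2)[OF ideal_env_ideal env_ideal_contains] by simp
      qed
      from Jl[OF this, of "scal (1 / fact (Suc (length us + length vs)))"]
      show "linext (\<lambda>us. scal (1 / fact (length us)) * P us) (mon_word us * r * mon_word vs) \<in> env_ideal"
        unfolding e linext_diff linext_const linext_mon
        by (simp add: right_diff_distrib const_mult_const mult.commute flip: mult.assoc)
    next
      case c
      have e: "mon_word us * r * mon_word vs = mon_word (us @ [g, h] @ vs) - mon_word (us @ [h, g] @ vs)"
        by (simp add: c left_diff_distrib right_diff_distrib mon_mult)
      have "P (us @ [g, h] @ vs) = P (us @ [h, g] @ vs)" by (rule Pperm) simp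
      thus "linext (\<lambda>us. scal (1 / fact (length us)) * P us) (mon_word us * r * mon_word vs) \<in> env_ideal"
        unfolding e linext_diff linext_mon using J0 by simp
    qed
  qed
qed

lemma symmetrization_mon:
  "symmetrization (sym_ideal +>\<^bsub>FA\<^esub> mon_word gs) = env_ideal +>\<^bsub>FA\<^esub> (scal (1 / fact (length gs)) *
     (\<Sum>\<sigma> | \<sigma> permutes {..<length gs}. mon_word (permute_list \<sigma> gs)))"
proof -
  have "symmetrization (sym_ideal +>\<^bsub>FA\<^esub> mon_word gs) = env_ideal +>\<^bsub>FA\<^esub> symmetrize (mon_word gs)"
    unfolding symmetrization_def
    by (rule induced_map[OF ideal_sym_ideal ideal_env_ideal])
      (auto simp: symmetrize_sym_ideal, simp add: symmetrize_linext linext_add)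
  thus ?thesis by (simp add: symmetrize_linext linext_mon)
qed

lemma sym_part_mon:
  "sym_part d (sym_ideal +>\<^bsub>FA\<^esub> mon_word gs) =
    (if length gs = d then sym_ideal +>\<^bsub>FA\<^esub> mon_word gs else \<zero>\<^bsub>Sym\<^esub>)"
proof -
  have z: "\<zero>\<^bsub>Sym\<^esub> = sym_ideal +>\<^bsub>FA\<^esub> 0" by (simp add: Sym_def FactRing_def coset_FA)
  have J0: "0 \<in> sym_ideal" using ideal_sym_ideal by (auto simp: ideal_FA_iff)
  have lin: "linear_relations \<subseteq> sym_ideal" unfolding sym_ideal_def genideal_def by auto
  have comm: "mon_word [g, h] - mon_word [h, g] \<in> sym_ideal" for g h unfolding sym_ideal_def genideal_def by blast
  have "hom_part d f \<in> sym_ideal" if "f \<in> sym_ideal" for f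
    unfolding hom_part_linext
  proof (rule linext_ideal[OF ideal_sym_ideal _ that[unfolded sym_ideal_def]])
    fix us vs :: "'g list" and r :: "('g,'k) free_alg"
    assume "r \<in> linear_relations \<union> {mon_word [g, h] - mon_word [h, g] |g h. True}"
    then consider (a) g h where "r = mon_word [g + h] - mon_word [g] - mon_word [h]"
      | (b) c g where "r = mon_word [c *s g] - scal c * mon_word [g]"
      | (c) g h where "r = mon_word [g, h] - mon_word [h, g]"
      by (auto simp: linear_relations_def)
    thus "linext (\<lambda>us. if length us = d then mon_word us else 0) (mon_word us * r * mon_word vs) \<in> sym_ideal"
    proof cases
      case a
      have e: "mon_word us * r * mon_word vs = mon_word (us @ [g + h] @ vs) - mon_word (us @ [g] @ vs) - mon_word (us @ [h] @ vs)"
        by (simp add: a left_diff_distrib right_diff_distrib mon_mult)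
      show ?thesis unfolding e linext_diff linext_mon
        using mid_relation(1)[OF ideal_sym_ideal lin, of us g h vs] J0 by simp
    next
      case b
      have "mon_word us * (scal c * mon_word [g]) * mon_word vs = scal c * mon_word (us @ [g] @ vs)"
        by (metis const_comm mon_mult mult.assoc append.assoc)
      hence e: "mon_word us * r * mon_word vs = mon_word (us @ [c *s g] @ vs) - scal c * mon_word (us @ [g] @ vs)"
        by (simp add: b left_diff_distrib right_diff_distrib mon_mult)
      show ?thesis unfolding e linext_diff linext_const linext_mon
        using mid_relation(2)[OF ideal_sym_ideal lin, of us c g vs] J0 by simp
    next
      case c
      have e: "mon_word us * r * mon_word vs = mon_word (us @ [g, h] @ vs) - mon_word (us @ [h, g] @ vs)"
        by (simp add: c left_diff_distrib right_diff_distrib mon_mult)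
      have "mon_word us * r * mon_word vs \<in> sym_ideal"
        using comm[of g h] ideal_sym_ideal unfolding c ideal_FA_iff by blast
      thus ?thesis using J0 unfolding e linext_diff linext_mon by simp
    qed
  qed
  hence "sym_part d (sym_ideal +>\<^bsub>FA\<^esub> mon_word gs) = sym_ideal +>\<^bsub>FA\<^esub> hom_part d (mon_word gs)"
    unfolding sym_part_def
    by (intro induced_map[OF ideal_sym_ideal ideal_sym_ideal]) (auto simp: hom_part_linext linext_add)
  thus ?thesis by (simp add: hom_part_linext linext_mon z)
qed

end

lemma free_lie_universal:
  fixes sc :: "'k::field_char_0 \<Rightarrow> 'g::ab_group_add \<Rightarrow> 'g" and f :: "'a \<Rightarrow> 'g"
  assumes "lie_algebra sc br"
  shows "\<exists>!\<phi> :: ('k, 'a) free_lie \<Rightarrow> 'g. (\<forall>s t. \<phi> (s + t) = \<phi> s + \<phi> t) \<and> (\<forall>c s. \<phi> (fl_scale c s) = sc c (\<phi> s)) \<and>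
    (\<forall>s t. \<phi> (fl_bracket s t) = br (\<phi> s) (\<phi> t)) \<and> (\<forall>a. \<phi> (gen a) = f a)"
proof -
  interpret lie_algebra sc br by fact
  define ev where "ev = rec_lie_term f 0 (\<lambda>_ _ a b. a + b) (\<lambda>c _ a. sc c a) (\<lambda>_ _ a b. br a b)"
  have ev: "ev (Gen a) = f a" "ev Zero = 0" "ev (Add s t) = ev s + ev t" "ev (Scale c s) = sc c (ev s)"
    "ev (Bracket s t) = br (ev s) (ev t)" for a s t c by (auto simp: ev_def)
  have eq: "lie_eq s t \<Longrightarrow> ev s = ev t" for s t
    by (induction rule: lie_eq.induct)
      (auto simp: ev bracket_add_left bracket_add_right bracket_scale_left bracket_scale_right
        bracket_self jacobi[simplified add.assoc] scale_left_distrib scale_right_distrib algebra_simps)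
  define \<phi> where "\<phi> s = ev (rep_free_lie s)" for s :: "('k,'a) free_lie"
  have \<phi>: "\<phi> (abs_free_lie t) = ev t" for t
    unfolding \<phi>_def by (rule eq) (metis Quotient3_free_lie Quotient3_rel_rep rep_abs_rsp_left lie_eq.lie_refl)
  have ab: "\<exists>t. s = abs_free_lie t" for s :: "('k,'a) free_lie"
    by (metis Quotient3_abs_rep Quotient3_free_lie)
  show ?thesis
  proof (rule ex1I[of _ \<phi>], intro conjI allI)
    show "\<phi> (s + t) = \<phi> s + \<phi> t" for s t
      using ab[of s] ab[of t] by (auto simp: \<phi> ev plus_free_lie.abs_eq)
    show "\<phi> (fl_scale c s) = sc c (\<phi> s)" for c s
      using ab[of s] by (auto simp: \<phi> ev fl_scale.abs_eq)
    show "\<phi> (fl_bracket s t) = br (\<phi> s) (\<phi> t)" for s t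
      using ab[of s] ab[of t] by (auto simp: \<phi> ev fl_bracket.abs_eq)
    show "\<phi> (gen a) = f a" for a by (auto simp: \<phi> ev gen.abs_eq)
  next
    fix \<psi> :: "('k,'a) free_lie \<Rightarrow> 'g" assume \<psi>: "(\<forall>s t. \<psi> (s + t) = \<psi> s + \<psi> t) \<and> (\<forall>c s. \<psi> (fl_scale c s) = sc c (\<psi> s)) \<and>
      (\<forall>s t. \<psi> (fl_bracket s t) = br (\<psi> s) (\<psi> t)) \<and> (\<forall>a. \<psi> (gen a) = f a)"
    have z: "\<psi> 0 = 0" using \<psi> by (metis add_cancel_left_right)
    have "\<psi> (abs_free_lie t) = ev t" for t
      by (induction t) (use \<psi> z in \<open>auto simp: ev simp flip: gen.abs_eq zero_free_lie.abs_eq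
         plus_free_lie.abs_eq fl_scale.abs_eq fl_bracket.abs_eq\<close>)
    thus "\<psi> = \<phi>" using ab \<phi> by (metis ext)
  qed
qed

end

theory Submission
  imports Defs "HOL-Computational_Algebra.Formal_Power_Series" "HOL-Library.Disjoint_Sets"
    "HOL-Combinatorics.Multiset_Permutations" "HOL-Library.Product_Plus"
begin

text \<open>
  The product of two symmetrized monomials is a coefficient of a product of two exponentials. Let
  \<open>X = \<Sum> t\<^sub>i x\<^sub>i\<close> and \<open>Y = \<Sum> s\<^sub>j y\<^sub>j\<close> with central variables of square zero. The coefficient of \<open>e\<^sup>X\<close> at
  \<open>t\<^sub>1 \<cdots> t\<^sub>n\<close> is the symmetrization of \<open>x\<^sub>1 \<cdots> x\<^sub>n\<close>, so the symmetrizations of the two arguments of \<open>B\<close> have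
  as their product the coefficient of \<open>e\<^sup>X e\<^sup>Y\<close> at \<open>t\<^sub>1 \<cdots> t\<^sub>n s\<^sub>1 \<cdots> s\<^sub>m\<close>. Write \<open>e\<^sup>X e\<^sup>Y = e\<^sup>Z\<close>. Expanding \<open>e\<^sup>Z\<close>, the same
  coefficient is the sum over all set partitions of the variables of the symmetrized products of the
  coefficients of \<open>Z\<close> at the blocks (\<open>coef_exp_series_partitions\<close>). It remains to identify the coefficients
  of \<open>Z\<close> and to undo the symmetrization.

  The coefficients of \<open>Z\<close> are Lie elements (\<open>log_exp_exp_is_lie\<close>). Comparing two expressions for
  \<open>D(e\<^sup>Z) e\<^sup>-\<^sup>Z\<close>, where \<open>D\<close> is the Euler derivation, yields
  \<open>((e\<^bsup>ad Z\<^esup> - 1) / ad Z)(D Z) = X + e\<^bsup>ad X\<^esup> Y\<close>, which expresses each coefficient of \<open>Z\<close> by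
  brackets of coefficients at smaller sets. To find them explicitly, the map sending a word to its
  right-nested bracket is applied to the expansion of \<open>Z = ln (1 + (e\<^sup>X e\<^sup>Y - 1))\<close> into words: it multiplies a Lie
  element of degree \<open>d\<close> by \<open>d\<close> (\<open>lie_degree_dynkin\<close>), and it turns the expansion into \<open>w1 + w2\<close>, as the terms in
  which the last two letters lie in the same multi-index cancel (\<open>sum_swappable\<close>). Hence the coefficient at a block
  that meets both groups of letters is \<open>w\<close> (\<open>coef_bch_w\<close>). For a block within one group \<open>Z\<close> may be replaced
  by \<open>X\<close> or \<open>Y\<close>, so the coefficient is a single letter or zero; this leaves exactly the special bipartitions.

  The symmetrization map is injective (\<open>symmetrize_injective\<close>), so that applying its inverse is legitimate. For a
  Lie algebra with an invertible derivation \<open>E\<close> there is a short argument: \<open>g \<mapsto> E g \<cdot> + ad g\<close> defines an action of the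
  enveloping algebra on the symmetric algebra, and acting on \<open>1\<close> recovers the top degree part of a symmetrized
  element up to \<open>E\<close>. A free Lie algebra has such a derivation, multiplication by the degree
  (\<open>bij_free_lie_derivation\<close>).
\<close>

section \<open>Power series in square-zero variables\<close>

lemma of_nat_left_commute: "a * (of_nat n * b) = of_nat n * (a * b :: 'a::ring_1)"
  by (simp only: mult.assoc[symmetric] mult_of_nat_commute[of n a])

text \<open>A function \<open>F\<close> on finite sets of variables stands for the power series \<open>\<Sum>\<^sub>S F(S) \<Prod>\<^bsub>v\<in>S\<^esub> t\<^sub>v\<close> in central
  variables with \<open>t\<^sub>v\<^sup>2 = 0\<close>. Multilinear identities in many noncommuting letters become identities
  between such series in a single ring, where \<open>exp\<close> and \<open>ln\<close> make sense. The value on infinite sets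
  is fixed to be \<open>0\<close> so that a series is determined by its coefficients at finite sets.\<close>

typedef (overloaded) ('v, 'a::zero) set_series = "{F :: 'v set \<Rightarrow> 'a. \<forall>S. infinite S \<longrightarrow> F S = 0}"
  morphisms coef Set_Series
  by (rule exI[of _ "\<lambda>_. 0"]) simp

setup_lifting type_definition_set_series

lemma coef_infinite: "infinite S \<Longrightarrow> coef F S = 0"
  using coef[of F] by simp

lemma set_series_eqI:
  assumes "\<And>S. finite S \<Longrightarrow> coef F S = coef G S"
  shows "F = G"
proof -
  have "coef F S = coef G S" for S
    using assms[of S] coef_infinite[of S F] coef_infinite[of S G] by (cases "finite S") simp_all
  hence "coef F = coef G" by (rule ext)
  thus ?thesis by (simp only: coef_inject)
qed

instantiation set_series :: (type, ring_1) ring_1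
begin

lift_definition zero_set_series :: "('a, 'b) set_series" is "\<lambda>_. 0" by simp
lift_definition one_set_series :: "('a, 'b) set_series" is "\<lambda>S. if S = {} then 1 else 0" by auto
lift_definition plus_set_series :: "('a, 'b) set_series \<Rightarrow> ('a, 'b) set_series \<Rightarrow> ('a, 'b) set_series"
  is "\<lambda>F G S. F S + G S" by simp
lift_definition minus_set_series :: "('a, 'b) set_series \<Rightarrow> ('a, 'b) set_series \<Rightarrow> ('a, 'b) set_series"
  is "\<lambda>F G S. F S - G S" by simp
lift_definition uminus_set_series :: "('a, 'b) set_series \<Rightarrow> ('a, 'b) set_series"
  is "\<lambda>F S. - F S" by simp
lift_definition times_set_series :: "('a, 'b) set_series \<Rightarrow> ('a, 'b) set_series \<Rightarrow> ('a, 'b) set_series"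
  is "\<lambda>F G S. \<Sum>T\<in>Pow S. F T * G (S - T)" by simp

instance
proof
  fix F G H :: "('a, 'b) set_series"
  show "F * G * H = F * (G * H)"
  proof (rule set_series_eqI)
    fix S :: "'a set" assume S: "finite S"
    have fin: "T \<subseteq> S \<Longrightarrow> finite T" for T by (rule finite_subset[OF _ S])
    have "coef (F * G * H) S = (\<Sum>T\<in>Pow S. \<Sum>U\<in>Pow T. coef F U * coef G (T - U) * coef H (S - T))"
      by (simp add: times_set_series.rep_eq sum_distrib_right)
    also have "\<dots> = (\<Sum>(T, U)\<in>(SIGMA T:Pow S. Pow T). coef F U * coef G (T - U) * coef H (S - T))"
      using S fin by (subst sum.Sigma) auto
    also have "\<dots> = (\<Sum>(U, W)\<in>(SIGMA U:Pow S. Pow (S - U)). coef F U * (coef G W * coef H (S - U - W)))"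
    proof (rule sum.reindex_bij_witness[of _ "\<lambda>(U, W). (U \<union> W, U)" "\<lambda>(T, U). (U, T - U)"]; clarify)
      fix T U x assume "T \<subseteq> S" "U \<subseteq> T"
      hence "S - U - (T - U) = S - T" by blast
      thus "coef F U * (coef G (T - U) * coef H (S - U - (T - U))) = coef F U * coef G (T - U) * coef H (S - T)"
        by (simp add: mult.assoc)
    qed auto
    also have "\<dots> = (\<Sum>U\<in>Pow S. \<Sum>W\<in>Pow (S - U). coef F U * (coef G W * coef H (S - U - W)))"
      using S fin by (subst sum.Sigma) auto
    finally show "coef (F * G * H) S = coef (F * (G * H)) S"
      by (simp add: times_set_series.rep_eq sum_distrib_left)
  qed
  show "1 * F = F"
  proof (rule set_series_eqI)
    fix S :: "'a set" assume "finite S"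
    have "(\<Sum>T\<in>Pow S. (if T = {} then 1 else 0) * coef F (S - T)) = (\<Sum>T\<in>{{}}. coef F (S - T))"
      using \<open>finite S\<close> by (intro sum.mono_neutral_cong_right) auto
    thus "coef (1 * F) S = coef F S" by (simp add: times_set_series.rep_eq one_set_series.rep_eq)
  qed
  show "F * 1 = F"
  proof (rule set_series_eqI)
    fix S :: "'a set" assume "finite S"
    have "(\<Sum>T\<in>Pow S. coef F T * (if S - T = {} then 1 else 0)) = (\<Sum>T\<in>{S}. coef F T)"
      using \<open>finite S\<close> by (intro sum.mono_neutral_cong_right) auto
    thus "coef (F * 1) S = coef F S" by (simp add: times_set_series.rep_eq one_set_series.rep_eq)
  qed
  show "(F + G) * H = F * H + G * H" "F * (G + H) = F * G + F * H"
    by (rule set_series_eqI, simp add: times_set_series.rep_eq plus_set_series.rep_eq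
      distrib_right distrib_left sum.distrib)+
  have "coef (0 :: ('a, 'b) set_series) {} \<noteq> coef 1 {}"
    by (simp add: zero_set_series.rep_eq one_set_series.rep_eq)
  thus "(0::('a, 'b) set_series) \<noteq> 1" by metis
qed (rule set_series_eqI, simp add: zero_set_series.rep_eq plus_set_series.rep_eq minus_set_series.rep_eq uminus_set_series.rep_eq algebra_simps)+

end

lemmas coef_simps = zero_set_series.rep_eq one_set_series.rep_eq plus_set_series.rep_eq
  minus_set_series.rep_eq uminus_set_series.rep_eq

lemmas coef_mult = times_set_series.rep_eq

lemma coef_sum: "coef (\<Sum>i\<in>I. F i) S = (\<Sum>i\<in>I. coef (F i) S)"
  by (induction I rule: infinite_finite_induct) (auto simp: coef_simps)

lemma coef_mult_empty [simp]: "coef (F * G) {} = coef F {} * coef G {}"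
  by (simp add: coef_mult)

text \<open>The order filtration that gives infinite sums and substitution into formal power series a
  meaning. Infinite sets have cardinality \<open>0\<close>, which is harmless since coefficients vanish there.\<close>

definition order_ge :: "nat \<Rightarrow> ('v, 'a::ring_1) set_series \<Rightarrow> bool"
  where "order_ge n F \<longleftrightarrow> (\<forall>S. card S < n \<longrightarrow> coef F S = 0)"

lemma order_ge_0 [simp]: "order_ge 0 F"
  by (simp add: order_ge_def)

lemma order_ge_1: "order_ge 1 F \<longleftrightarrow> coef F {} = 0"
proof
  assume "order_ge 1 F"
  thus "coef F {} = 0" unfolding order_ge_def by (metis card.empty less_one)
next
  assume "coef F {} = 0"
  thus "order_ge 1 F" unfolding order_ge_def less_one card_eq_0_iff by (metis coef_infinite)
qed

lemma order_ge_diff: "order_ge n F \<Longrightarrow> order_ge n G \<Longrightarrow> order_ge n (F - G)"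
  by (auto simp: order_ge_def coef_simps)

lemma order_ge_mult:
  assumes "order_ge m F" "order_ge n G"
  shows "order_ge (m + n) (F * G)"
  unfolding order_ge_def coef_mult
proof (intro allI impI sum.neutral ballI)
  fix S T :: "'a set" assume S: "card S < m + n" "T \<in> Pow S"
  show "coef F T * coef G (S - T) = 0"
  proof (cases "finite S")
    case True
    hence "card S = card T + card (S - T)"
      using S(2) by (metis PowD card_Diff_subset card_mono finite_subset le_add_diff_inverse)
    hence "card T < m \<or> card (S - T) < n" using S by linarith
    thus ?thesis using assms by (auto simp: order_ge_def)
  next
    case False
    hence "infinite T \<or> infinite (S - T)" by (metis finite_Diff2)
    thus ?thesis by (elim disjE) (simp_all add: coef_infinite)
  qed
qed

lemma order_ge_power: "order_ge 1 N \<Longrightarrow> order_ge n (N ^ n)"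
proof (induction n)
  case (Suc n)
  thus ?case using order_ge_mult[of 1 N n "N ^ n"] by simp
qed simp

text \<open>The infinite sum \<open>\<Sum>\<^sub>n f n\<close>, meant for summands with \<open>order_ge n (f n)\<close>. Truncating at \<open>card S\<close>
  keeps every coefficient a finite sum.\<close>

lift_definition series :: "(nat \<Rightarrow> ('v, 'a::ring_1) set_series) \<Rightarrow> ('v, 'a) set_series"
  is "\<lambda>f S. \<Sum>n\<le>card S. f n S" by simp

lemma coef_series:
  assumes "\<And>n. order_ge n (f n)" "card S \<le> M"
  shows "coef (series f) S = (\<Sum>n\<le>M. coef (f n) S)"
  unfolding series.rep_eq
  by (rule sum.mono_neutral_left) (use assms in \<open>auto simp: order_ge_def\<close>)

lemma series_mult:
  assumes f: "\<And>n. order_ge n (f n)" and g: "\<And>n. order_ge n (g n)"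
  shows "series f * series g = series (\<lambda>n. \<Sum>i\<le>n. f i * g (n - i))"
proof (rule set_series_eqI)
  fix S :: "'a set" assume S: "finite S"
  let ?M = "card S"
  have c: "card T \<le> ?M" "card (S - T) \<le> ?M" if "T \<in> Pow S" for T using that S by (auto intro: card_mono)
  have "coef (series f * series g) S =
     (\<Sum>T\<in>Pow S. (\<Sum>i\<le>?M. coef (f i) T) * (\<Sum>j\<le>?M. coef (g j) (S - T)))"
    unfolding coef_mult using coef_series[OF f c(1)] coef_series[OF g c(2)] by simp
  also have "\<dots> = (\<Sum>i\<le>?M. \<Sum>j\<le>?M. coef (f i * g j) S)"
    unfolding sum_product coef_mult
    by (subst sum.swap, intro sum.cong refl, subst sum.swap) simp
  also have "\<dots> = (\<Sum>(i, j)\<in>{..?M} \<times> {..?M}. coef (f i * g j) S)"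
    by (simp add: sum.cartesian_product)
  also have "\<dots> = (\<Sum>(i, j)\<in>{(i, j). i + j \<le> ?M}. coef (f i * g j) S)"
  proof (rule sum.mono_neutral_right)
    have "coef (f i * g j) S = 0" if "\<not> i + j \<le> ?M" for i j
      using order_ge_mult[OF f[of i] g[of j]] that by (auto simp: order_ge_def)
    thus "\<forall>ij\<in>{..?M} \<times> {..?M} - {(i, j). i + j \<le> ?M}. (case ij of (i, j) \<Rightarrow> coef (f i * g j) S) = 0"
      by auto
  qed auto
  also have "\<dots> = (\<Sum>n\<le>?M. \<Sum>i\<le>n. coef (f i * g (n - i)) S)"
    by (rule sum.triangle_reindex_eq)
  finally show "coef (series f * series g) S = coef (series (\<lambda>n. \<Sum>i\<le>n. f i * g (n - i))) S"
    by (simp add: series.rep_eq coef_sum)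
qed

lemma series_mult_right:
  assumes "\<And>n. order_ge n (f n)"
  shows "series f * G = series (\<lambda>n. f n * G)"
proof (rule set_series_eqI)
  fix S :: "'a set" assume S: "finite S"
  have c: "card T \<le> card S" if "T \<in> Pow S" for T using that S by (auto intro: card_mono)
  have "coef (series f * G) S = (\<Sum>T\<in>Pow S. (\<Sum>i\<le>card S. coef (f i) T) * coef G (S - T))"
    unfolding coef_mult using coef_series[OF assms c] by simp
  also have "\<dots> = coef (series (\<lambda>n. f n * G)) S"
    unfolding sum_distrib_right series.rep_eq coef_mult by (rule sum.swap)
  finally show "coef (series f * G) S = coef (series (\<lambda>n. f n * G)) S" .
qed

lemma series_shift:
  assumes "\<And>n. order_ge n (f n)" "f 0 = 0"
  shows "series f = series (\<lambda>n. f (Suc n))"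
proof (rule set_series_eqI)
  fix S :: "'a set" assume S: "finite S"
  have "coef (series f) S = (\<Sum>n\<le>Suc (card S). coef (f n) S)" using assms by (intro coef_series) auto
  also have "\<dots> = (\<Sum>n\<le>card S. coef (f (Suc n)) S)"
    by (subst sum.atMost_Suc_shift) (simp add: assms coef_simps)
  finally show "coef (series f) S = coef (series (\<lambda>n. f (Suc n))) S" by (simp add: series.rep_eq)
qed

text \<open>The Euler derivation \<open>\<Sum>\<^sub>v t\<^sub>v \<partial>/\<partial>t\<^sub>v\<close>.\<close>

lift_definition euler :: "('v, 'a::ring_1) set_series \<Rightarrow> ('v, 'a) set_series"
  is "\<lambda>F S. of_nat (card S) * F S" by simp

lemma euler_mult: "euler (F * G) = euler F * G + F * euler G"
proof (rule set_series_eqI)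
  fix S :: "'a set" assume S: "finite S"
  have "of_nat (card S) * (coef F T * coef G (S - T)) =
     of_nat (card T) * coef F T * coef G (S - T) + coef F T * (of_nat (card (S - T)) * coef G (S - T))"
    if "T \<in> Pow S" for T
  proof -
    have "card S = card T + card (S - T)"
      using S that by (metis PowD card_Diff_subset card_mono finite_subset le_add_diff_inverse)
    hence "(of_nat (card S) :: 'b) = of_nat (card T) + of_nat (card (S - T))" by simp
    thus ?thesis by (simp add: distrib_right of_nat_left_commute mult.assoc)
  qed
  thus "coef (euler (F * G)) S = coef (euler F * G + F * euler G) S"
    by (simp add: euler.rep_eq coef_simps coef_mult sum_distrib_left flip: sum.distrib)
qed

lemma euler_1: "euler 1 = 0"
  by transfer auto

lemma order_ge_euler: "order_ge n F \<Longrightarrow> order_ge n (euler F)"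
  by (auto simp: order_ge_def euler.rep_eq)

lemma euler_series: "euler (series f) = series (\<lambda>n. euler (f n))"
  by transfer (simp add: sum_distrib_left)

definition ad :: "'a::ring \<Rightarrow> 'a \<Rightarrow> 'a" where "ad z u = z * u - u * z"

lemma order_ge_ad: "order_ge 1 Z \<Longrightarrow> order_ge n U \<Longrightarrow> order_ge (Suc n) (ad Z U)"
  unfolding ad_def using order_ge_mult[of 1 Z n U] order_ge_mult[of n U 1 Z]
  by (auto intro: order_ge_diff)

lemma order_ge_ad_power: "order_ge 1 Z \<Longrightarrow> order_ge l ((ad Z ^^ l) U)"
  by (induction l) (auto intro: order_ge_ad)

text \<open>Left multiplication by \<open>z\<close> is the sum of the commuting operators \<open>ad z\<close> and right multiplication
  by \<open>z\<close>, so this is the binomial theorem.\<close>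

lemma power_mult_ad:
  fixes z u :: "'a::ring_1"
  shows "z ^ k * u = (\<Sum>l\<le>k. of_nat (k choose l) * ((ad z ^^ l) u * z ^ (k - l)))"
proof (induction k)
  case (Suc k)
  let ?a = "\<lambda>l. (ad z ^^ l) u"
  have "z ^ Suc k * u = (\<Sum>l\<le>k. of_nat (k choose l) * (z * ?a l * z ^ (k - l)))"
    unfolding power_Suc mult.assoc Suc sum_distrib_left
    by (simp add: of_nat_left_commute)
  also have "\<dots> = (\<Sum>l\<le>k. of_nat (k choose l) * (?a (Suc l) * z ^ (k - l)))
      + (\<Sum>l\<le>k. of_nat (k choose l) * (?a l * z ^ (Suc k - l)))"
    unfolding sum.distrib[symmetric]
  proof (intro sum.cong refl)
    fix l assume "l \<in> {..k}"
    hence "z ^ (Suc k - l) = z * z ^ (k - l)" by (simp add: Suc_diff_le)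
    thus "of_nat (k choose l) * (z * ?a l * z ^ (k - l)) =
        of_nat (k choose l) * (?a (Suc l) * z ^ (k - l)) + of_nat (k choose l) * (?a l * z ^ (Suc k - l))"
      by (simp add: ad_def algebra_simps)
  qed
  also have "(\<Sum>l\<le>k. of_nat (k choose l) * (?a l * z ^ (Suc k - l))) =
      (\<Sum>l\<le>Suc k. of_nat (k choose l) * (?a l * z ^ (Suc k - l)))"
    by (simp add: binomial_eq_0)
  also have "\<dots> = u * z ^ Suc k + (\<Sum>l\<le>k. of_nat (k choose Suc l) * (?a (Suc l) * z ^ (k - l)))"
    by (subst sum.atMost_Suc_shift) simp
  also have "(\<Sum>l\<le>k. of_nat (k choose l) * (?a (Suc l) * z ^ (k - l))) + \<dots> =
     u * z ^ Suc k + (\<Sum>l\<le>k. of_nat (Suc k choose Suc l) * (?a (Suc l) * z ^ (k - l)))"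
    by (simp add: distrib_right sum.distrib)
  also have "\<dots> = (\<Sum>l\<le>Suc k. of_nat (Suc k choose l) * (?a l * z ^ (Suc k - l)))"
    by (simp add: sum.atMost_Suc_shift del: sum.atMost_Suc)
  finally show ?case .
qed simp

text \<open>Moving all factors \<open>Z\<close> of \<open>\<Sum> Z\<^sup>i (euler Z) Z\<^sup>j\<close> to the right of \<open>euler Z\<close> produces iterated commutators;
  the numbers of ways add up to a binomial coefficient by the hockey-stick identity.\<close>

lemma euler_power_ad:
  fixes Z :: "('v, 'a::ring_1) set_series"
  shows "euler (Z ^ Suc k) = (\<Sum>l\<le>k. of_nat (Suc k choose Suc l) * ((ad Z ^^ l) (euler Z) * Z ^ (k - l)))"
proof (induction k)
  case (Suc k)
  let ?a = "\<lambda>l. (ad Z ^^ l) (euler Z)"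
  have "euler (Z ^ Suc (Suc k)) = euler (Z ^ Suc k * Z)" by (simp add: power_commutes mult.assoc)
  also have "\<dots> = euler (Z ^ Suc k) * Z + Z ^ Suc k * euler Z" by (rule euler_mult)
  also have "euler (Z ^ Suc k) * Z = (\<Sum>l\<le>k. of_nat (Suc k choose Suc l) * (?a l * Z ^ (Suc k - l)))"
    unfolding Suc sum_distrib_right
    by (intro sum.cong refl) (simp add: mult.assoc Suc_diff_le power_commutes)
  also have "\<dots> = (\<Sum>l\<le>Suc k. of_nat (Suc k choose Suc l) * (?a l * Z ^ (Suc k - l)))"
    by (simp add: binomial_eq_0)
  also have "Z ^ Suc k * euler Z = (\<Sum>l\<le>Suc k. of_nat (Suc k choose l) * (?a l * Z ^ (Suc k - l)))"
    by (rule power_mult_ad)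
  finally show ?case 
    by (simp only: sum.distrib[symmetric] distrib_right[symmetric] of_nat_add[symmetric]
      binomial_Suc_Suc[of "Suc k"] add.commute)
qed (simp add: euler_mult euler_1)

lift_definition cmul :: "'a::ring_1 \<Rightarrow> ('v, 'a) set_series \<Rightarrow> ('v, 'a) set_series"
  is "\<lambda>a F S. a * F S" by simp

lemma cmul_mult_left: "cmul a F * G = cmul a (F * G)"
  by (rule set_series_eqI) (simp add: cmul.rep_eq coef_mult sum_distrib_left mult.assoc)

lemma cmul_cmul: "cmul a (cmul b F) = cmul (a * b) F"
  by (rule set_series_eqI) (simp add: cmul.rep_eq mult.assoc)

lemma cmul_1 [simp]: "cmul 1 F = F"
  by (rule set_series_eqI) (simp add: cmul.rep_eq)

lemma cmul_0 [simp]: "cmul 0 F = 0" "cmul a 0 = 0"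
  by (rule set_series_eqI, simp add: cmul.rep_eq coef_simps)+

lemma cmul_sum: "cmul a (sum F I) = (\<Sum>i\<in>I. cmul a (F i))"
  by (rule set_series_eqI) (simp add: cmul.rep_eq coef_sum sum_distrib_left)

lemma sum_cmul: "cmul (sum c I) F = (\<Sum>i\<in>I. cmul (c i) F)"
  by (rule set_series_eqI) (simp add: cmul.rep_eq coef_sum sum_distrib_right)

lemma order_ge_cmul: "order_ge n F \<Longrightarrow> order_ge n (cmul a F)"
  by (simp add: order_ge_def cmul.rep_eq)

lemma coef_of_nat_mult: "coef (of_nat n * F) S = of_nat n * coef F S"
  by (induction n) (simp_all add: coef_simps distrib_right)

lemma of_nat_mult_eq_cmul: "of_nat n * F = cmul (of_nat n) F"
  by (rule set_series_eqI) (simp add: cmul.rep_eq coef_of_nat_mult)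

lemma series_head:
  assumes "\<And>n. n > 0 \<Longrightarrow> f n = 0"
  shows "series f = f 0"
proof (rule set_series_eqI)
  fix S :: "'a set" assume "finite S"
  have "(\<Sum>n\<le>card S. coef (f n) S) = (\<Sum>n\<in>{0}. coef (f n) S)"
    by (rule sum.mono_neutral_right) (auto simp: assms coef_simps)
  thus "coef (series f) S = coef (f 0) S" by (simp add: series.rep_eq)
qed

section \<open>Substitution into formal power series\<close>

text \<open>An algebra over \<open>'k\<close> given by the central ring homomorphism of its structure. The scalars of the
  free algebras considered below are embedded by the function \<open>scal\<close> in this way.\<close>

locale central_scalars =
  fixes sc :: "'k::field_char_0 \<Rightarrow> 'a::ring_1"
  assumes sc_add: "sc (c + d) = sc c + sc d"
    and sc_mult: "sc (c * d) = sc c * sc d"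
    and sc_1: "sc 1 = 1"
    and sc_central: "sc c * a = a * sc c"
begin

lemma sc_0: "sc 0 = 0"
  using sc_add[of 0 0] by simp

lemma sc_sum: "sc (sum f I) = (\<Sum>i\<in>I. sc (f i))"
  by (induction I rule: infinite_finite_induct) (simp_all add: sc_0 sc_add)

lemma sc_of_nat: "sc (of_nat n) = of_nat n"
  by (induction n) (simp_all add: sc_0 sc_1 sc_add)

lemma mult_cmul: "F * cmul (sc c) G = cmul (sc c) (F * G)"
proof (rule set_series_eqI)
  fix S :: "'b set" assume "finite S"
  have "f * (sc c * g) = sc c * (f * g)" for f g
    by (simp only: mult.assoc[symmetric] sc_central[of c f])
  thus "coef (F * cmul (sc c) G) S = coef (cmul (sc c) (F * G)) S"
    by (simp add: cmul.rep_eq coef_mult sum_distrib_left)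
qed

lemma euler_cmul: "euler (cmul (sc c) F) = cmul (sc c) (euler F)"
proof (rule set_series_eqI)
  fix S :: "'b set" assume "finite S"
  show "coef (euler (cmul (sc c) F)) S = coef (cmul (sc c) (euler F)) S"
    unfolding euler.rep_eq cmul.rep_eq by (rule of_nat_left_commute[symmetric])
qed

lemma cmul_mult_cmul: "cmul (sc c) F * cmul (sc d) G = cmul (sc (c * d)) (F * G)"
  by (simp only: cmul_mult_left mult_cmul cmul_cmul flip: sc_mult) (simp only: mult.commute)

definition subst :: "'k fps \<Rightarrow> ('v, 'a) set_series \<Rightarrow> ('v, 'a) set_series"
  where "subst a N = series (\<lambda>n. cmul (sc (fps_nth a n)) (N ^ n))"

text \<open>The operator \<open>a(ad Z)\<close> for a formal power series \<open>a\<close>, applied to \<open>U\<close>.\<close>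

definition ad_subst :: "'k fps \<Rightarrow> ('v, 'a) set_series \<Rightarrow> ('v, 'a) set_series \<Rightarrow> ('v, 'a) set_series"
  where "ad_subst a Z U = series (\<lambda>l. cmul (sc (fps_nth a l)) ((ad Z ^^ l) U))"

lemma order_ge_subst_term: "order_ge 1 N \<Longrightarrow> order_ge n (cmul (sc (fps_nth a n)) (N ^ n))"
  by (intro order_ge_cmul order_ge_power)

lemma coef_subst:
  assumes "order_ge 1 N" "card S \<le> M"
  shows "coef (subst a N) S = (\<Sum>n\<le>M. sc (fps_nth a n) * coef (N ^ n) S)"
  unfolding subst_def using coef_series[OF order_ge_subst_term[OF assms(1)] assms(2)]
  by (simp add: cmul.rep_eq)

lemma coef_subst_empty: "coef (subst a N) {} = sc (fps_nth a 0)"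
  by (simp add: subst_def series.rep_eq cmul.rep_eq coef_simps)

lemma subst_1: "subst 1 N = 1"
  unfolding subst_def by (subst series_head) (simp_all add: sc_0 sc_1)

lemma subst_X: "order_ge 1 N \<Longrightarrow> subst fps_X N = N"
proof (rule set_series_eqI)
  fix S :: "'b set" assume N: "order_ge 1 N" and "finite S"
  have "coef (subst fps_X N) S = (\<Sum>n\<le>Suc (card S). sc (fps_nth fps_X n) * coef (N ^ n) S)"
    by (rule coef_subst[OF N]) simp
  also have "\<dots> = (\<Sum>n\<in>{1}. sc (fps_nth fps_X n) * coef (N ^ n) S)"
    by (rule sum.mono_neutral_right) (auto simp: sc_0)
  finally show "coef (subst fps_X N) S = coef N S" by (simp add: sc_1)
qed

lemma subst_diff: "subst (a - b) N = subst a N - subst b N"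
proof (rule set_series_eqI)
  fix S :: "'b set" assume "finite S"
  have "sc (c - d) = sc c - sc d" for c d
    using sc_add[of "c - d" d] by (simp add: algebra_simps)
  thus "coef (subst (a - b) N) S = coef (subst a N - subst b N) S"
    by (simp add: subst_def series.rep_eq cmul.rep_eq coef_simps left_diff_distrib sum_subtractf)
qed

lemma subst_mult:
  assumes N: "order_ge 1 N"
  shows "subst (a * b) N = subst a N * subst b N"
proof -
  have "subst a N * subst b N = series (\<lambda>n. \<Sum>i\<le>n. cmul (sc (fps_nth a i)) (N ^ i) * cmul (sc (fps_nth b (n - i))) (N ^ (n - i)))"
    unfolding subst_def by (intro series_mult order_ge_subst_term[OF N])
  also have "\<dots> = subst (a * b) N"
    unfolding subst_def
    by (intro arg_cong[where f = series] ext)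
      (simp add: fps_mult_nth atLeast0AtMost sc_sum sum_cmul cmul_mult_cmul flip: power_add)
  finally show ?thesis ..
qed

lemma subst_power: "order_ge 1 N \<Longrightarrow> subst (a ^ n) N = subst a N ^ n"
  by (induction n) (simp_all add: subst_1 subst_mult)

text \<open>Together with \<open>subst_mult\<close> this transports every identity between formal power series over the
  field to a single element of a noncommutative algebra; in particular \<open>exp\<close> and \<open>ln\<close> are mutually inverse.\<close>

lemma subst_compose:
  assumes N: "order_ge 1 N" and b: "fps_nth b 0 = 0"
  shows "subst (a oo b) N = subst a (subst b N)"
proof (rule set_series_eqI)
  fix S :: "'b set" assume S: "finite S"
  let ?M = "card S"
  have bN: "order_ge 1 (subst b N)" by (simp add: order_ge_1 coef_subst_empty b sc_0 del: One_nat_def)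
  have "coef (subst (a oo b) N) S =
      (\<Sum>n\<le>?M. \<Sum>i\<le>?M. sc (fps_nth a i) * (sc (fps_nth (b ^ i) n) * coef (N ^ n) S))"
    unfolding coef_subst[OF N order_refl]
  proof (intro sum.cong refl)
    fix n assume "n \<in> {..?M}"
    (* as b has no constant term, b ^ i does not contribute to the coefficient at n for i > n *)
    hence "(\<Sum>i=0..n. fps_nth a i * fps_nth (b ^ i) n) = (\<Sum>i\<le>?M. fps_nth a i * fps_nth (b ^ i) n)"
      by (intro sum.mono_neutral_left) (auto simp: b startsby_zero_power_prefix)
    thus "sc (fps_nth (a oo b) n) * coef (N ^ n) S =
        (\<Sum>i\<le>?M. sc (fps_nth a i) * (sc (fps_nth (b ^ i) n) * coef (N ^ n) S))"
      by (simp add: fps_compose_nth sc_sum sc_mult sum_distrib_right mult.assoc)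
  qed
  also have "\<dots> = (\<Sum>i\<le>?M. sc (fps_nth a i) * coef (subst (b ^ i) N) S)"
    unfolding coef_subst[OF N order_refl] sum_distrib_left by (rule sum.swap)
  also have "\<dots> = coef (subst a (subst b N)) S"
    unfolding coef_subst[OF bN order_refl] by (simp add: subst_power[OF N])
  finally show "coef (subst (a oo b) N) S = coef (subst a (subst b N)) S" .
qed

lemma coef_power_cong:
  assumes "\<And>T. T \<subseteq> S \<Longrightarrow> coef F T = coef G T"
  shows "T \<subseteq> S \<Longrightarrow> coef (F ^ n) T = coef (G ^ n) T"
proof (induction n arbitrary: T)
  case (Suc n)
  have "U \<subseteq> S \<and> T - U \<subseteq> S" if "U \<in> Pow T" for U using that Suc.prems by blast
  thus ?case using assms Suc.IH by (simp add: coef_mult)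
qed simp

text \<open>Only the coefficients at subsets of \<open>S\<close> enter the coefficient at \<open>S\<close>: setting variables to zero
  commutes with substitution.\<close>

lemma coef_subst_cong:
  assumes "\<And>T. T \<subseteq> S \<Longrightarrow> coef F T = coef G T"
  shows "coef (subst a F) S = coef (subst a G) S"
  using coef_power_cong[OF assms order_refl] by (simp add: subst_def series.rep_eq cmul.rep_eq)

abbreviation exp_series :: "('v, 'a) set_series \<Rightarrow> ('v, 'a) set_series"
  where "exp_series \<equiv> subst (fps_exp 1)"

abbreviation ln_series :: "('v, 'a) set_series \<Rightarrow> ('v, 'a) set_series"
  where "ln_series P \<equiv> subst (fps_ln 1) (P - 1)"

lemma exp_ln_series:
  assumes "coef P {} = 1"
  shows "exp_series (ln_series P) = P"
proof -
  have N: "order_ge 1 (P - 1)" using assms by (simp add: order_ge_1 coef_simps del: One_nat_def)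
  have "fps_ln (1::'k) = fps_inv (fps_exp 1 - 1)" by (simp add: fps_ln_fps_exp_inv)
  hence "(fps_exp (1::'k) - 1) oo fps_ln 1 = fps_X"
    by (simp only:) (rule fps_inv_right, simp_all)
  hence e: "(fps_exp (1::'k) oo fps_ln 1) - 1 = fps_X" by (simp add: fps_compose_sub_distrib)
  have "exp_series (ln_series P) - 1 = subst ((fps_exp 1 oo fps_ln 1) - 1) (P - 1)"
    by (subst subst_diff) (simp add: subst_compose[OF N] subst_1)
  also have "\<dots> = P - 1" unfolding e by (rule subst_X[OF N])
  finally show ?thesis by simp
qed

lemma ln_exp_series:
  assumes "coef F {} = 0"
  shows "ln_series (exp_series F) = F"
proof -
  have N: "order_ge 1 F" using assms by (simp add: order_ge_1 del: One_nat_def)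
  have "fps_ln (1::'k) = fps_inv (fps_exp 1 - 1)" by (simp add: fps_ln_fps_exp_inv)
  hence "fps_ln (1::'k) oo (fps_exp 1 - 1) = fps_X"
    by (simp only:) (rule fps_inv, simp_all)
  moreover have "exp_series F - 1 = subst (fps_exp 1 - 1) F"
    by (simp add: subst_diff subst_1)
  ultimately show ?thesis
    by (simp add: subst_compose[OF N, symmetric] subst_X[OF N])
qed

text \<open>The formula \<open>e\<^sup>Z U e\<^sup>-\<^sup>Z = e\<^bsup>ad Z\<^esup> U\<close>.\<close>

lemma exp_series_mult_ad:
  assumes Z: "order_ge 1 Z"
  shows "exp_series Z * U = ad_subst (fps_exp 1) Z U * exp_series Z"
proof -
  have "exp_series Z * U = series (\<lambda>n. cmul (sc (1 / fact n)) (Z ^ n) * U)"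
    unfolding subst_def by (subst series_mult_right) (simp_all only: fps_exp_nth power_one of_nat_fact, intro order_ge_cmul order_ge_power Z)
  also have "\<dots> = series (\<lambda>n. \<Sum>i\<le>n. cmul (sc (1 / fact i)) ((ad Z ^^ i) U) * cmul (sc (1 / fact (n - i))) (Z ^ (n - i)))"
  proof (intro arg_cong[where f = series] ext)
    fix n
    have "cmul (sc (1 / fact n)) (of_nat (n choose i) * ((ad Z ^^ i) U * Z ^ (n - i))) =
        cmul (sc (1 / fact i)) ((ad Z ^^ i) U) * cmul (sc (1 / fact (n - i))) (Z ^ (n - i))" if "i \<in> {..n}" for i
    proof -
      have "(1 / fact n) * of_nat (n choose i) = 1 / fact i * (1 / fact (n - i) :: 'k)"
        using that by (simp add: binomial_fact)
      thus ?thesis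
        by (simp only: of_nat_mult_eq_cmul cmul_cmul cmul_mult_cmul sc_of_nat[symmetric] sc_mult[symmetric])
    qed
    thus "cmul (sc (1 / fact n)) (Z ^ n) * U =
       (\<Sum>i\<le>n. cmul (sc (1 / fact i)) ((ad Z ^^ i) U) * cmul (sc (1 / fact (n - i))) (Z ^ (n - i)))"
      by (simp add: cmul_mult_left power_mult_ad cmul_sum)
  qed
  also have "\<dots> = ad_subst (fps_exp 1) Z U * exp_series Z"
    unfolding subst_def ad_subst_def
    by (subst series_mult) (auto simp del: One_nat_def intro!: order_ge_cmul order_ge_power order_ge_ad_power Z)
  finally show ?thesis .
qed

text \<open>The power series \<open>(e\<^sup>t - 1) / t\<close>.\<close>

definition dexp :: "'k fps" where "dexp = Abs_fps (\<lambda>l. 1 / fact (Suc l))"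

text \<open>The formula \<open>D(e\<^sup>Z) = ((e\<^bsup>ad Z\<^esup> - 1) / ad Z)(D Z) e\<^sup>Z\<close> for the derivative of the exponential in a
  noncommutative algebra.\<close>

lemma euler_exp_series:
  assumes Z: "order_ge 1 Z"
  shows "euler (exp_series Z) = ad_subst dexp Z (euler Z) * exp_series Z"
proof -
  have "euler (exp_series Z) = series (\<lambda>n. cmul (sc (1 / fact n)) (euler (Z ^ n)))"
    by (simp add: subst_def euler_series euler_cmul)
  also have "\<dots> = series (\<lambda>n. cmul (sc (1 / fact (Suc n))) (euler (Z ^ Suc n)))"
    by (rule series_shift) (auto intro!: order_ge_cmul order_ge_euler order_ge_power Z simp: euler_1)
  also have "\<dots> = series (\<lambda>n. \<Sum>i\<le>n. cmul (sc (1 / fact (Suc i))) ((ad Z ^^ i) (euler Z)) * cmul (sc (1 / fact (n - i))) (Z ^ (n - i)))"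
  proof (intro arg_cong[where f = series] ext)
    fix n
    have "cmul (sc (1 / fact (Suc n))) (of_nat (Suc n choose Suc i) * ((ad Z ^^ i) (euler Z) * Z ^ (n - i))) =
        cmul (sc (1 / fact (Suc i))) ((ad Z ^^ i) (euler Z)) * cmul (sc (1 / fact (n - i))) (Z ^ (n - i))" if "i \<in> {..n}" for i
    proof -
      have "(1 / fact (Suc n)) * of_nat (Suc n choose Suc i) = 1 / fact (Suc i) * (1 / fact (n - i) :: 'k)"
        using that by (subst binomial_fact) (simp_all del: fact_Suc)
      thus ?thesis
        by (simp only: of_nat_mult_eq_cmul cmul_cmul cmul_mult_cmul sc_of_nat[symmetric] sc_mult[symmetric])
    qed
    thus "cmul (sc (1 / fact (Suc n))) (euler (Z ^ Suc n)) =
       (\<Sum>i\<le>n. cmul (sc (1 / fact (Suc i))) ((ad Z ^^ i) (euler Z)) * cmul (sc (1 / fact (n - i))) (Z ^ (n - i)))"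
      unfolding euler_power_ad cmul_sum by (rule sum.cong[OF refl])
  qed
  also have "\<dots> = ad_subst dexp Z (euler Z) * exp_series Z"
    unfolding subst_def ad_subst_def
    by (subst series_mult) (auto simp: dexp_def simp del: fact_Suc One_nat_def
      intro!: order_ge_cmul order_ge_power order_ge_ad_power Z)
  finally show ?thesis .
qed

lemma exp_series_inverse:
  assumes "order_ge 1 Z"
  shows "exp_series Z * subst (fps_exp (- 1)) Z = 1"
  by (simp add: subst_mult[OF assms, symmetric] fps_exp_add_mult[symmetric] subst_1)

text \<open>Both sides are \<open>D(P) P\<^sup>-\<^sup>1\<close> for the product \<open>P = e\<^sup>F e\<^sup>G = e\<^sup>Z\<close> and the Euler derivation \<open>D\<close>. The left-hand side is
  \<open>D Z\<close> plus commutators in which \<open>Z\<close> occurs with smaller index sets, so the equation determines \<open>Z\<close>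
  recursively as a Lie series in \<open>F\<close> and \<open>G\<close>.\<close>

lemma log_exp_exp_recursion:
  assumes F: "order_ge 1 F" and G: "order_ge 1 G" and Z: "order_ge 1 Z"
    and EF: "euler F = F" and EG: "euler G = G"
    and e: "exp_series Z = exp_series F * exp_series G"
  shows "ad_subst dexp Z (euler Z) = F + ad_subst (fps_exp 1) F G"
proof -
  have lin: "euler (exp_series F) = F * exp_series F" if "order_ge 1 F" "euler F = F" for F :: "('b, 'a) set_series"
  proof -
    have "(ad F ^^ l) F = 0" if "l > 0" for l
      using that by (induction l rule: nat_induct_non_zero) (simp_all add: ad_def)
    hence "ad_subst dexp F F = F"
      unfolding ad_subst_def by (subst series_head) (simp_all add: dexp_def sc_1)
    thus ?thesis using euler_exp_series[OF that(1)] that(2) by simp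
  qed
  have "ad_subst dexp Z (euler Z) * exp_series Z = euler (exp_series F * exp_series G)"
    using euler_exp_series[OF Z] e by simp
  also have "\<dots> = F * exp_series F * exp_series G + exp_series F * G * exp_series G"
    by (simp only: euler_mult lin[OF F EF] lin[OF G EG] mult.assoc)
  also have "\<dots> = (F + ad_subst (fps_exp 1) F G) * exp_series Z"
    by (simp add: exp_series_mult_ad[OF F] e distrib_right mult.assoc)
  finally have "ad_subst dexp Z (euler Z) * (exp_series Z * subst (fps_exp (- 1)) Z) =
      (F + ad_subst (fps_exp 1) F G) * (exp_series Z * subst (fps_exp (- 1)) Z)"
    by (simp only: mult.assoc[symmetric])
  thus ?thesis by (simp add: exp_series_inverse[OF Z])
qed

end

section \<open>Linear maps and derivations of the free algebra\<close>

lemma scal_0: "scal 0 = 0"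
  by (simp add: scal_def)

lemma scal_1: "scal 1 = 1"
  by (simp add: scal_def)

lemma scal_of_nat: "scal (of_nat n) = of_nat n"
  by (induction n) (simp_all add: scal_0 scal_1 const_add)

definition FA_linear :: "(('g, 'k::field) free_alg \<Rightarrow> ('g, 'k) free_alg) \<Rightarrow> bool"
  where "FA_linear T \<longleftrightarrow> (\<forall>f g. T (f + g) = T f + T g) \<and> (\<forall>c f. T (scal c * f) = scal c * T f)"

lemma FA_linear_addD: "FA_linear T \<Longrightarrow> T (f + g) = T f + T g"
  and FA_linear_scalD: "FA_linear T \<Longrightarrow> T (scal c * f) = scal c * T f"
  by (simp_all add: FA_linear_def)

lemma FA_linear_linext: "FA_linear (linext F)"
  by (simp add: FA_linear_def linext_add linext_const)

lemma FA_linear_comp: "FA_linear T \<Longrightarrow> FA_linear U \<Longrightarrow> FA_linear (\<lambda>f. T (U f))"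
  by (simp add: FA_linear_def)

lemma FA_linear_diff: "FA_linear T \<Longrightarrow> FA_linear U \<Longrightarrow> FA_linear (\<lambda>f. T f - U f)"
  by (simp add: FA_linear_def algebra_simps)

lemma mult_scal: "a * (scal c * f) = scal c * (a * f)"
  by (simp only: mult.assoc[symmetric] const_comm[of c a])

lemma FA_linear_0: "FA_linear T \<Longrightarrow> T 0 = 0"
  unfolding FA_linear_def by (metis add_cancel_right_right add.right_neutral)

lemma FA_linear_minus: "FA_linear T \<Longrightarrow> T (f - g) = T f - T g"
proof -
  assume T: "FA_linear T"
  have "T (f - g + g) = T (f - g) + T g" using T unfolding FA_linear_def by blast
  thus ?thesis by simp
qed

lemma FA_linear_sum: "FA_linear T \<Longrightarrow> T (sum h A) = (\<Sum>i\<in>A. T (h i))"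
  by (induction A rule: infinite_finite_induct) (auto simp: FA_linear_0, simp add: FA_linear_def)

lemma idealD:
  fixes J :: "('g, 'k::field) free_alg set"
  assumes "ideal J ring_of_type_algebra"
  shows "0 \<in> J" "f \<in> J \<Longrightarrow> g \<in> J \<Longrightarrow> f + g \<in> J" "f \<in> J \<Longrightarrow> g \<in> J \<Longrightarrow> f - g \<in> J"
    "f \<in> J \<Longrightarrow> a * f \<in> J" "f \<in> J \<Longrightarrow> f * a \<in> J" "f \<in> J \<Longrightarrow> - f \<in> J"
    "(\<And>i. i \<in> A \<Longrightarrow> h i \<in> J) \<Longrightarrow> sum h A \<in> J"
proof -
  show J0: "0 \<in> J" and Jm: "\<And>f g. f \<in> J \<Longrightarrow> g \<in> J \<Longrightarrow> f - g \<in> J"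
    and "f \<in> J \<Longrightarrow> a * f \<in> J" "f \<in> J \<Longrightarrow> f * a \<in> J"
    using assms by (auto simp: ideal_FA_iff)
  show Jn: "f \<in> J \<Longrightarrow> - f \<in> J" for f using Jm[OF J0, of f] by simp
  show Jp: "f \<in> J \<Longrightarrow> g \<in> J \<Longrightarrow> f + g \<in> J" for f g using Jm[of f "- g"] Jn[of g] by simp
  show "(\<And>i. i \<in> A \<Longrightarrow> h i \<in> J) \<Longrightarrow> sum h A \<in> J"
    by (induction A rule: infinite_finite_induct) (auto simp: J0 Jp)
qed

lemma ideal_trans:
  fixes J :: "('g, 'k::field) free_alg set"
  assumes "ideal J ring_of_type_algebra" "f - g \<in> J" "g - h \<in> J"
  shows "f - h \<in> J"
  using idealD(2)[OF assms(1,2,3)] by simp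

lemma FA_linear_in_ideal:
  assumes T: "FA_linear T" and J: "ideal J ring_of_type_algebra"
    and "\<And>us. Free_Monoid us \<in> Poly_Mapping.keys f \<Longrightarrow> T (mon_word us) \<in> J"
  shows "T f \<in> J"
proof -
  have "T f = (\<Sum>u\<in>Poly_Mapping.keys f. scal (Poly_Mapping.lookup f u) * T (mon_word (letters u)))"
    by (subst poly_sum_mon, subst FA_linear_sum[OF T]) (use T in \<open>simp add: FA_linear_def\<close>)
  also have "\<dots> \<in> J" using assms(3) by (intro idealD(7)[OF J] idealD(4)[OF J]) simp
  finally show ?thesis .
qed

lemma ideal_0: "ideal {0} (ring_of_type_algebra :: ('g, 'k::field) free_alg ring)"
  by (simp add: ideal_FA_iff)

lemma FA_linear_eqI:
  assumes "FA_linear T" "FA_linear U"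
    and "\<And>us. Free_Monoid us \<in> Poly_Mapping.keys f \<Longrightarrow> T (mon_word us) = U (mon_word us)"
  shows "T f = U f"
  using FA_linear_in_ideal[OF FA_linear_diff[OF assms(1,2)] ideal_0] assms(3) by fastforce

lemma mon_word_Nil: "mon_word [] = 1"
  by (simp add: mon_word_def zero_free_monoid_def[symmetric])

lemma mon_word_Cons: "mon_word (g # us) = mon_word [g] * mon_word us"
  by (simp add: mon_mult)

definition FA_derivation :: "(('g, 'k::field) free_alg \<Rightarrow> ('g, 'k) free_alg) \<Rightarrow> bool"
  where "FA_derivation D \<longleftrightarrow> FA_linear D \<and> (\<forall>f g. D (f * g) = D f * g + f * D g)"

text \<open>Used to compare derivations modulo an ideal: a difference of derivations, or the commutator of two
  derivations minus a third, need only be tested on letters.\<close>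

lemma FA_derivation_in_ideal:
  assumes D: "FA_derivation D" and J: "ideal J ring_of_type_algebra" and g: "\<And>g. D (mon_word [g]) \<in> J"
  shows "D f \<in> J"
proof (rule FA_linear_in_ideal[of D, OF _ J])
  show "FA_linear D" using D by (simp add: FA_derivation_def)
  fix us
  have "D (1 * 1) = D 1 * 1 + 1 * D 1" using D unfolding FA_derivation_def by blast
  hence D1: "D 1 = 0" by simp
  show "D (mon_word us) \<in> J"
  proof (induction us)
    case Nil
    show ?case by (simp add: mon_word_Nil D1 idealD(1)[OF J])
  next
    case (Cons a us)
    have "D (mon_word (a # us)) = D (mon_word [a]) * mon_word us + mon_word [a] * D (mon_word us)"
      using D unfolding FA_derivation_def by (subst mon_word_Cons) blast
    thus ?case using Cons g idealD(2,4,5)[OF J] by simp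
  qed
qed

fun deriv_word :: "('g \<Rightarrow> 'g) \<Rightarrow> 'g list \<Rightarrow> ('g, 'k::field) free_alg"
  where "deriv_word d [] = 0"
  | "deriv_word d (g # us) = mon_word (d g # us) + mon_word [g] * deriv_word d us"

lemma deriv_word_append:
  "deriv_word d (us @ vs) = deriv_word d us * mon_word vs + mon_word us * deriv_word d vs"
proof (induction us)
  case Nil
  show ?case by (simp add: mon_word_Nil)
next
  case (Cons g us)
  show ?case
    by (simp add: Cons distrib_left distrib_right mon_mult mult.assoc[symmetric])
qed

text \<open>The derivation of the free algebra that extends a map of the letters.\<close>

definition extend_deriv :: "('g \<Rightarrow> 'g) \<Rightarrow> ('g, 'k::field) free_alg \<Rightarrow> ('g, 'k) free_alg"
  where "extend_deriv d = linext (deriv_word d)"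

lemma extend_deriv_mon: "extend_deriv d (mon_word us) = deriv_word d us"
  by (simp add: extend_deriv_def linext_mon)

lemma extend_deriv_gen: "extend_deriv d (mon_word [g]) = mon_word [d g]"
  by (simp add: extend_deriv_mon)

lemma FA_linear_extend_deriv: "FA_linear (extend_deriv d)"
  unfolding extend_deriv_def by (rule FA_linear_linext)

lemmas extend_deriv_add = FA_linear_addD[OF FA_linear_extend_deriv]
  and extend_deriv_scal = FA_linear_scalD[OF FA_linear_extend_deriv]

lemma FA_derivation_extend_deriv: "FA_derivation (extend_deriv d)"
  unfolding FA_derivation_def
proof (intro conjI allI FA_linear_extend_deriv)
  fix f g :: "('a, 'b) free_alg"
  note lin = FA_linear_def extend_deriv_add extend_deriv_scal distrib_left distrib_right mult_scal
  have 1: "extend_deriv d (mon_word us * g) = extend_deriv d (mon_word us) * g + mon_word us * extend_deriv d g" for us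
    by (rule FA_linear_eqI[where f = g])
      (simp_all add: lin mon_mult extend_deriv_mon deriv_word_append algebra_simps)
  show "extend_deriv d (f * g) = extend_deriv d f * g + f * extend_deriv d g"
    by (rule FA_linear_eqI[where f = f])
      (simp_all add: lin 1 mult.assoc algebra_simps)
qed

lemma extend_deriv_mult: "extend_deriv d (f * g) = extend_deriv d f * g + f * extend_deriv d g"
  using FA_derivation_extend_deriv unfolding FA_derivation_def by blast

lemma FA_linear_hom_part: "FA_linear (hom_part d)"
  unfolding hom_part_linext by (rule FA_linear_linext)

lemma hom_part_mon: "hom_part d (mon_word us) = (if length us = d then mon_word us else 0)"
  by (simp add: hom_part_linext linext_mon)

lemma lookup_hom_part:
  "Poly_Mapping.lookup (hom_part d f) u = (if length (letters u) = d then Poly_Mapping.lookup f u else 0)"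
  unfolding hom_part_def by (auto simp: lookup_sum lookup_single when_def in_keys_iff)

lemmas hom_part_add = FA_linear_addD[OF FA_linear_hom_part]
  and hom_part_scal = FA_linear_scalD[OF FA_linear_hom_part]

lemma hom_part_mult_letter: "hom_part (Suc d) (mon_word [a] * f) = mon_word [a] * hom_part d f"
  by (rule FA_linear_eqI[where f = f])
    (simp_all add: FA_linear_def hom_part_add hom_part_scal mult_scal distrib_left mon_mult hom_part_mon)

lemma hom_part_0_mult_letter: "hom_part 0 (mon_word [a] * f) = 0"
  by (rule FA_linear_eqI[where f = f and U = "\<lambda>_. 0"])
    (simp_all add: FA_linear_def hom_part_add hom_part_scal mult_scal distrib_left mon_mult hom_part_mon)

lemma hom_part_deriv_word:
  "hom_part n (deriv_word d us) = (if length us = n then deriv_word d us else 0)"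
proof (induction us arbitrary: n)
  case Nil
  show ?case by (simp add: FA_linear_0[OF FA_linear_hom_part])
next
  case (Cons g us)
  show ?case
    by (cases n) (simp_all add: hom_part_add hom_part_mon hom_part_mult_letter hom_part_0_mult_letter Cons)
qed

lemma hom_part_extend_deriv: "hom_part n (extend_deriv d f) = extend_deriv d (hom_part n f)"
  by (rule FA_linear_eqI[where f = f])
    (simp_all add: FA_linear_def hom_part_add hom_part_scal extend_deriv_add extend_deriv_scal
      extend_deriv_mon hom_part_mon hom_part_deriv_word FA_linear_0[OF FA_linear_extend_deriv])

section \<open>Injectivity of the symmetrization map\<close>

text \<open>An invertible derivation \<open>E\<close> makes the Poincare-Birkhoff-Witt theorem easy. Let \<open>g\<close> act on the symmetric
  algebra by \<open>E g \<cdot> + ad g\<close>, where \<open>ad g\<close> is extended to a derivation. Since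
  \<open>[E g \<cdot> + ad g, E h \<cdot> + ad h] = ([g, E h] + [E g, h]) \<cdot> + ad [g, h] = E [g, h] \<cdot> + ad [g, h]\<close>,
  this is a representation, hence an action of the enveloping algebra, and
  \<open>g\<^sub>1 \<cdots> g\<^sub>d\<close> maps \<open>1\<close> to \<open>(E g\<^sub>1) \<cdots> (E g\<^sub>d)\<close> plus terms of lower degree. For a free Lie
  algebra the degree derivation is such an \<open>E\<close>.\<close>

locale lie_algebra_derivation = lie_algebra scale bracket
  for scale :: "'k::field_char_0 \<Rightarrow> 'g::ab_group_add \<Rightarrow> 'g" (infixr \<open>*s\<close> 75)
    and bracket :: "'g \<Rightarrow> 'g \<Rightarrow> 'g" +
  fixes E :: "'g \<Rightarrow> 'g"
  assumes E_add: "E (g + h) = E g + E h"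
    and E_scale: "E (c *s g) = c *s E g"
    and E_bracket: "E (bracket g h) = bracket (E g) h + bracket g (E h)"
    and E_bij: "bij E"
begin

lemma bracket_anti: "bracket g h = - bracket h g"
proof -
  have "bracket g h + bracket h g = bracket (g + h) (g + h)"
    by (simp only: bracket_add_left bracket_add_right) (simp add: bracket_self)
  also have "\<dots> = 0" by (rule bracket_self)
  finally have "bracket g h + bracket h g = 0" .
  thus ?thesis by (simp only: eq_neg_iff_add_eq_0)
qed

text \<open>The Jacobi identity in the form that \<open>bracket [g, h]\<close> is the commutator of \<open>bracket g\<close> and
  \<open>bracket h\<close>.\<close>

lemma jacobi_left: "bracket (bracket g h) a = bracket g (bracket h a) - bracket h (bracket g a)"
proof -
  have "bracket (bracket g h) a = - bracket a (bracket g h)" by (rule bracket_anti)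
  also have "\<dots> = bracket g (bracket h a) + bracket h (bracket a g)"
    using jacobi[of a g h] by (simp add: eq_neg_iff_add_eq_0 add_ac neg_eq_iff_add_eq_0)
  also have "bracket h (bracket a g) = - bracket h (bracket g a)"
  proof -
    have "bracket h (bracket a g) + bracket h (bracket g a) = bracket h (bracket a g + bracket g a)"
      by (rule bracket_add_right[symmetric])
    also have "bracket a g + bracket g a = 0" by (simp only: bracket_anti[of a g]) simp
    also have "bracket h 0 = 0" using bracket_add_right[of h 0 0] by simp
    finally show ?thesis by (simp only: eq_neg_iff_add_eq_0)
  qed
  finally show ?thesis by simp
qed

lemma sym_ideal_contains:
  "linear_relations \<subseteq> sym_ideal" "mon_word [g, h] - mon_word [h, g] \<in> sym_ideal"
  unfolding sym_ideal_def genideal_def by blast+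

lemmas symI = idealD[OF ideal_sym_ideal] and envI = idealD[OF ideal_env_ideal]

lemma linear_ideal:
  assumes "ideal J FA" "linear_relations \<subseteq> J"
  shows "mon_word [g + h] - mon_word [g] - mon_word [h] \<in> J"
    and "mon_word [c *s g] - scal c * mon_word [g] \<in> J"
    and "mon_word [0] \<in> J"
    and "mon_word [- g] + mon_word [g] \<in> J"
    and "mon_word [g - h] - (mon_word [g] - mon_word [h]) \<in> J"
proof -
  show a: "mon_word [g + h] - mon_word [g] - mon_word [h] \<in> J" for g h
    using mid_relation(1)[OF assms, of "[]" g h "[]"] by simp
  show "mon_word [c *s g] - scal c * mon_word [g] \<in> J"
    using mid_relation(2)[OF assms, of "[]" c g "[]"] by simp
  show z: "mon_word [0] \<in> J"
    using idealD(6)[OF assms(1) a[of 0 0]] by simp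
  show m: "mon_word [- g] + mon_word [g] \<in> J" for g
    using idealD(3)[OF assms(1) z a[of "- g" g]] by (simp add: algebra_simps)
  show "mon_word [g - h] - (mon_word [g] - mon_word [h]) \<in> J"
    using idealD(2)[OF assms(1) a[of g "- h"] m[of h]] by (simp add: algebra_simps)
qed

lemmas sym_linear = linear_ideal[OF ideal_sym_ideal sym_ideal_contains(1)]
  and env_linear = linear_ideal[OF ideal_env_ideal env_ideal_contains]

text \<open>A map given on words factors through the symmetric or the enveloping algebra if it respects the defining
  relations inside words.\<close>

lemma linext_relations:
  assumes J: "ideal J FA"
    and add: "\<And>us g h vs. F (us @ [g + h] @ vs) - F (us @ [g] @ vs) - F (us @ [h] @ vs) \<in> J"
    and scale: "\<And>us c g vs. F (us @ [c *s g] @ vs) - scal c * F (us @ [g] @ vs) \<in> J"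
  shows linext_sym_ideal: "(\<And>us g h vs. F (us @ [g, h] @ vs) - F (us @ [h, g] @ vs) \<in> J) \<Longrightarrow>
      f \<in> sym_ideal \<Longrightarrow> linext F f \<in> J"
    and linext_env_ideal: "(\<And>us g h vs. F (us @ [g, h] @ vs) - F (us @ [h, g] @ vs) - F (us @ [bracket g h] @ vs) \<in> J) \<Longrightarrow>
      f \<in> env_ideal \<Longrightarrow> linext F f \<in> J"
proof -
  have m: "mon_word us * mon_word ws * mon_word vs = mon_word (us @ ws @ vs)"
    and mc: "mon_word us * (scal c * mon_word ws) * mon_word vs = scal c * mon_word (us @ ws @ vs)" for us vs ws c
    by (simp_all only: mult_scal mult.assoc mon_mult append.assoc)
  have lin: "linext F (mon_word us * r * mon_word vs) \<in> J" if "r \<in> linear_relations" for us vs r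
    using that add scale
    by (auto simp: linear_relations_def left_diff_distrib right_diff_distrib m mc linext_diff linext_const linext_mon)
  {
    assume c: "\<And>us g h vs. F (us @ [g, h] @ vs) - F (us @ [h, g] @ vs) \<in> J" and f: "f \<in> sym_ideal"
    show "linext F f \<in> J"
    proof (rule linext_ideal[OF J _ f[unfolded sym_ideal_def]])
      show "linext F (mon_word us * r * mon_word vs) \<in> J"
        if "r \<in> linear_relations \<union> {mon_word [g, h] - mon_word [h, g] |g h. True}" for us r vs
        using that lin c by (auto simp: left_diff_distrib right_diff_distrib m linext_diff linext_mon)
    qed
  next
    assume c: "\<And>us g h vs. F (us @ [g, h] @ vs) - F (us @ [h, g] @ vs) - F (us @ [bracket g h] @ vs) \<in> J"
      and f: "f \<in> env_ideal"
    show "linext F f \<in> J"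
    proof (rule linext_ideal[OF J _ f[unfolded env_ideal_def]])
      show "linext F (mon_word us * r * mon_word vs) \<in> J"
        if "r \<in> linear_relations \<union> {mon_word [g, h] - mon_word [h, g] - mon_word [bracket g h] |g h. True}" for us r vs
        using that lin c by (auto simp: left_diff_distrib right_diff_distrib m linext_diff linext_mon)
    qed
  }
qed

lemma extend_deriv_sym_ideal:
  assumes add: "\<And>g h. d (g + h) = d g + d h" and scale: "\<And>c g. d (c *s g) = c *s d g"
    and f: "f \<in> sym_ideal"
  shows "extend_deriv d f \<in> sym_ideal"
  unfolding extend_deriv_def
proof (rule linext_ideal[OF ideal_sym_ideal _ f[unfolded sym_ideal_def]])
  fix us vs :: "'g list" and r :: "('g,'k) free_alg"
  assume r: "r \<in> linear_relations \<union> {mon_word [g, h] - mon_word [h, g] |g h. True}"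
  have dr: "extend_deriv d r \<in> sym_ideal"
  proof -
    note minus = FA_linear_minus[OF FA_linear_extend_deriv]
    from r consider (a) g h where "r = mon_word [g + h] - mon_word [g] - mon_word [h]"
      | (b) c g where "r = mon_word [c *s g] - scal c * mon_word [g]"
      | (c) g h where "r = mon_word [g, h] - mon_word [h, g]"
      by (auto simp: linear_relations_def)
    thus ?thesis
    proof cases
      case a
      thus ?thesis by (simp add: minus extend_deriv_gen add sym_linear)
    next
      case b
      thus ?thesis by (simp add: minus extend_deriv_scal extend_deriv_gen scale sym_linear)
    next
      case c
      have "extend_deriv d r = (mon_word [d g, h] - mon_word [h, d g]) + (mon_word [g, d h] - mon_word [d h, g])"
        unfolding c minus extend_deriv_mon by (simp add: mon_mult)
      thus ?thesis using symI(2) sym_ideal_contains(2) by metis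
    qed
  qed
  have "r \<in> sym_ideal" using r unfolding sym_ideal_def genideal_def by blast
  hence "extend_deriv d (mon_word us * r * mon_word vs) \<in> sym_ideal"
    using dr by (simp add: extend_deriv_mult symI distrib_right)
  thus "linext (deriv_word d) (mon_word us * r * mon_word vs) \<in> sym_ideal"
    by (simp add: extend_deriv_def)
qed

text \<open>The action of \<open>g\<close> on the symmetric algebra, on the level of representatives in the free algebra.\<close>

definition act :: "'g \<Rightarrow> ('g, 'k) free_alg \<Rightarrow> ('g, 'k) free_alg"
  where "act g f = mon_word [E g] * f + extend_deriv (bracket g) f"

lemma act_sym_ideal: "f \<in> sym_ideal \<Longrightarrow> act g f \<in> sym_ideal"
  unfolding act_def
  by (intro symI(2) symI(4) extend_deriv_sym_ideal) (simp_all add: bracket_add_right bracket_scale_right)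

lemma FA_linear_act: "FA_linear (act g)"
  by (simp add: FA_linear_def act_def extend_deriv_add extend_deriv_scal mult_scal distrib_left algebra_simps)

lemma act_add: "act (g + h) f - act g f - act h f \<in> sym_ideal"
proof -
  let ?D = "\<lambda>f. extend_deriv (bracket (g + h)) f - extend_deriv (bracket g) f - extend_deriv (bracket h) f"
  have "FA_derivation ?D"
    unfolding FA_derivation_def
    by (intro conjI FA_linear_diff FA_linear_extend_deriv) (simp add: extend_deriv_mult algebra_simps)
  hence "?D f \<in> sym_ideal"
    by (rule FA_derivation_in_ideal[OF _ ideal_sym_ideal])
      (simp add: extend_deriv_gen bracket_add_left sym_linear)
  moreover have "(mon_word [E (g + h)] - mon_word [E g] - mon_word [E h]) * f \<in> sym_ideal"
    by (intro symI(5)) (simp add: E_add sym_linear)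
  ultimately have "(mon_word [E (g + h)] - mon_word [E g] - mon_word [E h]) * f + ?D f \<in> sym_ideal"
    by (rule symI(2)[rotated])
  thus ?thesis by (simp add: act_def algebra_simps)
qed

lemma act_scale: "act (c *s g) f - scal c * act g f \<in> sym_ideal"
proof -
  let ?D = "\<lambda>f. extend_deriv (bracket (c *s g)) f - scal c * extend_deriv (bracket g) f"
  have "FA_linear (\<lambda>f. scal c * extend_deriv (bracket g) f)"
    by (simp add: FA_linear_def extend_deriv_add extend_deriv_scal distrib_left)
      (simp add: const_mult_const mult.commute flip: mult.assoc)
  moreover have "scal c * (f * h) = f * (scal c * h)" for f h :: "('g, 'k) free_alg"
    by (rule mult_scal[symmetric])
  ultimately have "FA_derivation ?D"
    unfolding FA_derivation_def
    by (intro conjI FA_linear_diff FA_linear_extend_deriv)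
      (simp_all add: extend_deriv_mult algebra_simps)
  hence "?D f \<in> sym_ideal"
    by (rule FA_derivation_in_ideal[OF _ ideal_sym_ideal])
      (simp add: extend_deriv_gen bracket_scale_left sym_linear)
  moreover have "(mon_word [E (c *s g)] - scal c * mon_word [E g]) * f \<in> sym_ideal"
    by (intro symI(5)) (simp add: E_scale sym_linear)
  ultimately have "(mon_word [E (c *s g)] - scal c * mon_word [E g]) * f + ?D f \<in> sym_ideal"
    by (rule symI(2)[rotated])
  thus ?thesis by (simp add: act_def algebra_simps)
qed

text \<open>The three contributions to the difference are \<open>ad\<close> of a commutator (\<open>D\<close>), the commutator of two
  multiplications (\<open>c\<close>), and the mixed terms, which cancel because \<open>E\<close> is a derivation (\<open>b\<close>).\<close>

lemma act_bracket: "act g (act h f) - act h (act g f) - act (bracket g h) f \<in> sym_ideal"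
proof -
  let ?d = "\<lambda>g. extend_deriv (bracket g) :: ('g, 'k) free_alg \<Rightarrow> ('g, 'k) free_alg"
  let ?D = "\<lambda>f. ?d g (?d h f) - ?d h (?d g f) - ?d (bracket g h) f"
  have "FA_derivation ?D"
    unfolding FA_derivation_def
    by (intro conjI FA_linear_diff FA_linear_comp[of "?d _" "?d _"] FA_linear_extend_deriv)
      (simp add: extend_deriv_mult extend_deriv_add algebra_simps)
  hence D: "?D f \<in> sym_ideal"
  proof (rule FA_derivation_in_ideal[OF _ ideal_sym_ideal])
    fix a
    show "?D (mon_word [a]) \<in> sym_ideal"
      using symI(6)[OF sym_linear(5)[of "bracket g (bracket h a)" "bracket h (bracket g a)"]]
      by (simp add: extend_deriv_gen jacobi_left)
  qed
  have c: "(mon_word [E g] * mon_word [E h] - mon_word [E h] * mon_word [E g]) * f \<in> sym_ideal"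
    by (intro symI(5)) (simp add: mon_mult sym_ideal_contains)
  have "mon_word [bracket g (E h) - bracket h (E g)] - (mon_word [bracket g (E h)] - mon_word [bracket h (E g)]) \<in> sym_ideal"
    by (rule sym_linear)
  moreover have "bracket g (E h) - bracket h (E g) = E (bracket g h)"
    by (subst bracket_anti[of h]) (simp add: E_bracket)
  ultimately have b: "- (mon_word [E (bracket g h)] - (mon_word [bracket g (E h)] - mon_word [bracket h (E g)])) * f \<in> sym_ideal"
    by (intro symI(5,6)) simp
  show ?thesis
    using symI(2)[OF symI(2)[OF D c] b]
    by (simp add: act_def extend_deriv_add extend_deriv_mult extend_deriv_gen algebra_simps)
qed

lemma foldr_act_linear: "FA_linear (foldr act us)"
proof (induction us)
  case (Cons g us)
  thus ?case using FA_linear_comp[OF FA_linear_act Cons] by (simp add: comp_def)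
qed (simp add: FA_linear_def)

lemma foldr_act_sym_ideal: "f \<in> sym_ideal \<Longrightarrow> foldr act us f \<in> sym_ideal"
  by (induction us) (auto intro: act_sym_ideal)

text \<open>The map from the enveloping algebra to the symmetric algebra that applies an element to \<open>1\<close>.\<close>

definition act_on_one :: "('g, 'k) free_alg \<Rightarrow> ('g, 'k) free_alg"
  where "act_on_one = linext (\<lambda>us. foldr act us 1)"

lemma FA_linear_act_on_one: "FA_linear act_on_one"
  unfolding act_on_one_def by (rule FA_linear_linext)

lemma act_on_one_mon: "act_on_one (mon_word us) = foldr act us 1"
  by (simp add: act_on_one_def linext_mon)

text \<open>The generators of the ideal act as zero by the lemmas on \<open>act\<close>. The word to the right of a generator
  only changes the element acted upon, and the action of the word to the left preserves the ideal.\<close>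

lemma act_on_one_env_ideal:
  assumes "f \<in> env_ideal"
  shows "act_on_one f \<in> sym_ideal"
proof -
  note minus = FA_linear_minus[OF foldr_act_linear] and fscal = FA_linear_scalD[OF foldr_act_linear]
  show ?thesis
    unfolding act_on_one_def
  proof (rule linext_env_ideal[OF ideal_sym_ideal _ _ _ assms])
    fix us vs g h c
    let ?s = "foldr act vs 1"
    show "foldr act (us @ [g + h] @ vs) 1 - foldr act (us @ [g] @ vs) 1 - foldr act (us @ [h] @ vs) 1 \<in> sym_ideal"
      using foldr_act_sym_ideal[OF act_add[of g h ?s], of us] by (simp add: minus)
    show "foldr act (us @ [c *s g] @ vs) 1 - scal c * foldr act (us @ [g] @ vs) 1 \<in> sym_ideal"
      using foldr_act_sym_ideal[OF act_scale[of c g ?s], of us] by (simp add: minus fscal)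
    show "foldr act (us @ [g, h] @ vs) 1 - foldr act (us @ [h, g] @ vs) 1 - foldr act (us @ [bracket g h] @ vs) 1 \<in> sym_ideal"
      using foldr_act_sym_ideal[OF act_bracket[of g h ?s], of us] by (simp add: minus)
  qed
qed

lemma hom_part_act_on_one:
  assumes "length us \<le> d"
  shows "hom_part d (act_on_one (mon_word us)) = (if length us = d then mon_word (map E us) else 0)"
  using assms
proof (induction us arbitrary: d)
  case Nil
  show ?case using hom_part_mon[of d "[]"] act_on_one_mon[of "[]"] by (cases "d = 0") (simp_all add: mon_word_Nil)
next
  case (Cons g us)
  then obtain k where d: "d = Suc k" "length us \<le> k" by (cases d) auto
  have "hom_part d (extend_deriv (bracket g) (act_on_one (mon_word us))) = 0"
    using Cons.IH[of d] d by (simp add: hom_part_extend_deriv FA_linear_0[OF FA_linear_extend_deriv])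
  moreover have "hom_part d (mon_word [E g] * act_on_one (mon_word us)) = mon_word [E g] * hom_part k (act_on_one (mon_word us))"
    unfolding d by (rule hom_part_mult_letter)
  ultimately show ?case
    using Cons.IH[OF d(2)] d by (simp add: act_on_one_mon act_def hom_part_add mon_mult)
qed

lemma mon_swap_sym_ideal: "mon_word (us @ [g, h] @ vs) - mon_word (us @ [h, g] @ vs) \<in> sym_ideal"
proof -
  have "mon_word us * (mon_word [g, h] - mon_word [h, g]) * mon_word vs \<in> sym_ideal"
    by (intro symI(4,5) sym_ideal_contains)
  thus ?thesis by (simp add: left_diff_distrib right_diff_distrib mon_mult)
qed

lemma mon_move_sym_ideal: "mon_word (us @ g # vs) - mon_word (g # us @ vs) \<in> sym_ideal"
proof (induction us)
  case Nil
  show ?case by (simp add: symI)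
next
  case (Cons a us)
  have "mon_word [a] * (mon_word (us @ g # vs) - mon_word (g # us @ vs)) \<in> sym_ideal"
    by (intro symI(4) Cons)
  hence "mon_word ((a # us) @ g # vs) - mon_word (a # g # us @ vs) \<in> sym_ideal"
    by (simp add: right_diff_distrib mon_mult)
  thus ?case using mon_swap_sym_ideal[of "[]" a g "us @ vs"]
    by (simp add: ideal_trans[OF ideal_sym_ideal])
qed

lemma mon_perm_sym_ideal: "mset us = mset vs \<Longrightarrow> mon_word us - mon_word vs \<in> sym_ideal"
proof (induction us arbitrary: vs)
  case Nil
  thus ?case by (simp add: symI)
next
  case (Cons g us)
  hence "g \<in> set vs" by (metis list.set_intros(1) mset_eq_setD)
  then obtain as bs where vs: "vs = as @ g # bs" by (meson split_list)
  hence "mset us = mset (as @ bs)" using Cons.prems by simp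
  hence "mon_word [g] * (mon_word us - mon_word (as @ bs)) \<in> sym_ideal"
    by (intro symI(4) Cons.IH)
  hence "mon_word (g # us) - mon_word (g # as @ bs) \<in> sym_ideal"
    by (simp add: right_diff_distrib mon_mult)
  moreover have "mon_word (g # as @ bs) - mon_word vs \<in> sym_ideal"
    using symI(6)[OF mon_move_sym_ideal[of as g bs]] by (simp add: vs)
  ultimately show ?case by (rule ideal_trans[OF ideal_sym_ideal])
qed

text \<open>An average over permutations of terms that all agree with \<open>f\<close> modulo the ideal.\<close>

lemma symmetrize_sym:
  assumes "FA_linear T" "\<And>\<sigma>. \<sigma> permutes {..<length us} \<Longrightarrow> T (mon_word (permute_list \<sigma> us)) - f \<in> sym_ideal"
  shows "T (symmetrize (mon_word us)) - f \<in> sym_ideal"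
proof -
  let ?P = "{\<sigma>. \<sigma> permutes {..<length us}}"
  have feq: "scal (1 / fact (length us)) * (\<Sum>\<sigma>\<in>?P. f) = f"
  proof -
    have "(\<Sum>\<sigma>\<in>?P. f) = of_nat (fact (length us)) * f"
      by (simp add: card_permutations[OF refl])
    also have "\<dots> = scal (fact (length us)) * f"
      by (simp only: scal_of_nat[symmetric] of_nat_fact)
    finally have "scal (1 / fact (length us)) * (\<Sum>\<sigma>\<in>?P. f) = scal 1 * f"
      by (simp only: mult.assoc[symmetric] const_mult_const) simp
    thus ?thesis by (simp add: scal_1)
  qed
  have "T (symmetrize (mon_word us)) - f =
      scal (1 / fact (length us)) * (\<Sum>\<sigma>\<in>?P. T (mon_word (permute_list \<sigma> us))) - scal (1 / fact (length us)) * (\<Sum>\<sigma>\<in>?P. f)"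
    unfolding feq by (simp add: symmetrize_linext linext_mon FA_linear_scalD[OF assms(1)] FA_linear_sum[OF assms(1)])
  also have "\<dots> = scal (1 / fact (length us)) * (\<Sum>\<sigma>\<in>?P. T (mon_word (permute_list \<sigma> us)) - f)"
    by (simp add: sum_subtractf right_diff_distrib)
  also have "\<dots> \<in> sym_ideal" using assms(2) by (intro symI(4) symI(7)) simp
  finally show ?thesis .
qed

lemma FA_linear_symmetrize: "FA_linear symmetrize"
  unfolding symmetrize_linext by (rule FA_linear_linext)

lemma linext_map_sym_ideal:
  assumes add: "\<And>g h. d (g + h) = d g + d h" and scale: "\<And>c g. d (c *s g) = c *s d g"
    and f: "f \<in> sym_ideal"
  shows "linext (\<lambda>us. mon_word (map d us)) f \<in> sym_ideal"
  using mid_relation[OF ideal_sym_ideal sym_ideal_contains(1), of "map d _" _ _ "map d _"]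
    mon_swap_sym_ideal[of "map d _" _ _ "map d _"]
  by (intro linext_sym_ideal[OF ideal_sym_ideal _ _ _ f]) (simp_all add: add scale)

lemma hom_part_sym_ideal:
  assumes f: "f \<in> sym_ideal"
  shows "hom_part d f \<in> sym_ideal"
  unfolding hom_part_linext
  using mid_relation[OF ideal_sym_ideal sym_ideal_contains(1)] mon_swap_sym_ideal
  by (intro linext_sym_ideal[OF ideal_sym_ideal _ _ _ f]) (simp_all add: symI(1))

text \<open>Induction on the length of the words in \<open>f\<close>. Applying the symmetrization of \<open>f\<close> to \<open>1\<close> shows that
  the top degree part of \<open>f\<close>, with \<open>E\<close> applied to each letter, vanishes in the symmetric algebra;
  by functoriality \<open>E\<close> can be undone.\<close>

lemma symmetrize_injective:
  assumes "symmetrize f \<in> env_ideal"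
  shows "f \<in> sym_ideal"
proof -
  have main: "f \<in> sym_ideal" if "\<And>u. u \<in> Poly_Mapping.keys f \<Longrightarrow> length (letters u) < N" "symmetrize f \<in> env_ideal" for N
    using that
  proof (induction N arbitrary: f)
    case 0
    have "Poly_Mapping.keys f = {}" using "0.prems"(1) by (meson equals0I not_less0)
    hence "f = 0" by simp
    thus ?case by (simp only: symI(1))
  next
    case (Suc N)
    let ?h = "hom_part N f"
    let ?E = "\<lambda>d. linext (\<lambda>us. mon_word (map d us)) :: ('g, 'k) free_alg \<Rightarrow> ('g, 'k) free_alg"
    have lin: "FA_linear (\<lambda>f. hom_part N (act_on_one f))"
      by (rule FA_linear_comp[OF FA_linear_hom_part FA_linear_act_on_one])
    have "hom_part N (act_on_one (symmetrize f)) - ?E E ?h \<in> sym_ideal"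
    proof (rule FA_linear_in_ideal[where f = f and T = "\<lambda>f. hom_part N (act_on_one (symmetrize f)) - ?E E (hom_part N f)", OF _ ideal_sym_ideal])
      show "FA_linear (\<lambda>f. hom_part N (act_on_one (symmetrize f)) - ?E E (hom_part N f))"
        by (rule FA_linear_diff[OF FA_linear_comp[OF lin FA_linear_symmetrize] FA_linear_comp[OF FA_linear_linext FA_linear_hom_part]])
    next
      fix us assume "Free_Monoid us \<in> Poly_Mapping.keys f"
      hence "length us \<le> N" using Suc.prems(1)[of "Free_Monoid us"] by simp
      show "hom_part N (act_on_one (symmetrize (mon_word us))) - ?E E (hom_part N (mon_word us)) \<in> sym_ideal"
      proof (rule symmetrize_sym[OF lin])
        fix \<sigma> assume \<sigma>: "\<sigma> permutes {..<length us}"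
        have "mset (map E (permute_list \<sigma> us)) = mset (map E us)" using \<sigma> by simp
        hence "mon_word (map E (permute_list \<sigma> us)) - mon_word (map E us) \<in> sym_ideal"
          by (rule mon_perm_sym_ideal)
        thus "hom_part N (act_on_one (mon_word (permute_list \<sigma> us))) - ?E E (hom_part N (mon_word us)) \<in> sym_ideal"
          using \<open>length us \<le> N\<close>
          by (cases "length us = N")
            (simp_all add: hom_part_act_on_one hom_part_mon linext_mon FA_linear_0[OF FA_linear_linext] symI(1))
      qed
    qed
    moreover have "act_on_one (symmetrize f) \<in> sym_ideal" by (rule act_on_one_env_ideal[OF Suc.prems(2)])
    ultimately have EE: "?E E ?h \<in> sym_ideal"
      using symI(3)[of "hom_part N (act_on_one (symmetrize f))" "hom_part N (act_on_one (symmetrize f)) - ?E E ?h"]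
      by (simp add: hom_part_sym_ideal)
    let ?I = "inv_into UNIV E"
    have inv_E: "?I (E g) = g" "E (?I g) = g" for g
      by (rule inv_into_f_f[OF bij_is_inj[OF E_bij] UNIV_I], rule surj_f_inv_f[OF bij_is_surj[OF E_bij]])
    have "?I (g + h) = ?I g + ?I h" for g h
      by (rule injD[OF bij_is_inj[OF E_bij]]) (simp add: E_add inv_E)
    moreover have "?I (c *s g) = c *s ?I g" for c g
      by (rule injD[OF bij_is_inj[OF E_bij]]) (simp add: E_scale inv_E)
    ultimately have "?E ?I (?E E ?h) \<in> sym_ideal"
      by (rule linext_map_sym_ideal[OF _ _ EE])
    moreover have "?E ?I (?E E h) = h" for h
      by (rule FA_linear_eqI[where f = h])
        (simp_all add: FA_linear_def linext_add linext_const linext_mon comp_def inv_E)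
    ultimately have h: "?h \<in> sym_ideal" by simp
    have "f - ?h \<in> sym_ideal"
    proof (rule Suc.IH)
      have "symmetrize (f - ?h) = symmetrize f - symmetrize ?h"
        by (rule FA_linear_minus[OF FA_linear_symmetrize])
      thus "symmetrize (f - ?h) \<in> env_ideal"
        using envI(3)[OF Suc.prems(2) symmetrize_sym_ideal[OF h]] by simp
      fix u assume "u \<in> Poly_Mapping.keys (f - ?h)"
      hence "u \<in> Poly_Mapping.keys f" "length (letters u) \<noteq> N"
        by (auto simp: in_keys_iff lookup_minus lookup_hom_part split: if_splits)
      thus "length (letters u) < N" using Suc.prems(1)[of u] by simp
    qed
    hence "f - ?h + ?h \<in> sym_ideal" using h by (rule symI(2))
    thus ?case by simp
  qed
  show ?thesis
  proof (rule main[OF _ assms])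
    fix u assume "u \<in> Poly_Mapping.keys f"
    hence "length (letters u) \<le> Max ((\<lambda>u. length (letters u)) ` Poly_Mapping.keys f)"
      by (intro Max_ge) simp_all
    thus "length (letters u) < Suc (Max ((\<lambda>u. length (letters u)) ` Poly_Mapping.keys f))" by simp
  qed
qed

end

section \<open>Powers of square-zero series as sums over ordered set partitions\<close>

text \<open>The labels \<open>q \<in> I\<close> index the terms of a series, and \<open>supp q\<close> is the set of variables of the term of
  \<open>q\<close>. A product of terms survives exactly if the supports are disjoint.\<close>

definition block_lists :: "'q set \<Rightarrow> ('q \<Rightarrow> 'v set) \<Rightarrow> nat \<Rightarrow> 'v set \<Rightarrow> 'q list set"
  where "block_lists I supp n C = {qs. length qs = n \<and> set qs \<subseteq> I \<and>
    sorted_wrt (\<lambda>p q. supp p \<inter> supp q = {}) qs \<and> (\<Union>q\<in>set qs. supp q) = C}"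

lemma block_lists_0: "block_lists I supp 0 C = (if C = {} then {[]} else {})"
  by (auto simp: block_lists_def)

lemma Cons_in_block_lists:
  "q # qs \<in> block_lists I supp (Suc n) C \<longleftrightarrow> q \<in> I \<and> supp q \<subseteq> C \<and> qs \<in> block_lists I supp n (C - supp q)"
  by (auto simp: block_lists_def)

lemma block_lists_Suc:
  "block_lists I supp (Suc n) C = (\<lambda>(T, q, qs). q # qs) ` (SIGMA T:Pow C. SIGMA q:{q \<in> I. supp q = T}. block_lists I supp n (C - T))"
proof (intro equalityI subsetI)
  fix ps assume ps: "ps \<in> block_lists I supp (Suc n) C"
  then obtain q qs where "ps = q # qs" by (auto simp: block_lists_def length_Suc_conv)
  thus "ps \<in> (\<lambda>(T, q, qs). q # qs) ` (SIGMA T:Pow C. SIGMA q:{q \<in> I. supp q = T}. block_lists I supp n (C - T))"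
    using ps by (auto simp: Cons_in_block_lists intro!: image_eqI[of _ _ "(supp q, q, qs)"])
qed (auto simp: Cons_in_block_lists)

lemma coef_power_expansion:
  fixes F :: "('v, 'a::ring_1) set_series"
  assumes fin: "\<And>C. finite C \<Longrightarrow> finite {q \<in> I. supp q = C}"
    and F: "\<And>C. finite C \<Longrightarrow> coef F C = (\<Sum>q | q \<in> I \<and> supp q = C. f q)"
    and "finite C"
  shows "finite (block_lists I supp n C)" "coef (F ^ n) C = (\<Sum>qs\<in>block_lists I supp n C. prod_list (map f qs))"
proof -
  have "finite (block_lists I supp n C) \<and> coef (F ^ n) C = (\<Sum>qs\<in>block_lists I supp n C. prod_list (map f qs))"
    using \<open>finite C\<close>
  proof (induction n arbitrary: C)
    case 0
    thus ?case by (simp add: block_lists_0 coef_simps)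
  next
    case (Suc n)
    let ?S = "SIGMA T:Pow C. SIGMA q:{q \<in> I. supp q = T}. block_lists I supp n (C - T)"
    have f1: "finite (Pow C)" using Suc.prems by simp
    have fT: "T \<in> Pow C \<Longrightarrow> finite T" for T using Suc.prems by (auto intro: finite_subset)
    have f2: "T \<in> Pow C \<Longrightarrow> finite {q \<in> I. supp q = T}" for T by (rule fin[OF fT])
    have f3: "finite (block_lists I supp n (C - T))" for T using Suc.prems Suc.IH[of "C - T"] by simp
    have f23: "T \<in> Pow C \<Longrightarrow> finite (SIGMA q:{q \<in> I. supp q = T}. block_lists I supp n (C - T))" for T
      using f2[of T] f3[of T] by (rule finite_SigmaI)
    have inj: "inj_on (\<lambda>(T, q, qs). q # qs) ?S"
      by (auto simp: inj_on_def)
    have "coef (F ^ Suc n) C = (\<Sum>T\<in>Pow C. (\<Sum>q | q \<in> I \<and> supp q = T. f q) * (\<Sum>qs\<in>block_lists I supp n (C - T). prod_list (map f qs)))"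
      using F[OF fT] Suc.IH Suc.prems by (simp add: coef_mult)
    also have "\<dots> = (\<Sum>T\<in>Pow C. \<Sum>(q, qs)\<in>(SIGMA q:{q \<in> I. supp q = T}. block_lists I supp n (C - T)). f q * prod_list (map f qs))"
      using f2 f3 by (intro sum.cong refl) (simp add: sum_product sum.Sigma)
    also have "\<dots> = (\<Sum>(T, q, qs)\<in>?S. f q * prod_list (map f qs))"
      using f1 f23 by (subst sum.Sigma) auto
    also have "\<dots> = (\<Sum>qs\<in>block_lists I supp (Suc n) C. prod_list (map f qs))"
      unfolding block_lists_Suc by (subst sum.reindex[OF inj]) (simp add: case_prod_beta)
    finally show ?case
      unfolding block_lists_Suc using finite_SigmaI[OF f1 f23] by simp
  qed
  thus "finite (block_lists I supp n C)" "coef (F ^ n) C = (\<Sum>qs\<in>block_lists I supp n C. prod_list (map f qs))"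
    by blast+
qed

lemma block_lists_sets: 
  "block_lists {C. C \<noteq> {}} (\<lambda>C. C) n V = {Cs. distinct Cs \<and> partition_on V (set Cs) \<and> length Cs = n}"
proof -
  have "sorted_wrt (\<lambda>S T. S \<inter> T = {}) Cs \<longleftrightarrow> distinct Cs \<and> disjoint (set Cs)" if "{} \<notin> set Cs" for Cs :: "'a set list"
    using that by (induction Cs) (auto simp: pairwise_insert disjnt_def)
  thus ?thesis by (auto simp: block_lists_def partition_on_def)
qed

context central_scalars begin

text \<open>The exponential formula. The summand of \<open>\<pi>\<close> is the symmetrized product of the coefficients of \<open>Z\<close> at the
  blocks of \<open>\<pi>\<close>, because the products in \<open>Z\<^sup>n\<close> run over the orderings of each partition into \<open>n\<close> blocks.\<close>

lemma coef_exp_series_partitions: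
  assumes Z: "coef Z {} = 0" and V: "finite V"
  shows "coef (exp_series Z) V = (\<Sum>\<pi> | partition_on V \<pi>.
    sc (1 / fact (card \<pi>)) * (\<Sum>Cs\<in>permutations_of_set \<pi>. prod_list (map (coef Z) Cs)))"
proof -
  (* partitions have at most 2 ^ card V blocks, a bound beyond which the exponential series may be cut off *)
  let ?I = "{C. C \<noteq> {}} :: 'b set set" and ?M = "card (Pow V)"
  have N: "order_ge 1 Z" using Z by (simp only: order_ge_1)
  have e: "{D \<in> ?I. D = C} = (if C = {} then {} else {C})" for C by auto
  have e1: "finite {D \<in> ?I. D = C}" and e2: "coef Z C = sum (coef Z) {D \<in> ?I. D = C}" for C
    unfolding e by (simp_all add: Z)
  note pw = coef_power_expansion[of ?I "\<lambda>C. C" Z "coef Z", OF e1 e2 V]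
  have fin: "finite {\<pi>. partition_on V \<pi>}" by (rule finitely_many_partition_on[OF V])
  have sub: "\<pi> \<subseteq> Pow V" if "partition_on V \<pi>" for \<pi> using that by (auto simp: partition_on_def)
  have card: "card \<pi> \<le> ?M" "finite \<pi>" if "partition_on V \<pi>" for \<pi>
    using card_mono[OF _ sub[OF that]] finite_subset[OF sub[OF that]] V by auto
  have "card V \<le> ?M" using V by (simp add: card_Pow less_imp_le)
  hence "coef (exp_series Z) V = (\<Sum>n\<le>?M. \<Sum>Cs\<in>block_lists ?I (\<lambda>C. C) n V. sc (1 / fact n) * prod_list (map (coef Z) Cs))"
    by (simp add: coef_subst[OF N] pw sum_distrib_left)
  also have "\<dots> = (\<Sum>(n, Cs)\<in>(SIGMA n:{..?M}. block_lists ?I (\<lambda>C. C) n V). sc (1 / fact n) * prod_list (map (coef Z) Cs))"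
    using pw(1) by (subst sum.Sigma) auto
  also have "\<dots> = (\<Sum>(\<pi>, Cs)\<in>(SIGMA \<pi>:{\<pi>. partition_on V \<pi>}. permutations_of_set \<pi>).
      sc (1 / fact (card \<pi>)) * prod_list (map (coef Z) Cs))"
    by (rule sum.reindex_bij_witness[of _ "\<lambda>(\<pi>, Cs). (card \<pi>, Cs)" "\<lambda>(n, Cs). (set Cs, Cs)"])
      (auto simp: block_lists_sets permutations_of_set_def distinct_card card simp flip: distinct_card)
  also have "\<dots> = (\<Sum>\<pi> | partition_on V \<pi>. \<Sum>Cs\<in>permutations_of_set \<pi>. sc (1 / fact (card \<pi>)) * prod_list (map (coef Z) Cs))"
    using fin by (subst sum.Sigma) auto
  finally show ?thesis by (simp add: sum_distrib_left)
qed

end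

section \<open>Lie elements and the Dynkin map\<close>

global_interpretation scal: central_scalars "scal :: 'k::field_char_0 \<Rightarrow> ('g, 'k) free_alg"
  by unfold_locales (rule const_add, rule const_mult_const[symmetric], rule scal_1, rule const_comm)

context lie_algebra_derivation begin

text \<open>Being represented in the enveloping algebra by an element of \<open>g\<close> of degree \<open>n\<close>. Degrees are
  eigenvalues of the derivation \<open>E\<close>.\<close>

definition lie_degree :: "nat \<Rightarrow> ('g, 'k) free_alg \<Rightarrow> bool"
  where "lie_degree n f \<longleftrightarrow> (\<exists>h. E h = of_nat n *s h \<and> f - mon_word [h] \<in> env_ideal)"

lemma lie_degree_0: "lie_degree n 0"
proof -
  have "E 0 = 0" using E_add[of 0 0] by simp
  moreover have "0 - mon_word [0] \<in> env_ideal" using envI(6)[OF env_linear(3)] by simp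
  ultimately show ?thesis unfolding lie_degree_def by (intro exI[of _ 0]) simp
qed

lemma lie_degree_add:
  assumes "lie_degree n f" "lie_degree n g"
  shows "lie_degree n (f + g)"
proof -
  obtain a b where ab: "E a = of_nat n *s a" "f - mon_word [a] \<in> env_ideal"
    "E b = of_nat n *s b" "g - mon_word [b] \<in> env_ideal"
    using assms unfolding lie_degree_def by blast
  have "(f - mon_word [a]) + (g - mon_word [b]) - (mon_word [a + b] - mon_word [a] - mon_word [b]) \<in> env_ideal"
    by (intro envI(2,3) ab env_linear)
  hence "f + g - mon_word [a + b] \<in> env_ideal" by (simp add: algebra_simps)
  moreover have "E (a + b) = of_nat n *s (a + b)" by (simp add: E_add ab scale_right_distrib)
  ultimately show ?thesis unfolding lie_degree_def by blast
qed

lemma lie_degree_scal: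
  assumes "lie_degree n f"
  shows "lie_degree n (scal c * f)"
proof -
  obtain a where a: "E a = of_nat n *s a" "f - mon_word [a] \<in> env_ideal"
    using assms unfolding lie_degree_def by blast
  have "scal c * (f - mon_word [a]) - (mon_word [c *s a] - scal c * mon_word [a]) \<in> env_ideal"
    by (intro envI(3,4) a env_linear)
  hence "scal c * f - mon_word [c *s a] \<in> env_ideal" by (simp add: algebra_simps)
  moreover have "E (c *s a) = of_nat n *s (c *s a)" by (simp add: E_scale a mult.commute)
  ultimately show ?thesis unfolding lie_degree_def by blast
qed

lemma lie_degree_diff: "lie_degree n f \<Longrightarrow> lie_degree n g \<Longrightarrow> lie_degree n (f - g)"
proof -
  have "scal (- 1) = (- 1 :: ('g, 'k) free_alg)"
  proof -
    have "scal (- 1) + scal 1 = (scal 0 :: ('g, 'k) free_alg)" by (simp only: const_add[symmetric]) simp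
    thus ?thesis by (simp only: scal_0 scal_1 eq_neg_iff_add_eq_0)
  qed
  hence "scal (- 1) * g = - g" by simp
  thus "lie_degree n f \<Longrightarrow> lie_degree n g \<Longrightarrow> lie_degree n (f - g)"
    using lie_degree_add[of n f "scal (- 1) * g"] lie_degree_scal[of n g "- 1"] by simp
qed

lemma lie_degree_sum: "(\<And>i. i \<in> I \<Longrightarrow> lie_degree n (f i)) \<Longrightarrow> lie_degree n (sum f I)"
  by (induction I rule: infinite_finite_induct) (auto intro: lie_degree_0 lie_degree_add)

lemma mon_bracket_env: "mon_word [g, h] - mon_word [h, g] - mon_word [bracket g h] \<in> env_ideal"
  unfolding env_ideal_def genideal_def by blast

lemma lie_degree_commutator:
  assumes "lie_degree m f" "lie_degree n g"
  shows "lie_degree (m + n) (f * g - g * f)"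
proof -
  obtain a b where ab: "E a = of_nat m *s a" "f - mon_word [a] \<in> env_ideal"
    "E b = of_nat n *s b" "g - mon_word [b] \<in> env_ideal"
    using assms unfolding lie_degree_def by blast
  let ?d = "f - mon_word [a]" and ?e = "g - mon_word [b]"
  have "(?d * g + mon_word [a] * ?e) - (?e * f + mon_word [b] * ?d) +
      (mon_word [a, b] - mon_word [b, a] - mon_word [bracket a b]) \<in> env_ideal"
    by (intro envI(2,3,4,5) ab mon_bracket_env)
  moreover have "(?d * g + mon_word [a] * ?e) - (?e * f + mon_word [b] * ?d) +
      (mon_word [a, b] - mon_word [b, a] - mon_word [bracket a b]) = (f * g - g * f) - mon_word [bracket a b]"
    by (simp add: algebra_simps mon_mult)
  moreover have "E (bracket a b) = of_nat (m + n) *s bracket a b"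
    by (simp add: E_bracket ab bracket_scale_left bracket_scale_right scale_left_distrib)
  ultimately show ?thesis unfolding lie_degree_def by metis
qed

definition nested :: "'g list \<Rightarrow> 'g"
  where "nested us = foldr bracket (butlast us) (E (last us))"

lemma nested_append: "vs \<noteq> [] \<Longrightarrow> nested (us @ vs) = foldr bracket us (nested vs)"
  by (simp add: nested_def butlast_append)

lemma foldr_bracket_add: "foldr bracket us (g + h) = foldr bracket us g + foldr bracket us h"
  by (induction us) (simp_all add: bracket_add_right)

lemma foldr_bracket_scale: "foldr bracket us (c *s g) = c *s foldr bracket us g"
  by (induction us) (simp_all add: bracket_scale_right)

text \<open>The Dynkin map. The factor \<open>E\<close> on the last letter makes it well defined on words whose letters are
  arbitrary elements of \<open>g\<close>, not only generators of degree one.\<close>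

definition dynkin :: "('g, 'k) free_alg \<Rightarrow> ('g, 'k) free_alg"
  where "dynkin = linext (\<lambda>us. if us = [] then 0 else mon_word [nested us])"

lemma FA_linear_dynkin: "FA_linear dynkin"
  unfolding dynkin_def by (rule FA_linear_linext)

lemma dynkin_mon: "us \<noteq> [] \<Longrightarrow> dynkin (mon_word us) = mon_word [nested us]"
  by (simp add: dynkin_def linext_mon)

text \<open>Inside a word, a commutator relation is respected because of the Jacobi identity; at the end of a word it is
  respected because \<open>E\<close> is a derivation.\<close>

lemma dynkin_env_ideal:
  assumes "f \<in> env_ideal"
  shows "dynkin f \<in> env_ideal"
proof -
  have left: "nested (us @ [g] @ vs) = foldr bracket us (bracket g (nested vs))" if "vs \<noteq> []" for us g vs
    using nested_append[OF that, of "us @ [g]"] by simp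
  have last: "nested (us @ [g] @ []) = foldr bracket us (E g)" for us g
    by (simp add: nested_def)
  have add: "nested (us @ [g + h] @ vs) = nested (us @ [g] @ vs) + nested (us @ [h] @ vs)" for us g h vs
  proof (cases "vs = []")
    case True
    show ?thesis unfolding True last E_add by (rule foldr_bracket_add)
  next
    case False
    show ?thesis unfolding left[OF False] bracket_add_left by (rule foldr_bracket_add)
  qed
  have scale: "nested (us @ [c *s g] @ vs) = c *s nested (us @ [g] @ vs)" for us c g vs
  proof (cases "vs = []")
    case True
    show ?thesis unfolding True last E_scale by (rule foldr_bracket_scale)
  next
    case False
    show ?thesis unfolding left[OF False] bracket_scale_left by (rule foldr_bracket_scale)
  qed
  have comm: "nested (us @ [g, h] @ vs) = nested (us @ [bracket g h] @ vs) + nested (us @ [h, g] @ vs)" for us g h vs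
  proof (cases "vs = []")
    case True
    have "bracket h (E g) = - bracket (E g) h" by (rule bracket_anti)
    hence "bracket g (E h) = E (bracket g h) + bracket h (E g)" by (simp add: E_bracket)
    thus ?thesis using True nested_append[of "[_, _]"] nested_append[of "[_]"]
      by (simp add: nested_def foldr_bracket_add[symmetric] butlast_append)
  next
    case False
    have two: "nested (us @ [g, h] @ vs) = foldr bracket us (bracket g (bracket h (nested vs)))" for g h
      using nested_append[OF False, of "us @ [g, h]"] by simp
    show ?thesis unfolding two left[OF False] jacobi_left foldr_bracket_add[symmetric] by simp
  qed
  show ?thesis
    unfolding dynkin_def
  proof (rule linext_env_ideal[OF ideal_env_ideal _ _ _ assms])
    fix us vs g h c
    let ?d = "\<lambda>us. if us = [] then 0 else mon_word [nested us] :: ('g, 'k) free_alg"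
    show "?d (us @ [g + h] @ vs) - ?d (us @ [g] @ vs) - ?d (us @ [h] @ vs) \<in> env_ideal"
      unfolding add by (simp add: env_linear)
    show "?d (us @ [c *s g] @ vs) - scal c * ?d (us @ [g] @ vs) \<in> env_ideal"
      unfolding scale by (simp add: env_linear)
    show "?d (us @ [g, h] @ vs) - ?d (us @ [h, g] @ vs) - ?d (us @ [bracket g h] @ vs) \<in> env_ideal"
      using env_linear(1)[of "nested (us @ [bracket g h] @ vs)" "nested (us @ [h, g] @ vs)"]
      unfolding comm[of us g h vs] by (simp add: algebra_simps)
  qed
qed

text \<open>The theorem of Dynkin, Specht and Wever: on a one-letter word the map is \<open>E\<close>, which multiplies an
  element of degree \<open>n\<close> by \<open>n\<close>.\<close>

lemma lie_degree_dynkin: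
  assumes "lie_degree n f"
  shows "scal (of_nat n) * f - dynkin f \<in> env_ideal"
proof -
  obtain a where a: "E a = of_nat n *s a" "f - mon_word [a] \<in> env_ideal"
    using assms unfolding lie_degree_def by blast
  have "dynkin (mon_word [a]) = mon_word [of_nat n *s a]"
    by (simp add: dynkin_mon nested_def a)
  hence "scal (of_nat n) * (f - mon_word [a]) - dynkin (f - mon_word [a]) -
      (mon_word [of_nat n *s a] - scal (of_nat n) * mon_word [a]) = scal (of_nat n) * f - dynkin f"
    by (simp add: FA_linear_minus[OF FA_linear_dynkin] algebra_simps)
  moreover have "scal (of_nat n) * (f - mon_word [a]) - dynkin (f - mon_word [a]) -
      (mon_word [of_nat n *s a] - scal (of_nat n) * mon_word [a]) \<in> env_ideal"
    by (intro envI(3,4) dynkin_env_ideal a env_linear)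
  ultimately show ?thesis by simp
qed

definition lie_below :: "nat \<Rightarrow> ('v, ('g, 'k) free_alg) set_series \<Rightarrow> bool"
  where "lie_below n F \<longleftrightarrow> (\<forall>C. card C < n \<longrightarrow> lie_degree (card C) (coef F C))"

lemma lie_below_mono: "lie_below n F \<Longrightarrow> m \<le> n \<Longrightarrow> lie_below m F"
  by (simp add: lie_below_def)

text \<open>The bound improves by one: as the constant terms vanish, only coefficients at proper subsets contribute to
  the commutator.\<close>

lemma lie_below_ad:
  assumes Z: "lie_below n Z" "coef Z {} = 0" and U: "lie_below n U" "coef U {} = 0"
  shows "lie_below (Suc n) (ad Z U)"
  unfolding lie_below_def
proof (intro allI impI)
  fix C :: "'a set" assume n: "card C < Suc n"
  show "lie_degree (card C) (coef (ad Z U) C)"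
  proof (cases "finite C")
    case True
    have "(\<Sum>T\<in>Pow C. coef U T * coef Z (C - T)) = (\<Sum>T\<in>Pow C. coef U (C - T) * coef Z T)"
      by (rule sum.reindex_bij_witness[of _ "\<lambda>T. C - T" "\<lambda>T. C - T"]) (auto simp: double_diff)
    hence "coef (ad Z U) C = (\<Sum>T\<in>Pow C. coef Z T * coef U (C - T) - coef U (C - T) * coef Z T)"
      by (simp add: ad_def coef_simps coef_mult sum_subtractf)
    also have "lie_degree (card C) \<dots>"
    proof (rule lie_degree_sum)
      fix T assume T: "T \<in> Pow C"
      show "lie_degree (card C) (coef Z T * coef U (C - T) - coef U (C - T) * coef Z T)"
      proof (cases "T = {} \<or> T = C")
        case True
        thus ?thesis using Z(2) U(2) lie_degree_0 by auto
      next
        case False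
        have c: "card C = card T + card (C - T)"
          using card_Un_disjoint[of T "C - T"] T True by (simp add: finite_subset Un_absorb1)
        (* both factors have smaller index sets *)
        have "T \<subset> C" "C - T \<subset> C" using False T by blast+
        hence "card T < card C" "card (C - T) < card C"
          using psubset_card_mono[OF True] by blast+
        hence "card T < n" "card (C - T) < n" using n by linarith+
        thus ?thesis unfolding c using Z(1) U(1) by (intro lie_degree_commutator) (auto simp: lie_below_def)
      qed
    qed
    finally show ?thesis .
  qed (simp add: coef_infinite lie_degree_0)
qed

lemma coef_ad_power_empty: "coef Z {} = 0 \<Longrightarrow> coef U {} = 0 \<Longrightarrow> coef ((ad Z ^^ l) U) {} = 0"
  by (induction l) (simp_all add: ad_def coef_simps)

lemma lie_below_ad_power:
  assumes Z: "lie_below n Z" "coef Z {} = 0" and U: "lie_below n U" "coef U {} = 0"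
  shows "lie_below n ((ad Z ^^ l) U)" "l > 0 \<Longrightarrow> lie_below (Suc n) ((ad Z ^^ l) U)"
proof -
  show *: "lie_below n ((ad Z ^^ l) U)" for l
  proof (induction l)
    case (Suc l)
    have "lie_below (Suc n) (ad Z ((ad Z ^^ l) U))"
      by (rule lie_below_ad[OF Z Suc coef_ad_power_empty[OF Z(2) U(2)]])
    thus ?case using lie_below_mono[of "Suc n" _ n] by simp
  qed (simp add: U)
  assume "l > 0"
  then obtain k where "l = Suc k" by (cases l) auto
  thus "lie_below (Suc n) ((ad Z ^^ l) U)"
    using lie_below_ad[OF Z *[of k] coef_ad_power_empty[OF Z(2) U(2)]] by simp
qed

text \<open>The theorem of Baker, Campbell and Hausdorff in multilinear form, by induction on the size of the index set
  \<open>C\<close>. In the recursion \<open>log_exp_exp_recursion\<close> the summand for \<open>l = 0\<close> contributes \<open>card C\<close> times the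
  coefficient of \<open>Z\<close> at \<open>C\<close>, and all other terms are Lie elements by the induction hypothesis.\<close>

lemma log_exp_exp_is_lie:
  assumes F: "order_ge 1 F" "euler F = F" "\<And>n. lie_below n F"
    and G: "order_ge 1 G" "euler G = G" "\<And>n. lie_below n G"
    and Z: "order_ge 1 Z"
    and e: "scal.exp_series Z = scal.exp_series F * scal.exp_series G"
  shows "lie_below n Z"
proof (induction n)
  case (Suc n)
  have F0: "coef F {} = 0" and G0: "coef G {} = 0" and Z0: "coef Z {} = 0"
    using F(1) G(1) Z unfolding order_ge_1 by simp_all
  have EZ: "lie_below n (euler Z)" "coef (euler Z) {} = 0"
    using Suc lie_degree_scal[of _ _ "of_nat _"]
    by (auto simp: lie_below_def euler.rep_eq scal.sc_of_nat)
  show ?case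
    unfolding lie_below_def
  proof (intro allI impI)
    fix C :: "'a set" assume C: "card C < Suc n"
    let ?R = "\<lambda>a Z U. (\<Sum>l\<le>card C. scal (fps_nth a l) * coef ((ad Z ^^ l) U) C)"
    have R: "coef (scal.ad_subst a Z U) C = ?R a Z U" for a Z U
      by (simp add: scal.ad_subst_def series.rep_eq cmul.rep_eq)
    show "lie_degree (card C) (coef Z C)"
    proof (cases "card C = 0")
      case True
      hence "coef Z C = 0" using Z by (simp add: order_ge_def)
      thus ?thesis by (simp add: lie_degree_0)
    next
      case False
      have "coef (scal.ad_subst scal.dexp Z (euler Z)) C = coef F C + coef (scal.ad_subst (fps_exp 1) F G) C"
        using scal.log_exp_exp_recursion[OF F(1) G(1) Z F(2) G(2) e] by (simp only: plus_set_series.rep_eq)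
      hence "?R (scal.dexp) Z (euler Z) = coef F C + ?R (fps_exp 1) F G"
        by (simp only: R)
      moreover have "?R (scal.dexp) Z (euler Z) = of_nat (card C) * coef Z C +
          (\<Sum>l\<in>{1..card C}. scal (fps_nth scal.dexp l) * coef ((ad Z ^^ l) (euler Z)) C)"
      proof -
        have "{..card C} = insert 0 {1..card C}" by auto
        thus ?thesis by (simp add: scal.dexp_def scal_1 euler.rep_eq)
      qed
      ultimately have "of_nat (card C) * coef Z C = coef F C + ?R (fps_exp 1) F G -
          (\<Sum>l\<in>{1..card C}. scal (fps_nth scal.dexp l) * coef ((ad Z ^^ l) (euler Z)) C)"
        by (simp add: algebra_simps)
      also have "lie_degree (card C) \<dots>"
      proof (intro lie_degree_diff lie_degree_add lie_degree_sum lie_degree_scal)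
        show "lie_degree (card C) (coef F C)" using F(3) unfolding lie_below_def by blast
        show "lie_degree (card C) (coef ((ad F ^^ l) G) C)" for l
          using lie_below_ad_power(1)[OF F(3) F0 G(3) G0, of "Suc (card C)"] by (simp add: lie_below_def)
        show "lie_degree (card C) (coef ((ad Z ^^ l) (euler Z)) C)" if "l \<in> {1..card C}" for l
          using lie_below_ad_power(2)[OF Suc Z0 EZ, of l] that C by (simp add: lie_below_def)
      qed
      finally have "lie_degree (card C) (of_nat (card C) * coef Z C)" .
      hence "lie_degree (card C) (scal (1 / of_nat (card C)) * (of_nat (card C) * coef Z C))"
        by (rule lie_degree_scal)
      moreover have "scal (1 / of_nat (card C)) * (of_nat (card C) * coef Z C) = coef Z C"
        using False by (simp add: scal.sc_of_nat[symmetric] mult.assoc[symmetric] const_mult_const scal_1)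
      ultimately show ?thesis by simp
    qed
  qed
qed (simp add: lie_below_def)

end

section \<open>The logarithm of a product of two exponentials\<close>

lemma scal_mult_scal_mult: "(scal c * f) * (scal d * g) = scal (c * d) * (f * g)"
  by (simp only: mult.assoc mult_scal[of f d g]) (simp only: mult.assoc[symmetric] const_mult_const)

text \<open>The series \<open>\<Sum>\<^bsub>v\<in>S\<^esub> t\<^sub>v v\<close>: the letters index their own variables.\<close>

lift_definition letter_series :: "'g set \<Rightarrow> ('g, ('g, 'k::field) free_alg) set_series"
  is "\<lambda>S C. if is_singleton C \<and> C \<subseteq> S then mon_word [the_elem C] else 0"
  by (auto simp: is_singleton_def)

lemma coef_letter_series:
  "coef (letter_series S) C = (\<Sum>v | v \<in> S \<and> {v} = C. mon_word [v])"
proof (cases "\<exists>v\<in>S. C = {v}")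
  case True
  then obtain v where "v \<in> S" "C = {v}" by blast
  moreover have "{u. u \<in> S \<and> {u} = {v}} = {v}" using \<open>v \<in> S\<close> by auto
  ultimately show ?thesis by (simp add: letter_series.rep_eq is_singleton_def)
next
  case False
  hence e: "{v. v \<in> S \<and> {v} = C} = {}" by auto
  show ?thesis unfolding e using False by (auto simp: letter_series.rep_eq is_singleton_def)
qed

lemma coef_letter_series_empty: "coef (letter_series S) {} = 0"
  by (simp add: letter_series.rep_eq is_singleton_def)

lemma euler_letter_series: "euler (letter_series S) = letter_series S"
  by (rule set_series_eqI) (auto simp: euler.rep_eq letter_series.rep_eq is_singleton_def)

lemma prod_list_mon_word: "prod_list (map (\<lambda>v. mon_word [v]) us) = mon_word us"
  by (induction us) (simp_all add: mon_word_Nil mon_mult)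

lemma block_lists_letters: "block_lists S (\<lambda>v. {v}) n C = {us. length us = n \<and> distinct us \<and> set us \<subseteq> S \<and> set us = C}"
proof -
  have "sorted_wrt (\<lambda>p q. {p} \<inter> {q} = {}) us \<longleftrightarrow> distinct us" for us :: "'a list"
    by (induction us) auto
  thus ?thesis by (auto simp: block_lists_def)
qed

text \<open>Only words that contain each letter of \<open>C\<close> exactly once survive, so for \<open>C \<subseteq> S\<close> this coefficient is the
  symmetrization of the product of the letters of \<open>C\<close>.\<close>

lemma coef_exp_letter_series:
  assumes C: "finite C"
  shows "coef (scal.exp_series (letter_series S)) C =
    (\<Sum>us | distinct us \<and> set us \<subseteq> S \<and> set us = C. scal (1 / fact (length us)) * mon_word us)"
proof -
  have N: "order_ge 1 (letter_series S)" by (simp only: order_ge_1 coef_letter_series_empty)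
  have fin: "finite {v \<in> S. {v} = C}" for C
    by (rule finite_subset[of _ "{the_elem C}"]) auto
  note pw = coef_power_expansion[of S "\<lambda>v. {v}" "letter_series S" "\<lambda>v. mon_word [v]", OF fin coef_letter_series C]
  let ?U = "{us. distinct us \<and> set us \<subseteq> S \<and> set us = C}"
  have len: "length us = card C" if "us \<in> ?U" for us using that distinct_card by fastforce
  let ?V = "\<lambda>n. {us. length us = n \<and> distinct us \<and> set us \<subseteq> S \<and> set us = C}"
  have "coef (scal.exp_series (letter_series S)) C =
      (\<Sum>n\<le>card C. scal (1 / fact n) * (\<Sum>us | length us = n \<and> distinct us \<and> set us \<subseteq> S \<and> set us = C. mon_word us))"
    by (simp add: scal.coef_subst[OF N order_refl] pw(2) block_lists_letters prod_list_mon_word)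
  also have "\<dots> = (\<Sum>n\<in>{card C}. scal (1 / fact n) * (\<Sum>us | length us = n \<and> distinct us \<and> set us \<subseteq> S \<and> set us = C. mon_word us))"
  proof (rule sum.mono_neutral_right)
    show "\<forall>n\<in>{..card C} - {card C}. scal (1 / fact n) *
        (\<Sum>us | length us = n \<and> distinct us \<and> set us \<subseteq> S \<and> set us = C. mon_word us) = 0"
    proof
      fix n assume "n \<in> {..card C} - {card C}"
      hence e: "{us. length us = n \<and> distinct us \<and> set us \<subseteq> S \<and> set us = C} = {}" using len by auto
      show "scal (1 / fact n) * (\<Sum>us | length us = n \<and> distinct us \<and> set us \<subseteq> S \<and> set us = C. mon_word us) = 0"
        unfolding e by simp
    qed
  qed auto
  also have "\<dots> = (\<Sum>us\<in>?U. scal (1 / fact (card C)) * mon_word us)"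
  proof -
    have "?V (card C) = ?U" using len by auto
    thus ?thesis by (simp add: sum_distrib_left)
  qed
  also have "\<dots> = (\<Sum>us\<in>?U. scal (1 / fact (length us)) * mon_word us)"
    by (rule sum.cong[OF refl]) (simp only: len)
  finally show ?thesis .
qed

definition flat :: "('g list \<times> 'g list) list \<Rightarrow> 'g list"
  where "flat qs = concat (map (\<lambda>(\<alpha>, \<beta>). \<alpha> @ \<beta>) qs)"

lemma flat_simps [simp]: "flat [] = []" "flat (q # qs) = fst q @ snd q @ flat qs"
  "flat (ps @ qs) = flat ps @ flat qs"
  by (simp_all add: flat_def case_prod_beta)

definition pair_coeff :: "('g list \<times> 'g list) list \<Rightarrow> 'k::field_char_0"
  where "pair_coeff qs = (\<Prod>q\<leftarrow>qs. fact (length (fst q)) * fact (length (snd q)))"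

text \<open>The letters of \<open>Xs\<close> and \<open>Ys\<close> are elements of \<open>g\<close> of degree one.\<close>

locale exp_product = lie_algebra_derivation scale bracket E
  for scale :: "'k::field_char_0 \<Rightarrow> 'g::ab_group_add \<Rightarrow> 'g" (infixr \<open>*s\<close> 75)
    and bracket :: "'g \<Rightarrow> 'g \<Rightarrow> 'g" and E +
  fixes Xs Ys :: "'g set"
  assumes finite_Xs: "finite Xs" and finite_Ys: "finite Ys" and disjoint_Xs_Ys: "Xs \<inter> Ys = {}"
    and E_letter: "v \<in> Xs \<union> Ys \<Longrightarrow> E v = v"
begin

text \<open>Its coefficient at \<open>Xs \<union> Ys\<close> is the product of the symmetrizations of \<open>\<Prod>Xs\<close> and \<open>\<Prod>Ys\<close>.\<close>

definition exp_exp :: "('g, ('g, 'k) free_alg) set_series"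
  where "exp_exp = scal.exp_series (letter_series Xs) * scal.exp_series (letter_series Ys)"

text \<open>The Baker-Campbell-Hausdorff series; for nonempty \<open>A \<subseteq> Xs\<close> and \<open>B \<subseteq> Ys\<close> its coefficient at \<open>A \<union> B\<close>
  represents \<open>w A B\<close> in the enveloping algebra.\<close>

definition bch :: "('g, ('g, 'k) free_alg) set_series"
  where "bch = scal.ln_series exp_exp"

text \<open>A pair \<open>(\<alpha>, \<beta>)\<close> labels the term of \<open>exp_exp\<close> belonging to the word \<open>\<alpha> @ \<beta>\<close>.\<close>

definition pairs :: "('g list \<times> 'g list) set"
  where "pairs = {(\<alpha>, \<beta>). distinct \<alpha> \<and> set \<alpha> \<subseteq> Xs \<and> distinct \<beta> \<and> set \<beta> \<subseteq> Ys}"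

abbreviation supp :: "'g list \<times> 'g list \<Rightarrow> 'g set"
  where "supp q \<equiv> set (fst q) \<union> set (snd q)"

definition weight :: "'g list \<times> 'g list \<Rightarrow> ('g, 'k) free_alg"
  where "weight q = scal (1 / (fact (length (fst q)) * fact (length (snd q)))) * mon_word (fst q @ snd q)"

lemma finite_distinct_set: "finite C \<Longrightarrow> finite {us. distinct us \<and> Q us \<and> set us = C}"
  by (rule finite_subset[OF _ finite_permutations_of_set[of C]]) (auto simp: permutations_of_set_def)

lemma finite_pairs: "finite C \<Longrightarrow> finite {q \<in> pairs. supp q = C}"
proof -
  assume C: "finite C"
  have "{q \<in> pairs. supp q = C} \<subseteq> {us. set us \<subseteq> C \<and> distinct us} \<times> {us. set us \<subseteq> C \<and> distinct us}"
    by (auto simp: pairs_def)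
  thus ?thesis
    by (rule finite_subset) (intro finite_cartesian_product finite_subset_distinct C)
qed

lemma coef_exp_exp:
  assumes C: "finite C"
  shows "coef exp_exp C = (\<Sum>q | q \<in> pairs \<and> supp q = C. weight q)"
proof -
  let ?U = "\<lambda>S T. {us. distinct us \<and> set us \<subseteq> S \<and> set us = T}"
  have fin: "finite (?U S T)" if "T \<in> Pow C" for S T
    using that C by (intro finite_distinct_set) (auto intro: finite_subset)
  let ?w = "\<lambda>us. scal (1 / fact (length us)) * mon_word us"
  have w: "?w \<alpha> * ?w \<beta> = weight (\<alpha>, \<beta>)" for \<alpha> \<beta> :: "'g list"
  proof -
    have "?w \<alpha> * ?w \<beta> = scal ((1 / fact (length \<alpha>)) * (1 / fact (length \<beta>))) * (mon_word \<alpha> * mon_word \<beta>)"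
      by (rule scal_mult_scal_mult)
    thus ?thesis by (simp add: weight_def mon_mult)
  qed
  have fT: "finite T" "finite (C - T)" if "T \<in> Pow C" for T using that C by (auto intro: finite_subset)
  have "coef exp_exp C = (\<Sum>T\<in>Pow C. (\<Sum>us\<in>?U Xs T. ?w us) * (\<Sum>us\<in>?U Ys (C - T). ?w us))"
    unfolding exp_exp_def coef_mult by (intro sum.cong refl) (simp add: coef_exp_letter_series fT)
  also have "\<dots> = (\<Sum>T\<in>Pow C. \<Sum>q\<in>?U Xs T \<times> ?U Ys (C - T). weight q)"
    by (intro sum.cong refl) (simp only: sum_product w sum.cartesian_product case_prod_eta)
  also have "\<dots> = (\<Sum>(T, q)\<in>(SIGMA T:Pow C. ?U Xs T \<times> ?U Ys (C - T)). weight q)"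
    using C fin by (subst sum.Sigma) auto
  also have "\<dots> = (\<Sum>q | q \<in> pairs \<and> supp q = C. weight q)"
    by (rule sum.reindex_bij_witness[of _ "\<lambda>q. (set (fst q), q)" "\<lambda>(T, q). q"])
      (use disjoint_Xs_Ys in \<open>auto simp: pairs_def disjoint_iff subset_eq\<close>)
  finally show ?thesis .
qed

text \<open>These lists index the multilinear terms of Dynkin's expansion \<open>\<Sum>\<^sub>r ((-1)\<^bsup>r-1\<^esup> / r) (e\<^sup>X e\<^sup>Y - 1)\<^sup>r\<close> of the
  logarithm in the letters of \<open>C\<close>.\<close>

definition pair_lists :: "'g set \<Rightarrow> ('g list \<times> 'g list) list set"
  where "pair_lists C = {qs. (\<forall>(\<alpha>, \<beta>)\<in>set qs. (\<alpha>, \<beta>) \<noteq> ([], []) \<and> set \<alpha> \<subseteq> Xs \<and> set \<beta> \<subseteq> Ys) \<and>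
    distinct (flat qs) \<and> set (flat qs) = C}"

lemma block_lists_pairs:
  "block_lists (pairs - {([], [])}) supp r C = {qs \<in> pair_lists C. length qs = r}"
proof -
  let ?I = "pairs - {([], [])}" and ?disj = "sorted_wrt (\<lambda>p q. supp p \<inter> supp q = {})"
  let ?ok = "\<lambda>(\<alpha>, \<beta>). (\<alpha>, \<beta>) \<noteq> ([], []) \<and> set \<alpha> \<subseteq> Xs \<and> set \<beta> \<subseteq> Ys"
  have s: "set (flat qs) = (\<Union>q\<in>set qs. supp q)" for qs :: "('g list \<times> 'g list) list"
    by (induction qs) auto
  have eq: "set qs \<subseteq> ?I \<and> ?disj qs \<longleftrightarrow> (\<forall>q\<in>set qs. ?ok q) \<and> distinct (flat qs)" for qs
  proof (induction qs)
    case (Cons q qs)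
    obtain \<alpha> \<beta> where q: "q = (\<alpha>, \<beta>)" by (cases q)
    have l: "set (q # qs) \<subseteq> ?I \<and> ?disj (q # qs) \<longleftrightarrow>
        q \<in> ?I \<and> (\<forall>p\<in>set qs. supp q \<inter> supp p = {}) \<and> set qs \<subseteq> ?I \<and> ?disj qs"
      by (auto simp only: list.set(2) insert_subset sorted_wrt.simps)
    have r: "distinct (flat (q # qs)) \<longleftrightarrow> distinct \<alpha> \<and> distinct \<beta> \<and> set \<alpha> \<inter> set \<beta> = {} \<and>
        (\<forall>p\<in>set qs. supp q \<inter> supp p = {}) \<and> distinct (flat qs)"
      by (auto simp: q s)
    have m: "q \<in> ?I \<longleftrightarrow> distinct \<alpha> \<and> distinct \<beta> \<and> ?ok q"
      by (auto simp: q pairs_def)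
    have d: "?ok q \<Longrightarrow> set \<alpha> \<inter> set \<beta> = {}" using disjoint_Xs_Ys by (auto simp: q)
    have a: "(\<forall>q\<in>set (q # qs). ?ok q) \<longleftrightarrow> ?ok q \<and> (\<forall>q\<in>set qs. ?ok q)" by simp
    show ?case using Cons.IH d unfolding l r m a by argo
  qed simp
  have "(length qs = r \<and> set qs \<subseteq> ?I \<and> ?disj qs \<and> D) =
      (((\<forall>q\<in>set qs. ?ok q) \<and> distinct (flat qs) \<and> D) \<and> length qs = r)" for qs D
    using eq[of qs] by argo
  thus ?thesis unfolding block_lists_def pair_lists_def s mem_Collect_eq by (intro Collect_cong)
qed

definition log_coeff :: "('g list \<times> 'g list) list \<Rightarrow> 'k"
  where "log_coeff qs = fps_nth (fps_ln 1) (length qs) / pair_coeff qs"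

lemma prod_weight: "prod_list (map weight qs) = scal (1 / pair_coeff qs) * mon_word (flat qs)"
proof (induction qs)
  case (Cons q qs)
  have "prod_list (map weight (q # qs)) =
      scal ((1 / (fact (length (fst q)) * fact (length (snd q)))) * (1 / pair_coeff qs)) *
      (mon_word (fst q @ snd q) * mon_word (flat qs))"
    unfolding list.map prod_list.Cons Cons weight_def by (rule scal_mult_scal_mult)
  thus ?case by (simp add: mon_mult pair_coeff_def)
qed (simp add: pair_coeff_def mon_word_Nil scal_1)

lemma length_le_flat: "(\<forall>(\<alpha>, \<beta>)\<in>set qs. (\<alpha>, \<beta>) \<noteq> ([], [])) \<Longrightarrow> length qs \<le> length (flat qs)"
proof (induction qs)
  case (Cons q qs)
  hence "length (fst q) + length (snd q) \<ge> 1" by (cases q) (auto simp: Suc_le_eq)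
  thus ?case using Cons by simp
qed simp

lemma
  assumes C: "finite C"
  shows finite_pair_lists: "finite (pair_lists C)"
    and coef_bch: "coef bch C = (\<Sum>qs\<in>pair_lists C. scal (log_coeff qs) * mon_word (flat qs))"
proof -
  let ?I = "pairs - {([], [])}"
  have P1: "coef (exp_exp - 1) C = (\<Sum>q | q \<in> ?I \<and> supp q = C. weight q)" if C: "finite C" for C
  proof (cases "C = {}")
    case True
    have e: "{q. q \<in> pairs \<and> supp q = C} = {([], [])}" "{q. q \<in> ?I \<and> supp q = C} = {}"
      using True by (auto simp: pairs_def)
    show ?thesis unfolding coef_simps coef_exp_exp[OF C] e using True by (simp add: weight_def scal_1 mon_word_Nil)
  next
    case False
    hence "{q. q \<in> pairs \<and> supp q = C} = {q. q \<in> ?I \<and> supp q = C}" by auto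
    thus ?thesis using False by (simp only: coef_simps coef_exp_exp[OF C]) simp
  qed
  have fin: "finite {q \<in> ?I. supp q = C}" if "finite C" for C
    by (rule finite_subset[OF _ finite_pairs[OF that]]) auto
  note pw = coef_power_expansion[of ?I supp "exp_exp - 1" weight, OF fin P1 C, unfolded block_lists_pairs]
  have len: "length qs \<le> card C" if "qs \<in> pair_lists C" for qs
    using that length_le_flat[of qs] distinct_card[of "flat qs"] by (auto simp: pair_lists_def)
  have S: "(SIGMA n:{..card C}. {qs \<in> pair_lists C. length qs = n}) = (\<lambda>qs. (length qs, qs)) ` pair_lists C"
    using len by auto
  have inj: "inj_on (\<lambda>qs. (length qs, qs)) (pair_lists C)" by (simp add: inj_on_def)
  have "finite (SIGMA n:{..card C}. {qs \<in> pair_lists C. length qs = n})" using pw(1) by (intro finite_SigmaI) auto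
  thus "finite (pair_lists C)" unfolding S using inj by (rule finite_imageD)
  have N: "order_ge 1 (exp_exp - 1)" unfolding order_ge_1 by (subst P1) (auto simp: pairs_def intro: sum.neutral)
  have "coef bch C = (\<Sum>n\<le>card C. \<Sum>qs\<in>{qs \<in> pair_lists C. length qs = n}. scal (fps_nth (fps_ln 1) n) * prod_list (map weight qs))"
    unfolding bch_def by (simp add: scal.coef_subst[OF N order_refl] pw(2) sum_distrib_left)
  also have "\<dots> = (\<Sum>(n, qs)\<in>(SIGMA n:{..card C}. {qs \<in> pair_lists C. length qs = n}). scal (fps_nth (fps_ln 1) n) * prod_list (map weight qs))"
    using pw(1) by (subst sum.Sigma) auto
  also have "\<dots> = (\<Sum>qs\<in>pair_lists C. scal (log_coeff qs) * mon_word (flat qs))"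
    unfolding S sum.reindex[OF inj]
    by (simp add: prod_weight log_coeff_def const_mult_const flip: mult.assoc)
  finally show "coef bch C = (\<Sum>qs\<in>pair_lists C. scal (log_coeff qs) * mon_word (flat qs))" .
qed

end

section \<open>Dynkin's formula for the coefficients of the logarithm\<close>

context exp_product begin

lemma pair_lists_iff:
  assumes "A \<subseteq> Xs" "B \<subseteq> Ys"
  shows "qs \<in> pair_lists (A \<union> B) \<longleftrightarrow> (\<forall>q\<in>set qs. q \<noteq> ([], [])) \<and>
    distinct (concat (map fst qs)) \<and> distinct (concat (map snd qs)) \<and>
    set (concat (map fst qs)) = A \<and> set (concat (map snd qs)) = B" (is "?L \<longleftrightarrow> ?R")
proof -
  let ?a = "concat (map fst qs)" and ?b = "concat (map snd qs)"
  have m: "mset (flat qs) = mset (?a @ ?b)" by (induction qs) auto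
  have d: "distinct (flat qs) \<longleftrightarrow> distinct ?a \<and> distinct ?b \<and> set ?a \<inter> set ?b = {}"
    using mset_eq_imp_distinct_iff[OF m] by (simp only: distinct_append)
  have s: "set (flat qs) = set ?a \<union> set ?b"
    using mset_eq_setD[OF m] by (simp only: set_append)
  have b: "(\<forall>(\<alpha>, \<beta>)\<in>set qs. (\<alpha>, \<beta>) \<noteq> ([], []) \<and> set \<alpha> \<subseteq> Xs \<and> set \<beta> \<subseteq> Ys) \<longleftrightarrow>
      (\<forall>q\<in>set qs. q \<noteq> ([], [])) \<and> set ?a \<subseteq> Xs \<and> set ?b \<subseteq> Ys"
    by fastforce
  have 1: "set ?a = A \<and> set ?b = B" if "set ?a \<subseteq> Xs" "set ?b \<subseteq> Ys" "set ?a \<union> set ?b = A \<union> B"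
    using that assms disjoint_Xs_Ys by blast
  have 2: "A \<inter> B = {}" using assms disjoint_Xs_Ys by blast
  show ?thesis
    unfolding pair_lists_def mem_Collect_eq b d s
  proof (intro iffI; elim conjE; intro conjI)
  qed (use 1 2 assms in simp_all)
qed

definition swap_last :: "'a list \<Rightarrow> 'a list"
  where "swap_last us = butlast (butlast us) @ [last us, last (butlast us)]"

lemma swap_last_append2: "swap_last (us @ [a, b]) = us @ [b, a]"
  by (simp add: swap_last_def butlast_append)

lemma split_last2: "length us \<ge> 2 \<Longrightarrow> \<exists>vs a b. us = vs @ [a, b]"
  by (cases us rule: rev_cases; simp; rule rev_exhaust[of "butlast us"]) auto

lemma swap_last_append: "length vs \<ge> 2 \<Longrightarrow> swap_last (us @ vs) = us @ swap_last vs"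
  using split_last2[of vs] swap_last_append2[of "us @ _"] by (auto simp: swap_last_append2)

lemma swap_last_facts:
  assumes "length us \<ge> 2"
  shows "swap_last (swap_last us) = us" "length (swap_last us) = length us" "mset (swap_last us) = mset us"
  using split_last2[OF assms] by (auto simp: swap_last_append2)

text \<open>Antisymmetry of the innermost bracket.\<close>

lemma nested_swap_last:
  assumes "length us \<ge> 2" "set us \<subseteq> Xs \<union> Ys"
  shows "nested (swap_last us) = - nested us"
proof -
  obtain vs a b where us: "us = vs @ [a, b]" using split_last2[OF assms(1)] by blast
  have "E a = a" "E b = b" using assms(2) us E_letter by auto
  hence "nested us = foldr bracket vs (bracket a b)" "nested (swap_last us) = foldr bracket vs (bracket b a)"
    unfolding us swap_last_append2 by (simp_all add: nested_append) (simp_all add: nested_def)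
  moreover have "foldr bracket vs (- g) = - foldr bracket vs g" for g
    using foldr_bracket_add[of vs g "- g"] foldr_bracket_add[of vs 0 0] by (simp add: eq_neg_iff_add_eq_0 add.commute)
  ultimately show ?thesis using bracket_anti[of b a] by simp
qed

definition log_term :: "('g list \<times> 'g list) list \<Rightarrow> 'g"
  where "log_term qs = log_coeff qs *s nested (flat qs)"

definition swap_pair :: "'g list \<times> 'g list \<Rightarrow> 'g list \<times> 'g list"
  where "swap_pair q = (if snd q = [] then (swap_last (fst q), []) else (fst q, swap_last (snd q)))"

text \<open>The last two letters of the word of a pair list belong to the same multi-index of its last pair, so that
  exchanging them gives another pair list with the same coefficient.\<close>

definition swappable :: "'g list \<times> 'g list \<Rightarrow> bool"
  where "swappable q \<longleftrightarrow> (if snd q = [] then length (fst q) \<ge> 2 else length (snd q) \<ge> 2)"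

lemma swap_pair_facts:
  assumes "swappable q"
  shows "swap_pair (swap_pair q) = q \<and> swappable (swap_pair q) \<and>
    length (fst (swap_pair q)) = length (fst q) \<and> length (snd (swap_pair q)) = length (snd q) \<and>
    mset (fst (swap_pair q)) = mset (fst q) \<and> mset (snd (swap_pair q)) = mset (snd q) \<and>
    fst (swap_pair q) @ snd (swap_pair q) = swap_last (fst q @ snd q) \<and> length (fst q @ snd q) \<ge> 2"
proof -
  obtain \<alpha> \<beta> where q: "q = (\<alpha>, \<beta>)" by (cases q)
  show ?thesis
  proof (cases "\<beta> = []")
    case True
    hence "length \<alpha> \<ge> 2" using assms by (simp add: q swappable_def)
    thus ?thesis using True by (simp add: q swap_pair_def swappable_def swap_last_facts)
  next
    case False
    hence l: "length \<beta> \<ge> 2" using assms by (simp add: q swappable_def)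
    moreover have "swap_last \<beta> \<noteq> []" by (simp add: swap_last_def)
    ultimately show ?thesis using False by (simp add: q swap_pair_def swappable_def swap_last_facts swap_last_append)
  qed
qed

text \<open>Exchanging the last two letters is an involution that changes the sign of each term. This is why in
  Dynkin's formula the last nonempty multi-index has a single entry.\<close>

lemma sum_swappable:
  assumes C: "finite C"
  shows "(\<Sum>qs | qs \<in> pair_lists C \<and> qs \<noteq> [] \<and> swappable (last qs). log_term qs) = 0" (is "?S = 0")
proof -
  let ?K = "{qs. qs \<in> pair_lists C \<and> qs \<noteq> [] \<and> swappable (last qs)}"
  let ?t = "\<lambda>qs. butlast qs @ [swap_pair (last qs)]"
  have t: "?t qs \<in> ?K \<and> ?t (?t qs) = qs \<and> log_term (?t qs) = - log_term qs" if qsK: "qs \<in> ?K" for qs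
  proof -
    obtain rs q where qs: "qs = rs @ [q]" using qsK by (cases qs rule: rev_cases) auto
    have q: "swappable q" using qsK qs by simp
    have f: "swap_pair (swap_pair q) = q" "swappable (swap_pair q)"
      "length (fst (swap_pair q)) = length (fst q)" "length (snd (swap_pair q)) = length (snd q)"
      "mset (fst (swap_pair q)) = mset (fst q)" "mset (snd (swap_pair q)) = mset (snd q)"
      "fst (swap_pair q) @ snd (swap_pair q) = swap_last (fst q @ snd q)" "length (fst q @ snd q) \<ge> 2"
      using swap_pair_facts[OF q] by blast+
    have st: "set (fst (swap_pair q)) = set (fst q)" "set (snd (swap_pair q)) = set (snd q)"
      using mset_eq_setD[OF f(5)] mset_eq_setD[OF f(6)] .
    have ne: "fst (swap_pair q) = [] \<longrightarrow> snd (swap_pair q) \<noteq> []" using f(3,4,8) by auto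
    have mf: "mset (flat (?t qs)) = mset (flat qs)" using f(5,6) by (simp add: qs)
    have fl: "flat (?t qs) = swap_last (flat qs)"
      using f(7,8) by (simp add: qs swap_last_append)
    have d: "distinct (flat (?t qs)) = distinct (flat qs)" using mf mset_eq_imp_distinct_iff by blast
    have s: "set (flat (?t qs)) = set (flat qs)" using mf mset_eq_setD by blast
    have K: "?t qs \<in> ?K"
      using qsK f(2) unfolding pair_lists_def mem_Collect_eq d s by (simp add: qs case_prod_beta st ne)
    have "set (flat qs) \<subseteq> Xs \<union> Ys"
      using qsK unfolding pair_lists_def flat_def by fastforce
    hence "nested (flat (?t qs)) = - nested (flat qs)"
      unfolding fl using f(8) by (intro nested_swap_last) (simp_all add: qs)
    moreover have "log_coeff (?t qs) = log_coeff qs"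
      using f(3,4) by (simp add: log_coeff_def pair_coeff_def qs)
    ultimately have "log_term (?t qs) = - log_term qs" by (simp add: log_term_def)
    thus ?thesis using K f(1) by (simp add: qs)
  qed
  have "?S = (\<Sum>qs\<in>?K. - log_term qs)"
    by (rule sum.reindex_bij_witness[of _ ?t ?t]) (use t in auto)
  hence "?S = - ?S" by (simp only: sum_negf)
  hence "?S + ?S = 0" by (rule iffD1[OF eq_neg_iff_add_eq_0])
  hence "(2::'k) *s ?S = 0" using scale_left_distrib[of 1 1 ?S] by simp
  thus ?thesis by simp
qed

lemma ad_alternating_eq: "ad_alternating (map fst rs) (map snd rs) v = foldr bracket (flat rs) v"
  by (induction rs) (simp_all add: ad_alternating_def ad_list_def case_prod_beta)

lemma log_coeff_Suc:
  assumes "length qs = Suc n"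
  shows "log_coeff qs = ((- 1) ^ (Suc n + 1) / of_nat (Suc n)) /
    ((\<Prod>\<alpha>\<leftarrow>map fst qs. fact (length \<alpha>)) * (\<Prod>\<beta>\<leftarrow>map snd qs. fact (length \<beta>)))"
proof -
  have "pair_coeff qs = (\<Prod>\<alpha>\<leftarrow>map fst qs. fact (length \<alpha>)) * (\<Prod>\<beta>\<leftarrow>map snd qs. fact (length \<beta>) :: 'k)"
    unfolding pair_coeff_def by (induction qs) (simp_all add: mult_ac)
  thus ?thesis by (simp add: log_coeff_def assms fps_ln_nth)
qed

lemma nested_snoc: "v \<in> Xs \<union> Ys \<Longrightarrow> nested (us @ [v]) = foldr bracket us v"
  by (simp add: nested_def E_letter)

lemma finite_sub: "A \<subseteq> Xs \<Longrightarrow> finite A" "B \<subseteq> Ys \<Longrightarrow> finite B"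
  using finite_Xs finite_Ys by (auto intro: finite_subset)

text \<open>The way in which the index sets of \<open>w1\<close> and \<open>w2\<close> say that some multi-indices together enumerate a set
  without repetition: they have the right total length and cover the set.\<close>

lemma enumeration_concat:
  assumes "finite A"
  shows "distinct (concat L) \<and> set (concat L) = A \<longleftrightarrow>
    (\<forall>us\<in>set L. distinct us \<and> set us \<subseteq> A) \<and> (\<Sum>us\<leftarrow>L. length us) = card A \<and> (\<Union>us\<in>set L. set us) = A"
proof (intro iffI; elim conjE)
  assume d: "distinct (concat L)" and s: "set (concat L) = A"
  have "(\<Sum>us\<leftarrow>L. length us) = card A" using distinct_card[OF d] s by (simp only: length_concat)
  moreover have "\<forall>us\<in>set L. distinct us \<and> set us \<subseteq> A" using d s by (auto simp: distinct_concat_iff)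
  ultimately show "(\<forall>us\<in>set L. distinct us \<and> set us \<subseteq> A) \<and> (\<Sum>us\<leftarrow>L. length us) = card A \<and> (\<Union>us\<in>set L. set us) = A"
    using s by (simp only: set_concat simp_thms)
next
  assume c: "(\<Sum>us\<leftarrow>L. length us) = card A" and s: "(\<Union>us\<in>set L. set us) = A"
  have s': "set (concat L) = A" using s by (simp only: set_concat)
  have "card (set (concat L)) = length (concat L)" using c by (simp only: s' length_concat)
  thus "distinct (concat L) \<and> set (concat L) = A" using s' card_distinct by blast
qed

text \<open>The same with an additional last entry \<open>l\<close>, the letter to which the brackets are applied.\<close>

lemma enumeration_concat_snoc:
  assumes A: "finite A"
  shows "distinct (concat L @ [l]) \<and> set (concat L @ [l]) = A \<longleftrightarrow> l \<in> A \<and>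
    (\<forall>us\<in>set L. distinct us \<and> set us \<subseteq> A) \<and> (\<Sum>us\<leftarrow>L. length us) = card A - 1 \<and> {l} \<union> (\<Union>us\<in>set L. set us) = A"
proof -
  have "l \<in> A \<Longrightarrow> card A \<ge> 1" using A by (auto simp: Suc_le_eq card_gt_0_iff)
  hence "l \<in> A \<Longrightarrow> (\<Sum>us\<leftarrow>L. length us) + 1 = card A \<longleftrightarrow> (\<Sum>us\<leftarrow>L. length us) = card A - 1" by linarith
  thus ?thesis using enumeration_concat[OF A, of "L @ [[l]]"] by auto
qed

lemma zip_nonempty_iff:
  assumes "length as = length bs"
  shows "(\<forall>q\<in>set (zip as bs). q \<noteq> ([], [])) \<longleftrightarrow> (\<forall>i<length as. length (as ! i) + length (bs ! i) \<ge> 1)"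
proof -
  have "(a, b) \<noteq> ([], []) \<longleftrightarrow> length a + length b \<ge> 1" for a :: "'a list" and b :: "'b list"
    by (cases a; cases b) auto
  thus ?thesis using assms by (simp add: all_set_conv_all_nth)
qed

lemma w1_indices_iff:
  assumes A: "A \<subseteq> Xs" and B: "B \<subseteq> Ys"
  shows "(r, \<alpha>s, \<beta>s, l) \<in> w1_indices A B \<longleftrightarrow>
    (\<exists>rs \<alpha>. r = Suc (length rs) \<and> \<alpha>s = map fst rs @ [\<alpha>] \<and> \<beta>s = map snd rs \<and> rs @ [(\<alpha>, [l])] \<in> pair_lists (A \<union> B))"
    (is "_ \<longleftrightarrow> ?R")
proof (cases "r \<ge> 1 \<and> length \<alpha>s = r \<and> length \<beta>s = r - 1")
  case True
  then obtain as \<alpha> where as: "\<alpha>s = as @ [\<alpha>]" by (cases \<alpha>s rule: rev_cases) auto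
  have len: "length as = length \<beta>s" "r = Suc (length as)" using True as by auto
  define rs where "rs = zip as \<beta>s"
  have rs: "map fst rs = as" "map snd rs = \<beta>s" "length rs = length as" using len by (simp_all add: rs_def)
  have ne: "(\<forall>i<r - 1. length (\<alpha>s ! i) + length (\<beta>s ! i) \<ge> 1) \<longleftrightarrow> (\<forall>q\<in>set rs. q \<noteq> ([], []))"
    using zip_nonempty_iff[OF len(1)] len by (simp add: rs_def as nth_append)
  have "(r, \<alpha>s, \<beta>s, l) \<in> w1_indices A B \<longleftrightarrow> (\<forall>q\<in>set rs. q \<noteq> ([], [])) \<and>
      (distinct (concat \<alpha>s) \<and> set (concat \<alpha>s) = A) \<and> (distinct (concat \<beta>s @ [l]) \<and> set (concat \<beta>s @ [l]) = B)"
    unfolding enumeration_concat[OF finite_sub(1)[OF A]] enumeration_concat_snoc[OF finite_sub(2)[OF B]]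
    using True ne by (auto simp: w1_indices_def)
  also have "\<dots> \<longleftrightarrow> rs @ [(\<alpha>, [l])] \<in> pair_lists (A \<union> B)"
    unfolding pair_lists_iff[OF A B] by (auto simp: rs as)
  also have "\<dots> \<longleftrightarrow> ?R"
  proof
    assume "rs @ [(\<alpha>, [l])] \<in> pair_lists (A \<union> B)"
    thus ?R using rs len as by (intro exI[of _ rs] exI[of _ \<alpha>]) simp
  next
    assume ?R
    then obtain rs' \<alpha>' where r': "\<alpha>s = map fst rs' @ [\<alpha>']" "\<beta>s = map snd rs'" "rs' @ [(\<alpha>', [l])] \<in> pair_lists (A \<union> B)"
      by blast
    have "rs' = rs" using r'(1,2) by (simp add: rs_def as zip_map_fst_snd)
    thus "rs @ [(\<alpha>, [l])] \<in> pair_lists (A \<union> B)" using r' as by simp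
  qed
  finally show ?thesis .
next
  case False
  hence "(r, \<alpha>s, \<beta>s, l) \<notin> w1_indices A B" by (auto simp: w1_indices_def)
  moreover have "\<not> ?R" using False by auto
  ultimately show ?thesis by blast
qed

lemma w2_indices_iff:
  assumes A: "A \<subseteq> Xs" and B: "B \<subseteq> Ys"
  shows "(r, \<alpha>s, \<beta>s, l) \<in> w2_indices A B \<longleftrightarrow>
    (\<exists>rs. r = Suc (length rs) \<and> \<alpha>s = map fst rs \<and> \<beta>s = map snd rs \<and> rs @ [([l], [])] \<in> pair_lists (A \<union> B))"
    (is "_ \<longleftrightarrow> ?R")
proof (cases "r \<ge> 1 \<and> length \<alpha>s = r - 1 \<and> length \<beta>s = r - 1")
  case True
  hence len: "length \<alpha>s = length \<beta>s" "r = Suc (length \<alpha>s)" by auto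
  define rs where "rs = zip \<alpha>s \<beta>s"
  have rs: "map fst rs = \<alpha>s" "map snd rs = \<beta>s" "length rs = length \<alpha>s" using len by (simp_all add: rs_def)
  have ne: "(\<forall>i<r - 1. length (\<alpha>s ! i) + length (\<beta>s ! i) \<ge> 1) \<longleftrightarrow> (\<forall>q\<in>set rs. q \<noteq> ([], []))"
    using zip_nonempty_iff[OF len(1)] len by (simp add: rs_def)
  have "(r, \<alpha>s, \<beta>s, l) \<in> w2_indices A B \<longleftrightarrow> (\<forall>q\<in>set rs. q \<noteq> ([], [])) \<and>
      (distinct (concat \<alpha>s @ [l]) \<and> set (concat \<alpha>s @ [l]) = A) \<and> (distinct (concat \<beta>s) \<and> set (concat \<beta>s) = B)"
    unfolding enumeration_concat[OF finite_sub(2)[OF B]] enumeration_concat_snoc[OF finite_sub(1)[OF A]]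
    using True ne by (auto simp: w2_indices_def)
  also have "\<dots> \<longleftrightarrow> rs @ [([l], [])] \<in> pair_lists (A \<union> B)"
    unfolding pair_lists_iff[OF A B] by (auto simp: rs)
  also have "\<dots> \<longleftrightarrow> ?R"
  proof
    assume "rs @ [([l], [])] \<in> pair_lists (A \<union> B)"
    thus ?R using rs len by (intro exI[of _ rs]) simp
  next
    assume ?R
    then obtain rs' where r': "\<alpha>s = map fst rs'" "\<beta>s = map snd rs'" "rs' @ [([l], [])] \<in> pair_lists (A \<union> B)"
      by blast
    have "rs' = rs" using r'(1,2) by (simp add: rs_def zip_map_fst_snd)
    thus "rs @ [([l], [])] \<in> pair_lists (A \<union> B)" using r' by simp
  qed
  finally show ?thesis .
next
  case False
  hence "(r, \<alpha>s, \<beta>s, l) \<notin> w2_indices A B" by (auto simp: w2_indices_def)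
  moreover have "\<not> ?R" using False by auto
  ultimately show ?thesis by blast
qed

text \<open>The terms of \<open>w1\<close> are those of Dynkin's expansion whose last pair is \<open>(\<alpha>\<^sub>r, [l])\<close>.\<close>

lemma w1_eq:
  assumes A: "A \<subseteq> Xs" and B: "B \<subseteq> Ys"
  shows "w1 A B = (\<Sum>qs | qs \<in> pair_lists (A \<union> B) \<and> qs \<noteq> [] \<and> length (snd (last qs)) = 1. log_term qs)"
proof -
  let ?K = "{qs. qs \<in> pair_lists (A \<union> B) \<and> qs \<noteq> [] \<and> length (snd (last qs)) = 1}"
  let ?i = "\<lambda>qs. (length qs, map fst qs, map snd (butlast qs), hd (snd (last qs)))"
  let ?j = "\<lambda>(r :: nat, \<alpha>s, \<beta>s, l). zip \<alpha>s (\<beta>s @ [[l]])"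
  let ?F = "\<lambda>(r, \<alpha>s, \<beta>s, l). w_coeff r \<alpha>s \<beta>s *s ad_alternating (butlast \<alpha>s) \<beta>s (ad_list (last \<alpha>s) l)"
  have 1: "?i (?j a) = a \<and> ?j a \<in> ?K \<and> log_term (?j a) = ?F a" if a: "a \<in> w1_indices A B" for a
  proof -
    obtain r \<alpha>s \<beta>s l where a': "a = (r, \<alpha>s, \<beta>s, l)" by (cases a)
    then obtain rs \<alpha> where r: "r = Suc (length rs)" "\<alpha>s = map fst rs @ [\<alpha>]" "\<beta>s = map snd rs"
      and m: "rs @ [(\<alpha>, [l])] \<in> pair_lists (A \<union> B)" using a w1_indices_iff[OF A B] by blast
    have j: "?j a = rs @ [(\<alpha>, [l])]" by (simp add: a' r zip_map_fst_snd)
    have "l \<in> Xs \<union> Ys" using m B by (simp add: pair_lists_iff[OF A B]) blast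
    hence "nested (flat (rs @ [(\<alpha>, [l])])) = foldr bracket (flat rs) (foldr bracket \<alpha> l)"
      using nested_snoc[of l "flat rs @ \<alpha>"] by simp
    hence "log_term (rs @ [(\<alpha>, [l])]) = ?F a"
      by (simp add: a' r log_term_def ad_alternating_eq ad_list_def w_coeff_def log_coeff_Suc[of _ "length rs"])
    thus ?thesis unfolding j using m by (simp add: a' r)
  qed
  have 2: "?j (?i qs) = qs \<and> ?i qs \<in> w1_indices A B" if qs: "qs \<in> ?K" for qs
  proof -
    obtain rs q where "qs = rs @ [q]" using qs by (cases qs rule: rev_cases) auto
    moreover obtain \<alpha> l where "q = (\<alpha>, [l])" using qs calculation by (cases q) (auto simp: length_Suc_conv)
    ultimately have q: "qs = rs @ [(\<alpha>, [l])]" by simp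
    have "?i qs \<in> w1_indices A B"
      unfolding w1_indices_iff[OF A B] using qs by (intro exI[of _ rs] exI[of _ \<alpha>]) (simp add: q)
    thus ?thesis by (simp add: q zip_map_fst_snd)
  qed
  show ?thesis unfolding w1_def by (rule sum.reindex_bij_witness[of _ ?i ?j]) (use 1 2 in blast)+
qed

text \<open>The terms of \<open>w2\<close> are those of Dynkin's expansion whose last pair is \<open>([l], [])\<close>.\<close>

lemma w2_eq:
  assumes A: "A \<subseteq> Xs" and B: "B \<subseteq> Ys"
  shows "w2 A B = (\<Sum>qs | qs \<in> pair_lists (A \<union> B) \<and> qs \<noteq> [] \<and> snd (last qs) = [] \<and> length (fst (last qs)) = 1. log_term qs)"
proof -
  let ?K = "{qs. qs \<in> pair_lists (A \<union> B) \<and> qs \<noteq> [] \<and> snd (last qs) = [] \<and> length (fst (last qs)) = 1}"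
  let ?i = "\<lambda>qs. (length qs, map fst (butlast qs), map snd (butlast qs), hd (fst (last qs)))"
  let ?j = "\<lambda>(r :: nat, \<alpha>s, \<beta>s, l). zip \<alpha>s \<beta>s @ [([l], [])]"
  let ?F = "\<lambda>(r, \<alpha>s, \<beta>s, l). w_coeff r \<alpha>s \<beta>s *s ad_alternating \<alpha>s \<beta>s l"
  have 1: "?i (?j a) = a \<and> ?j a \<in> ?K \<and> log_term (?j a) = ?F a" if a: "a \<in> w2_indices A B" for a
  proof -
    obtain r \<alpha>s \<beta>s l where a': "a = (r, \<alpha>s, \<beta>s, l)" by (cases a)
    then obtain rs where r: "r = Suc (length rs)" "\<alpha>s = map fst rs" "\<beta>s = map snd rs"
      and m: "rs @ [([l], [])] \<in> pair_lists (A \<union> B)" using a w2_indices_iff[OF A B] by blast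
    have j: "?j a = rs @ [([l], [])]" by (simp add: a' r zip_map_fst_snd)
    have "l \<in> Xs \<union> Ys" using m A by (simp add: pair_lists_iff[OF A B]) blast
    hence "nested (flat (rs @ [([l], [])])) = foldr bracket (flat rs) l"
      using nested_snoc[of l "flat rs"] by simp
    hence "log_term (rs @ [([l], [])]) = ?F a"
      by (simp add: a' r log_term_def ad_alternating_eq w_coeff_def log_coeff_Suc[of _ "length rs"])
    thus ?thesis unfolding j using m by (simp add: a' r)
  qed
  have 2: "?j (?i qs) = qs \<and> ?i qs \<in> w2_indices A B" if qs: "qs \<in> ?K" for qs
  proof -
    obtain rs q where "qs = rs @ [q]" using qs by (cases qs rule: rev_cases) auto
    moreover obtain l where "q = ([l], [])" using qs calculation by (cases q) (auto simp: length_Suc_conv)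
    ultimately have q: "qs = rs @ [([l], [])]" by simp
    have "?i qs \<in> w2_indices A B"
      unfolding w2_indices_iff[OF A B] using qs by (intro exI[of _ rs]) (simp add: q)
    thus ?thesis by (simp add: q zip_map_fst_snd)
  qed
  show ?thesis unfolding w2_def by (rule sum.reindex_bij_witness[of _ ?i ?j]) (use 1 2 in blast)+
qed

lemma sum_log_term:
  assumes A: "A \<subseteq> Xs" and B: "B \<subseteq> Ys" and ne: "A \<noteq> {}"
  shows "(\<Sum>qs\<in>pair_lists (A \<union> B). log_term qs) = w1 A B + w2 A B"
proof -
  let ?C = "A \<union> B"
  let ?K1 = "{qs. qs \<in> pair_lists ?C \<and> qs \<noteq> [] \<and> length (snd (last qs)) = 1}"
  let ?K2 = "{qs. qs \<in> pair_lists ?C \<and> qs \<noteq> [] \<and> snd (last qs) = [] \<and> length (fst (last qs)) = 1}"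
  let ?K3 = "{qs. qs \<in> pair_lists ?C \<and> qs \<noteq> [] \<and> swappable (last qs)}"
  have C: "finite ?C" using finite_sub A B by simp
  have fin: "finite ?K1" "finite ?K2" "finite ?K3"
    by (rule finite_subset[OF _ finite_pair_lists[OF C]], blast)+
  have un: "pair_lists ?C = ?K1 \<union> ?K2 \<union> ?K3"
  proof (intro equalityI subsetI)
    fix qs assume qs: "qs \<in> pair_lists ?C"
    hence "qs \<noteq> []" using ne by (auto simp: pair_lists_def)
    moreover from this have "last qs \<noteq> ([], [])"
      using qs last_in_set[of qs] unfolding pair_lists_iff[OF A B] by blast
    moreover have "length (snd q) = 1 \<or> snd q = [] \<and> length (fst q) = 1 \<or> swappable q" if "q \<noteq> ([], [])" for q :: "'g list \<times> 'g list"
    proof -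
      obtain \<alpha> \<beta> where q: "q = (\<alpha>, \<beta>)" by (cases q)
      have "length \<alpha> \<noteq> 0 \<or> length \<beta> \<noteq> 0" using that q by auto
      hence "length \<beta> = 1 \<or> length \<beta> = 0 \<and> length \<alpha> = 1 \<or> length \<beta> \<ge> 2 \<or> length \<beta> = 0 \<and> length \<alpha> \<ge> 2" by linarith
      thus ?thesis by (auto simp: q swappable_def)
    qed
    ultimately show "qs \<in> ?K1 \<union> ?K2 \<union> ?K3" using qs by blast
  qed auto
  have dis: "?K1 \<inter> ?K2 = {}" "(?K1 \<union> ?K2) \<inter> ?K3 = {}"
    by (auto simp: swappable_def split: if_splits)
  have "sum log_term (pair_lists ?C) = sum log_term ?K1 + sum log_term ?K2 + sum log_term ?K3"
    using sum.union_disjoint[OF finite_UnI[OF fin(1,2)] fin(3) dis(2), of log_term]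
      sum.union_disjoint[OF fin(1,2) dis(1), of log_term]
    by (simp only: un[symmetric])
  thus ?thesis using w1_eq[OF A B] w2_eq[OF A B] sum_swappable[OF C] by simp
qed

lemma mon_sum_env: "(\<Sum>i\<in>I. scal (c i) * mon_word [v i]) - mon_word [\<Sum>i\<in>I. c i *s v i] \<in> env_ideal"
proof (induction I rule: infinite_finite_induct)
  case (insert i I)
  let ?s = "\<Sum>i\<in>I. c i *s v i"
  have "((\<Sum>i\<in>I. scal (c i) * mon_word [v i]) - mon_word [?s]) - (mon_word [c i *s v i] - scal (c i) * mon_word [v i])
     - (mon_word [c i *s v i + ?s] - mon_word [c i *s v i] - mon_word [?s]) \<in> env_ideal"
    by (intro envI(3) insert.IH env_linear)
  thus ?case by (simp add: insert.hyps algebra_simps)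
qed (use envI(6)[OF env_linear(3)] in simp_all)

lemma lie_below_letters: "S \<subseteq> Xs \<union> Ys \<Longrightarrow> lie_below n (letter_series S)"
proof -
  assume S: "S \<subseteq> Xs \<union> Ys"
  have "lie_degree (card C) (coef (letter_series S) C)" for C
  proof (cases "\<exists>v\<in>S. C = {v}")
    case True
    then obtain v where "v \<in> S" "C = {v}" by blast
    moreover from this have "E v = v" using S E_letter by blast
    ultimately show ?thesis
      unfolding lie_degree_def by (intro exI[of _ v]) (simp add: letter_series.rep_eq is_singleton_def envI)
  next
    case False
    hence "coef (letter_series S) C = (0 :: ('g, 'k) free_alg)" by (auto simp: letter_series.rep_eq is_singleton_def)
    thus ?thesis by (simp add: lie_degree_0)
  qed
  thus "lie_below n (letter_series S)" by (simp add: lie_below_def)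
qed

lemma exp_exp_empty: "coef exp_exp {} = 1"
  by (simp add: exp_exp_def scal.coef_subst_empty scal_1)

lemma exp_bch: "scal.exp_series bch = exp_exp"
  unfolding bch_def by (rule scal.exp_ln_series[OF exp_exp_empty])

lemma bch_empty: "coef bch {} = 0"
  by (simp add: bch_def scal.coef_subst_empty scal_0 fps_ln_nth)

lemma lie_degree_bch: "lie_degree (card C) (coef bch C)"
proof -
  have o: "order_ge 1 (letter_series S :: ('g, ('g, 'k) free_alg) set_series)" for S
    by (simp only: order_ge_1 coef_letter_series_empty)
  have l: "lie_below n (letter_series Xs)" "lie_below n (letter_series Ys)" for n
    by (rule lie_below_letters, rule Un_upper1, rule lie_below_letters, rule Un_upper2)
  have "order_ge 1 bch" by (simp only: order_ge_1 bch_empty)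
  hence "lie_below (Suc (card C)) bch"
    using exp_bch[unfolded exp_exp_def]
    by (rule log_exp_exp_is_lie[OF o euler_letter_series l(1) o euler_letter_series l(2)])
  thus ?thesis by (simp add: lie_below_def)
qed

text \<open>By \<open>lie_degree_dynkin\<close> the Dynkin map multiplies the Lie element on the left by \<open>card A + card B\<close>, whereas
  applied to Dynkin's expansion term by term it gives \<open>w1 A B + w2 A B\<close>.\<close>

lemma coef_bch_w:
  assumes A: "A \<subseteq> Xs" "A \<noteq> {}" and B: "B \<subseteq> Ys" "B \<noteq> {}"
  shows "coef bch (A \<union> B) - mon_word [w A B] \<in> env_ideal"
proof -
  let ?C = "A \<union> B" and ?n = "card A + card B"
  have fin: "finite A" "finite B" using finite_sub A B by auto
  have C: "finite ?C" using fin by simp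
  have "A \<inter> B = {}" using A B disjoint_Xs_Ys by blast
  hence n: "card ?C = ?n" using fin by (simp add: card_Un_disjoint)
  have n0: "(of_nat ?n :: 'k) \<noteq> 0" using fin A by (simp only: of_nat_eq_0_iff) simp
  have nonempty: "flat qs \<noteq> []" if "qs \<in> pair_lists ?C" for qs
    using that A(2) by (auto simp: pair_lists_def)
  have "dynkin (coef bch ?C) = (\<Sum>qs\<in>pair_lists ?C. scal (log_coeff qs) * mon_word [nested (flat qs)])"
    unfolding coef_bch[OF C] FA_linear_sum[OF FA_linear_dynkin] FA_linear_scalD[OF FA_linear_dynkin]
    by (intro sum.cong refl) (simp only: dynkin_mon[OF nonempty])
  hence d: "dynkin (coef bch ?C) - mon_word [w1 A B + w2 A B] \<in> env_ideal"
    using mon_sum_env[of log_coeff "\<lambda>qs. nested (flat qs)" "pair_lists ?C"]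
    by (simp only: log_term_def[symmetric] sum_log_term[OF A(1) B(1) A(2)])
  have l: "scal (of_nat ?n) * coef bch ?C - dynkin (coef bch ?C) \<in> env_ideal"
    using lie_degree_dynkin[OF lie_degree_bch[of ?C]] by (simp only: n)
  have "scal (1 / of_nat ?n) * (scal (of_nat ?n) * coef bch ?C - mon_word [w1 A B + w2 A B]) \<in> env_ideal"
    by (intro envI(4) ideal_trans[OF ideal_env_ideal l d])
  moreover have "scal (1 / of_nat ?n) * (scal (of_nat ?n) * coef bch ?C) = coef bch ?C"
    using n0 by (simp only: mult.assoc[symmetric] const_mult_const) (simp add: scal_1)
  ultimately have "coef bch ?C - scal (1 / of_nat ?n) * mon_word [w1 A B + w2 A B] \<in> env_ideal"
    by (simp only: right_diff_distrib)
  moreover have "scal (1 / of_nat ?n) * mon_word [w1 A B + w2 A B] - mon_word [w A B] \<in> env_ideal"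
    using envI(6)[OF env_linear(2)[of "1 / of_nat ?n" "w1 A B + w2 A B"]] A B by (simp add: w_def)
  ultimately show ?thesis by (rule ideal_trans[OF ideal_env_ideal])
qed

lemma coef_exp_letters_outside:
  assumes "finite D" "\<not> D \<subseteq> S"
  shows "coef (scal.exp_series (letter_series S)) D = (0 :: ('g, 'k) free_alg)"
proof -
  have e: "{us. distinct us \<and> set us \<subseteq> S \<and> set us = D} = {}" using assms(2) by auto
  show ?thesis unfolding coef_exp_letter_series[OF assms(1)] e by simp
qed

lemma coef_exp_letters_disjoint:
  assumes "finite D" "D \<inter> S = {}"
  shows "coef (scal.exp_series (letter_series S)) D = (if D = {} then 1 else (0 :: ('g, 'k) free_alg))"
proof (cases "D = {}")
  case False
  hence "\<not> D \<subseteq> S" using assms(2) by blast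
  thus ?thesis using coef_exp_letters_outside[OF assms(1)] False by simp
qed (simp add: scal.coef_subst_empty scal_1)

text \<open>With only one of the two groups of variables present, the logarithm is that of a single exponential.\<close>

lemma coef_bch_one_side:
  assumes "C \<subseteq> Xs \<or> C \<subseteq> Ys"
  shows "coef bch C = coef (letter_series (Xs \<union> Ys)) C"
proof -
  obtain S where S: "C \<subseteq> S" "S = Xs \<or> S = Ys" using assms by blast
  have "coef (exp_exp - 1) T = coef (scal.exp_series (letter_series S) - 1) T" if T: "T \<subseteq> C" for T
  proof -
    have fT: "finite T" using T S finite_sub by auto
    have fU: "finite U" "finite (T - U)" if "U \<in> Pow T" for U using that fT by (auto intro: finite_subset)
    have "coef exp_exp T = coef (scal.exp_series (letter_series S)) T"
    proof (cases "S = Xs")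
      case True
      hence "(T - U) \<inter> Ys = {}" for U using T S disjoint_Xs_Ys by blast
      hence "coef exp_exp T = (\<Sum>U\<in>Pow T. coef (scal.exp_series (letter_series Xs)) U * (if T - U = {} then 1 else 0))"
        unfolding exp_exp_def coef_mult using fU by (intro sum.cong refl) (simp only: coef_exp_letters_disjoint)
      also have "\<dots> = (\<Sum>U\<in>{T}. coef (scal.exp_series (letter_series Xs)) U)"
        using fT by (intro sum.mono_neutral_cong_right) auto
      finally show ?thesis using True by simp
    next
      case False
      hence "S = Ys" using S(2) by blast
      hence "U \<inter> Xs = {}" if "U \<in> Pow T" for U using T S(1) that disjoint_Xs_Ys by blast
      hence "coef exp_exp T = (\<Sum>U\<in>Pow T. (if U = {} then 1 else 0) * coef (scal.exp_series (letter_series Ys)) (T - U))"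
        unfolding exp_exp_def coef_mult using fU by (intro sum.cong refl) (simp only: coef_exp_letters_disjoint)
      also have "\<dots> = (\<Sum>U\<in>{{}}. coef (scal.exp_series (letter_series Ys)) (T - U))"
        using fT by (intro sum.mono_neutral_cong_right) auto
      finally show ?thesis using \<open>S = Ys\<close> by simp
    qed
    thus ?thesis by (simp only: minus_set_series.rep_eq)
  qed
  hence "coef bch C = coef (scal.ln_series (scal.exp_series (letter_series S))) C"
    unfolding bch_def by (rule scal.coef_subst_cong)
  also have "\<dots> = coef (letter_series S) C"
    by (simp only: scal.ln_exp_series[OF coef_letter_series_empty])
  also have "\<dots> = coef (letter_series (Xs \<union> Ys)) C"
    using S by (auto simp: letter_series.rep_eq)
  finally show ?thesis .
qed

end

section \<open>The operators \<open>B\<^sub>p\<close> on representatives\<close>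

context lie_algebra_derivation begin

abbreviation sym_coset :: "('g, 'k) free_alg \<Rightarrow> ('g, 'k) free_alg set"
  where "sym_coset f \<equiv> sym_ideal +>\<^bsub>FA\<^esub> f"

abbreviation env_coset :: "('g, 'k) free_alg \<Rightarrow> ('g, 'k) free_alg set"
  where "env_coset f \<equiv> env_ideal +>\<^bsub>FA\<^esub> f"

lemma coset_eq_iff:
  assumes "ideal J FA"
  shows "J +>\<^bsub>FA\<^esub> f = J +>\<^bsub>FA\<^esub> g \<longleftrightarrow> f - g \<in> J"
proof
  assume "J +>\<^bsub>FA\<^esub> f = J +>\<^bsub>FA\<^esub> g"
  moreover have "f \<in> J +>\<^bsub>FA\<^esub> f" unfolding coset_FA using idealD(1)[OF assms] by force
  ultimately have "f \<in> J +>\<^bsub>FA\<^esub> g" by simp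
  thus "f - g \<in> J" unfolding coset_FA by auto
next
  assume fg: "f - g \<in> J"
  have sub: "(\<lambda>h. h + f) ` J \<subseteq> (\<lambda>h. h + g) ` J" if "f - g \<in> J" for f g
  proof
    fix x assume "x \<in> (\<lambda>h. h + f) ` J"
    then obtain h where "h \<in> J" "x = h + f" by blast
    hence "x = (h + (f - g)) + g" "h + (f - g) \<in> J" using idealD(2)[OF assms _ that] by auto
    thus "x \<in> (\<lambda>h. h + g) ` J" by blast
  qed
  have "g - f \<in> J" using idealD(6)[OF assms fg] by simp
  thus "J +>\<^bsub>FA\<^esub> f = J +>\<^bsub>FA\<^esub> g" unfolding coset_FA using sub[OF fg] sub[of g f] by blast
qed

lemma coset_operations:
  assumes "ideal J FA"
  shows "(J +>\<^bsub>FA\<^esub> f) \<otimes>\<^bsub>FA Quot J\<^esub> (J +>\<^bsub>FA\<^esub> g) = J +>\<^bsub>FA\<^esub> (f * g)"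
    "(J +>\<^bsub>FA\<^esub> f) \<oplus>\<^bsub>FA Quot J\<^esub> (J +>\<^bsub>FA\<^esub> g) = J +>\<^bsub>FA\<^esub> (f + g)"
    "\<one>\<^bsub>FA Quot J\<^esub> = J +>\<^bsub>FA\<^esub> 1" "\<zero>\<^bsub>FA Quot J\<^esub> = J +>\<^bsub>FA\<^esub> 0"
    "carrier (FA Quot J) = range (\<lambda>f. J +>\<^bsub>FA\<^esub> f)"
proof -
  note hom = ideal.rcos_ring_hom[OF assms]
  have c: "f \<in> carrier FA" "f \<otimes>\<^bsub>FA\<^esub> g = f * g" "f \<oplus>\<^bsub>FA\<^esub> g = f + g" "\<one>\<^bsub>FA\<^esub> = 1" for f g :: "('g, 'k) free_alg"
    by (simp_all add: ring_of_type_algebra_def)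
  show "(J +>\<^bsub>FA\<^esub> f) \<otimes>\<^bsub>FA Quot J\<^esub> (J +>\<^bsub>FA\<^esub> g) = J +>\<^bsub>FA\<^esub> (f * g)"
    using ring_hom_mult[OF hom c(1) c(1), of f g] by (simp add: c)
  show "(J +>\<^bsub>FA\<^esub> f) \<oplus>\<^bsub>FA Quot J\<^esub> (J +>\<^bsub>FA\<^esub> g) = J +>\<^bsub>FA\<^esub> (f + g)"
    using ring_hom_add[OF hom c(1) c(1), of f g] by (simp add: c)
  show "\<one>\<^bsub>FA Quot J\<^esub> = J +>\<^bsub>FA\<^esub> 1" using ring_hom_one[OF hom] by (simp add: c)
  show "\<zero>\<^bsub>FA Quot J\<^esub> = J +>\<^bsub>FA\<^esub> 0" by (simp add: FactRing_def coset_FA)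
  show "carrier (FA Quot J) = range (\<lambda>f. J +>\<^bsub>FA\<^esub> f)"
    by (auto simp: FactRing_def A_RCOSETS_def' ring_of_type_algebra_def)
qed

lemmas Sym_operations = coset_operations[OF ideal_sym_ideal, folded Sym_def]
lemmas sym_coset_eq_iff = coset_eq_iff[OF ideal_sym_ideal]
lemmas env_coset_eq_iff = coset_eq_iff[OF ideal_env_ideal]

lemma commutator_sym_ideal: "f * g - g * f \<in> sym_ideal"
proof -
  have 1: "mon_word us * g - g * mon_word us \<in> sym_ideal" for us
  proof (rule FA_linear_in_ideal[where f = g and T = "\<lambda>g. mon_word us * g - g * mon_word us", OF _ ideal_sym_ideal])
    show "FA_linear (\<lambda>g. mon_word us * g - g * mon_word us)"
      by (rule FA_linear_diff) (simp_all add: FA_linear_def distrib_left distrib_right mult_scal mult.assoc)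
    show "mon_word us * mon_word vs - mon_word vs * mon_word us \<in> sym_ideal" for vs
      unfolding mon_mult by (rule mon_perm_sym_ideal) simp
  qed
  show ?thesis
  proof (rule FA_linear_in_ideal[where f = f and T = "\<lambda>f. f * g - g * f", OF _ ideal_sym_ideal])
    show "FA_linear (\<lambda>f. f * g - g * f)"
      by (rule FA_linear_diff) (simp_all add: FA_linear_def distrib_left distrib_right mult_scal mult.assoc)
  qed (rule 1)
qed

lemma cring_Sym: "cring Sym"
proof -
  have ring: "ring Sym" unfolding Sym_def by (rule ideal.quotient_is_ring[OF ideal_sym_ideal])
  have comm: "a \<otimes>\<^bsub>Sym\<^esub> b = b \<otimes>\<^bsub>Sym\<^esub> a" if "a \<in> carrier Sym" "b \<in> carrier Sym" for a b
  proof -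
    obtain f g where "a = sym_coset f" "b = sym_coset g" using \<open>a \<in> carrier Sym\<close> \<open>b \<in> carrier Sym\<close> unfolding Sym_operations by blast
    moreover have "sym_coset (f * g) = sym_coset (g * f)" by (simp only: sym_coset_eq_iff commutator_sym_ideal)
    ultimately show ?thesis by (simp only: Sym_operations)
  qed
  show ?thesis
    by (intro cring.intro comm_monoid.intro comm_monoid_axioms.intro ring ring.axioms(2) comm)
qed

lemma sym_coset_closed: "sym_coset f \<in> carrier Sym"
  by (simp add: Sym_operations)

lemma finsum_Sym:
  assumes "finite A"
  shows "finsum Sym (\<lambda>i. sym_coset (f i)) A = sym_coset (\<Sum>i\<in>A. f i)"
proof -
  interpret S: cring Sym by (rule cring_Sym)
  show ?thesis using assms
  proof (induction A)
    case empty
    show ?case by (simp only: S.finsum_empty sum.empty Sym_operations)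
  next
    case (insert i A)
    have "finsum Sym (\<lambda>i. sym_coset (f i)) (insert i A) = sym_coset (f i) \<oplus>\<^bsub>Sym\<^esub> finsum Sym (\<lambda>i. sym_coset (f i)) A"
      by (rule S.finsum_insert[OF insert.hyps]) (simp_all add: sym_coset_closed)
    thus ?case by (simp only: insert.IH Sym_operations sum.insert[OF insert.hyps])
  qed
qed

lemma finprod_Sym:
  assumes "distinct L"
  shows "finprod Sym (\<lambda>i. sym_embed (f i)) (set L) = sym_coset (mon_word (map f L))"
proof -
  interpret S: cring Sym by (rule cring_Sym)
  show ?thesis using assms
  proof (induction L)
    case Nil
    show ?case by (simp only: S.finprod_empty list.set list.map mon_word_Nil Sym_operations)
  next
    case (Cons i L)
    have "finprod Sym (\<lambda>i. sym_embed (f i)) (insert i (set L)) = sym_embed (f i) \<otimes>\<^bsub>Sym\<^esub> finprod Sym (\<lambda>i. sym_embed (f i)) (set L)"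
      using Cons.prems by (intro S.finprod_insert) (simp_all add: sym_coset_closed sym_embed_def)
    moreover have "finprod Sym (\<lambda>i. sym_embed (f i)) (set L) = sym_coset (mon_word (map f L))"
      using Cons by simp
    ultimately show ?case by (simp add: sym_embed_def Sym_operations mon_mult)
  qed
qed

lemma symmetrization_coset: "symmetrization (sym_coset f) = env_coset (symmetrize f)"
  unfolding symmetrization_def
  by (rule induced_map[OF ideal_sym_ideal ideal_env_ideal])
    (auto simp: symmetrize_sym_ideal FA_linear_addD[OF FA_linear_symmetrize])

lemma sym_part_coset: "sym_part d (sym_coset f) = sym_coset (hom_part d f)"
  unfolding sym_part_def
  by (rule induced_map[OF ideal_sym_ideal ideal_sym_ideal]) (auto simp: hom_part_sym_ideal hom_part_add)

lemma inj_symmetrization: "inj_on symmetrization (carrier Sym)"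
proof (rule inj_onI)
  fix a b assume "a \<in> carrier Sym" "b \<in> carrier Sym" and e: "symmetrization a = symmetrization b"
  then obtain f g where ab: "a = sym_coset f" "b = sym_coset g" unfolding Sym_operations by blast
  have "symmetrize f - symmetrize g \<in> env_ideal"
    using e by (simp only: ab symmetrization_coset env_coset_eq_iff)
  hence "f - g \<in> sym_ideal"
    by (intro symmetrize_injective) (simp only: FA_linear_minus[OF FA_linear_symmetrize])
  thus "a = b" by (simp only: ab sym_coset_eq_iff)
qed

lemma B_op_coset:
  assumes "symmetrize f * symmetrize g - symmetrize h \<in> env_ideal"
  shows "B_op (sym_coset f) (sym_coset g) = sym_coset h"
proof -
  have "env_coset (symmetrize f * symmetrize g) = env_coset (symmetrize h)"
    using assms by (simp only: env_coset_eq_iff)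
  hence "symmetrization (sym_coset f) \<otimes>\<^bsub>Env\<^esub> symmetrization (sym_coset g) = symmetrization (sym_coset h)"
    unfolding symmetrization_coset Env_def coset_operations[OF ideal_env_ideal] .
  thus ?thesis unfolding B_op_def by (simp only: inv_into_f_f[OF inj_symmetrization sym_coset_closed])
qed

text \<open>If one of the two products of letters is zero in the symmetric algebra, then the sum that defines \<open>B_part\<close>
  is empty; in that case \<open>h\<close> vanishes in the symmetric algebra as well, by injectivity of the symmetrization map.\<close>

lemma B_part_homogeneous:
  assumes h: "symmetrize (mon_word us) * symmetrize (mon_word vs) - symmetrize h \<in> env_ideal"
  shows "B_part p (sym_coset (mon_word us)) (sym_coset (mon_word vs)) =
    (if p \<le> length us + length vs then sym_coset (hom_part (length us + length vs - p) h) else \<zero>\<^bsub>Sym\<^esub>)"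
proof -
  interpret S: cring Sym by (rule cring_Sym)
  let ?n = "length us" and ?m = "length vs" and ?\<xi> = "sym_coset (mon_word us)" and ?\<eta> = "sym_coset (mon_word vs)"
  let ?T = "{(a, b). sym_part a ?\<xi> \<noteq> \<zero>\<^bsub>Sym\<^esub> \<and> sym_part b ?\<eta> \<noteq> \<zero>\<^bsub>Sym\<^esub> \<and> p \<le> a + b}"
  let ?F = "\<lambda>(a, b). sym_part (a + b - p) (B_op (sym_part a ?\<xi>) (sym_part b ?\<eta>))"
  have sp: "sym_part a (sym_coset (mon_word ws)) = (if length ws = a then sym_coset (mon_word ws) else \<zero>\<^bsub>Sym\<^esub>)" for a ws
    by (rule sym_part_mon)
  have z: "sym_coset f = \<zero>\<^bsub>Sym\<^esub> \<longleftrightarrow> f \<in> sym_ideal" for f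
    unfolding Sym_operations sym_coset_eq_iff by simp
  have F: "?F (?n, ?m) = sym_coset (hom_part (?n + ?m - p) h)"
    by (simp only: split_conv sp simp_thms if_True B_op_coset[OF h]) (simp only: sym_part_coset)
  show ?thesis
  proof (cases "?\<xi> \<noteq> \<zero>\<^bsub>Sym\<^esub> \<and> ?\<eta> \<noteq> \<zero>\<^bsub>Sym\<^esub> \<and> p \<le> ?n + ?m")
    case True
    hence T: "?T = {(?n, ?m)}" by (auto simp: sp split: if_splits)
    have "finsum Sym ?F {(?n, ?m)} = ?F (?n, ?m)"
      using S.finsum_insert[of "{}" "(?n, ?m)" ?F] F sym_coset_closed by (simp del: split_conv)
    thus ?thesis unfolding B_part_def T F using True by simp
  next
    case False
    hence T: "?T = {}" by (auto simp: sp split: if_splits)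
    have "hom_part d h \<in> sym_ideal" if "?\<xi> = \<zero>\<^bsub>Sym\<^esub> \<or> ?\<eta> = \<zero>\<^bsub>Sym\<^esub>" for d
    proof -
      have "symmetrize (mon_word us) * symmetrize (mon_word vs) \<in> env_ideal"
        using that symmetrize_sym_ideal envI(4,5) unfolding z by blast
      hence "symmetrize h \<in> env_ideal" using envI(3)[OF _ h] by fastforce
      thus ?thesis by (intro hom_part_sym_ideal symmetrize_injective)
    qed
    thus ?thesis unfolding B_part_def T S.finsum_empty using False z by auto
  qed
qed

end

section \<open>The product formula\<close>

lemma prod_list_zero: "0 \<in> set xs \<Longrightarrow> prod_list xs = (0 :: 'a::ring_1)"
  by (induction xs) auto

text \<open>Permutations of positions and orderings of the set of entries correspond to each other if the entries of
  \<open>Cs\<close> are distinct; their images under \<open>f\<close> may coincide.\<close>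

lemma symmetrize_distinct:
  fixes f :: "'c \<Rightarrow> 'g"
  assumes "distinct Cs"
  shows "symmetrize (mon_word (map f Cs) :: ('g, 'k::field_char_0) free_alg) =
    scal (1 / fact (length Cs)) * (\<Sum>Ds\<in>permutations_of_set (set Cs). mon_word (map f Ds))"
proof -
  have "(\<Sum>\<sigma> | \<sigma> permutes {..<length Cs}. mon_word (permute_list \<sigma> (map f Cs))) =
      (\<Sum>\<sigma> | \<sigma> permutes {..<length Cs}. mon_word (map f (permute_list \<sigma> Cs)) :: ('g, 'k) free_alg)"
    by (intro sum.cong refl) (simp add: permute_list_map)
  also have "\<dots> = (\<Sum>Ds\<in>permutations_of_set (set Cs). mon_word (map f Ds))"
  proof (rule sum.reindex_bij_betw)
    have "inj_on (\<lambda>\<sigma>. permute_list \<sigma> Cs) {\<sigma>. \<sigma> permutes {..<length Cs}}"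
    proof (rule inj_onI)
      fix \<sigma> \<tau> assume p: "\<sigma> \<in> {\<sigma>. \<sigma> permutes {..<length Cs}}" "\<tau> \<in> {\<sigma>. \<sigma> permutes {..<length Cs}}"
        and e: "permute_list \<sigma> Cs = permute_list \<tau> Cs"
      show "\<sigma> = \<tau>"
      proof
        fix i
        show "\<sigma> i = \<tau> i"
        proof (cases "i < length Cs")
          case True
          hence "Cs ! \<sigma> i = Cs ! \<tau> i"
            using p e permute_list_nth[of \<sigma> Cs i] permute_list_nth[of \<tau> Cs i] by simp
          moreover have "\<sigma> i < length Cs" "\<tau> i < length Cs"
            using p True permutes_in_image[of _ "{..<length Cs}" i] by auto
          ultimately show ?thesis using assms by (simp add: nth_eq_iff_index_eq)
        next
          case False
          thus ?thesis using p by (simp add: permutes_not_in)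
        qed
      qed
    qed
    moreover have "(\<lambda>\<sigma>. permute_list \<sigma> Cs) ` {\<sigma>. \<sigma> permutes {..<length Cs}} = permutations_of_set (set Cs)"
    proof (intro equalityI subsetI)
      fix Ds assume "Ds \<in> permutations_of_set (set Cs)"
      hence "set Ds = set Cs" "distinct Ds" by (simp_all add: permutations_of_set_def)
      hence "mset Ds = mset Cs" using assms set_eq_iff_mset_eq_distinct by blast
      then obtain \<sigma> where "\<sigma> permutes {..<length Cs}" "permute_list \<sigma> Cs = Ds"
        by (rule mset_eq_permutation)
      thus "Ds \<in> (\<lambda>\<sigma>. permute_list \<sigma> Cs) ` {\<sigma>. \<sigma> permutes {..<length Cs}}" by blast
    qed (use assms in \<open>auto simp: permutations_of_set_def distinct_permute_list\<close>)
    ultimately show "bij_betw (\<lambda>\<sigma>. permute_list \<sigma> Cs) {\<sigma>. \<sigma> permutes {..<length Cs}} (permutations_of_set (set Cs))"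
      by (simp add: bij_betw_def)
  qed
  finally show ?thesis by (simp add: symmetrize_linext linext_mon)
qed

context exp_product begin

lemma coef_exp_letters_self:
  assumes "distinct us" "set us = S"
  shows "coef (scal.exp_series (letter_series S)) S = (symmetrize (mon_word us) :: ('g, 'k) free_alg)"
proof -
  have S: "finite S" using assms(2) by auto
  have "{vs. distinct vs \<and> set vs \<subseteq> S \<and> set vs = S} = permutations_of_set S"
    by (auto simp: permutations_of_set_def)
  moreover have "length vs = length us" if "vs \<in> permutations_of_set S" for vs
    using that assms distinct_card[of vs] distinct_card[of us] by (simp add: permutations_of_set_def)
  ultimately have "coef (scal.exp_series (letter_series S)) S =
      (\<Sum>vs\<in>permutations_of_set S. scal (1 / fact (length us)) * mon_word vs :: ('g, 'k) free_alg)"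
    by (simp add: coef_exp_letter_series[OF S])
  moreover have "symmetrize (mon_word us) =
      (scal (1 / fact (length us)) * (\<Sum>vs\<in>permutations_of_set S. mon_word vs) :: ('g, 'k) free_alg)"
    by (subst symmetrize_distinct[OF assms(1), of "\<lambda>v. v", unfolded list.map_ident]) (simp only: assms(2))
  ultimately show ?thesis by (simp only: sum_distrib_left)
qed

lemma coef_exp_exp_top:
  assumes xs: "distinct xs" "set xs = Xs" and ys: "distinct ys" "set ys = Ys"
  shows "coef exp_exp (Xs \<union> Ys) = symmetrize (mon_word xs) * symmetrize (mon_word ys)"
proof -
  let ?V = "Xs \<union> Ys" 
  let ?e = "\<lambda>S. coef (scal.exp_series (letter_series S)) :: 'g set \<Rightarrow> ('g, 'k) free_alg"
  have V: "finite ?V" using finite_Xs finite_Ys by simp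
  have "coef exp_exp ?V = (\<Sum>T\<in>Pow ?V. ?e Xs T * ?e Ys (?V - T))"
    by (simp add: exp_exp_def coef_mult)
  also have "\<dots> = (\<Sum>T\<in>{Xs}. ?e Xs T * ?e Ys (?V - T))"
  proof (rule sum.mono_neutral_right)
    show "\<forall>T\<in>Pow ?V - {Xs}. ?e Xs T * ?e Ys (?V - T) = 0"
    proof
      fix T assume T: "T \<in> Pow ?V - {Xs}"
      hence "finite T" "finite (?V - T)" using V by (auto intro: finite_subset)
      moreover have "\<not> T \<subseteq> Xs \<or> \<not> ?V - T \<subseteq> Ys" using T disjoint_Xs_Ys by blast
      ultimately have "?e Xs T = 0 \<or> ?e Ys (?V - T) = 0" using coef_exp_letters_outside by blast
      thus "?e Xs T * ?e Ys (?V - T) = 0" by (elim disjE) (simp_all only: mult_zero_left mult_zero_right)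
    qed
  qed (use V in auto)
  finally have "coef exp_exp ?V = ?e Xs Xs * ?e Ys (?V - Xs)" by simp
  moreover have "?V - Xs = Ys" using disjoint_Xs_Ys by blast
  ultimately show ?thesis
    by (simp add: coef_exp_letters_self[OF xs] coef_exp_letters_self[OF ys])
qed

text \<open>The blocks at which the coefficient of \<open>bch\<close> is given by an element \<open>w\<close>; at all other nonempty blocks it is
  zero.\<close>

definition special_block :: "'g set \<Rightarrow> bool"
  where "special_block C \<longleftrightarrow> C \<inter> Xs \<noteq> {} \<and> C \<inter> Ys \<noteq> {} \<or> card C = 1"

definition block_w :: "'g set \<Rightarrow> 'g"
  where "block_w C = w (C \<inter> Xs) (C \<inter> Ys)"

lemma coef_bch_special:
  assumes C: "C \<subseteq> Xs \<union> Ys" "special_block C"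
  shows "coef bch C - mon_word [block_w C] \<in> env_ideal"
proof (cases "C \<inter> Xs \<noteq> {} \<and> C \<inter> Ys \<noteq> {}")
  case True
  have "C = (C \<inter> Xs) \<union> (C \<inter> Ys)" using C by blast
  thus ?thesis using True coef_bch_w[of "C \<inter> Xs" "C \<inter> Ys"] by (simp add: block_w_def)
next
  case False
  then obtain v where v: "C = {v}" using C(2) unfolding special_block_def by (meson card_1_singletonE)
  hence v': "v \<in> Xs \<or> v \<in> Ys" using C by blast
  have "w {v} {} = v" "w {} {v} = v" by (simp_all add: w_def)
  moreover have "C \<inter> Xs = {v} \<and> C \<inter> Ys = {} \<or> C \<inter> Xs = {} \<and> C \<inter> Ys = {v}"
    using v v' False by blast
  ultimately have "block_w C = v" unfolding block_w_def by fastforce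
  moreover have "coef bch C = mon_word [v]"
  proof -
    have "coef bch C = coef (letter_series (Xs \<union> Ys)) C" using v v' by (intro coef_bch_one_side) simp
    also have "\<dots> = mon_word [v]" using v' by (simp add: v letter_series.rep_eq)
    finally show ?thesis .
  qed
  ultimately show ?thesis by (simp add: envI)
qed

lemma coef_bch_not_special:
  assumes C: "C \<subseteq> Xs \<union> Ys" "\<not> special_block C"
  shows "coef bch C = 0"
proof -
  have "C \<subseteq> Xs \<or> C \<subseteq> Ys" using C unfolding special_block_def by blast
  hence "coef bch C = coef (letter_series (Xs \<union> Ys)) C" by (rule coef_bch_one_side)
  thus ?thesis using C(2) by (auto simp: letter_series.rep_eq special_block_def is_singleton_altdef)
qed

lemma prod_list_mon_env:
  "(\<And>C. C \<in> set Cs \<Longrightarrow> f C - mon_word [g C] \<in> env_ideal) \<Longrightarrow>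
    prod_list (map f Cs) - mon_word (map g Cs) \<in> env_ideal"
proof (induction Cs)
  case (Cons C Cs)
  have "(f C - mon_word [g C]) * prod_list (map f Cs) +
      mon_word [g C] * (prod_list (map f Cs) - mon_word (map g Cs)) \<in> env_ideal"
    using Cons by (intro envI(2,4,5)) simp_all
  thus ?case by (simp add: algebra_simps mon_mult)
qed (simp add: mon_word_Nil envI)

definition special_partitions :: "'g set set set"
  where "special_partitions = {\<pi>. partition_on (Xs \<union> Ys) \<pi> \<and> (\<forall>C\<in>\<pi>. special_block C)}"

text \<open>The coefficient of \<open>exp bch = exp_exp\<close> at \<open>Xs \<union> Ys\<close>, expanded over set partitions. Partitions with a
  block that is not special contribute zero; for the others, each coefficient of \<open>bch\<close> is represented by an
  element \<open>w\<close>. The function \<open>L\<close> chooses an enumeration of the blocks.\<close>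

lemma symmetrize_product:
  assumes xs: "distinct xs" "set xs = Xs" and ys: "distinct ys" "set ys = Ys"
    and L: "\<And>\<pi>. \<pi> \<in> special_partitions \<Longrightarrow> distinct (L \<pi>) \<and> set (L \<pi>) = \<pi>"
  shows "symmetrize (mon_word xs) * symmetrize (mon_word ys) -
    symmetrize (\<Sum>\<pi>\<in>special_partitions. mon_word (map block_w (L \<pi>))) \<in> env_ideal"
proof -
  let ?V = "Xs \<union> Ys"
  have V: "finite ?V" using finite_Xs finite_Ys by simp
  let ?p = "\<lambda>\<pi>. scal (1 / fact (card \<pi>)) * (\<Sum>Cs\<in>permutations_of_set \<pi>. prod_list (map (coef bch) Cs))"
  have fin: "finite {\<pi>. partition_on ?V \<pi>}" by (rule finitely_many_partition_on[OF V])
  have sub: "C \<subseteq> ?V" if "partition_on ?V \<pi>" "C \<in> \<pi>" for \<pi> C using that by (auto simp: partition_on_def)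
  have "symmetrize (mon_word xs) * symmetrize (mon_word ys) = coef (scal.exp_series bch) ?V"
    by (simp only: exp_bch coef_exp_exp_top[OF xs ys])
  also have "\<dots> = (\<Sum>\<pi> | partition_on ?V \<pi>. ?p \<pi>)"
    by (rule scal.coef_exp_series_partitions[OF bch_empty V])
  also have "\<dots> = (\<Sum>\<pi>\<in>special_partitions. ?p \<pi>)"
  proof (rule sum.mono_neutral_right[OF fin])
    show "\<forall>\<pi>\<in>{\<pi>. partition_on ?V \<pi>} - special_partitions. ?p \<pi> = 0"
    proof
      fix \<pi> assume \<pi>: "\<pi> \<in> {\<pi>. partition_on ?V \<pi>} - special_partitions"
      then obtain C where C: "C \<in> \<pi>" "\<not> special_block C" by (auto simp: special_partitions_def)
      have Z0: "coef bch C = 0" using coef_bch_not_special[OF _ C(2)] sub[OF _ C(1)] \<pi> by blast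
      have "prod_list (map (coef bch) Cs) = 0" if "Cs \<in> permutations_of_set \<pi>" for Cs
      proof (rule prod_list_zero)
        have "C \<in> set Cs" using that C(1) by (simp add: permutations_of_set_def)
        thus "0 \<in> set (map (coef bch) Cs)" unfolding set_map using Z0 by (intro image_eqI[of 0 "coef bch" C]) simp_all
      qed
      thus "?p \<pi> = 0" by simp
    qed
  qed (auto simp: special_partitions_def)
  finally have e: "symmetrize (mon_word xs) * symmetrize (mon_word ys) = (\<Sum>\<pi>\<in>special_partitions. ?p \<pi>)" .
  have "?p \<pi> - symmetrize (mon_word (map block_w (L \<pi>))) \<in> env_ideal" if \<pi>: "\<pi> \<in> special_partitions" for \<pi>
  proof -
    have l: "length (L \<pi>) = card \<pi>" using L[OF \<pi>] distinct_card[of "L \<pi>"] by simp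
    have "?p \<pi> - symmetrize (mon_word (map block_w (L \<pi>))) = scal (1 / fact (card \<pi>)) *
        (\<Sum>Cs\<in>permutations_of_set \<pi>. prod_list (map (coef bch) Cs) - mon_word (map block_w Cs))"
      using symmetrize_distinct[of "L \<pi>" block_w] L[OF \<pi>] l by (simp add: sum_subtractf right_diff_distrib)
    also have "\<dots> \<in> env_ideal"
    proof (intro envI(4,7) prod_list_mon_env coef_bch_special)
      fix Cs C assume "Cs \<in> permutations_of_set \<pi>" "C \<in> set Cs"
      hence "C \<in> \<pi>" by (simp add: permutations_of_set_def)
      thus "C \<subseteq> ?V" "special_block C" using \<pi> sub by (auto simp: special_partitions_def)
    qed
    finally show ?thesis .
  qed
  hence "(\<Sum>\<pi>\<in>special_partitions. ?p \<pi> - symmetrize (mon_word (map block_w (L \<pi>)))) \<in> env_ideal"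
    by (rule envI(7))
  thus ?thesis by (simp only: e FA_linear_sum[OF FA_linear_symmetrize] sum_subtractf)
qed

end

context exp_product begin

definition split_block :: "'g set \<Rightarrow> 'g set \<times> 'g set"
  where "split_block C = (C \<inter> Xs, C \<inter> Ys)"

lemma special_bipartition_split:
  assumes \<pi>: "\<pi> \<in> special_partitions"
  shows "special_bipartition Xs Ys (split_block ` \<pi>)"
proof -
  have un: "\<Union>\<pi> = Xs \<union> Ys" and dis: "\<And>C D. C \<in> \<pi> \<Longrightarrow> D \<in> \<pi> \<Longrightarrow> C \<noteq> D \<Longrightarrow> C \<inter> D = {}"
    and sb: "\<And>C. C \<in> \<pi> \<Longrightarrow> special_block C"
    using \<pi> by (auto simp: special_partitions_def partition_on_def disjoint_def)
  have "bipartition Xs Ys (split_block ` \<pi>)"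
    unfolding bipartition_def
  proof (intro conjI ballI impI)
    show "split_block ` \<pi> \<subseteq> Pow Xs \<times> Pow Ys" by (auto simp: split_block_def)
    show "Xs = (\<Union>S\<in>split_block ` \<pi>. fst S)" "Ys = (\<Union>S\<in>split_block ` \<pi>. snd S)"
      using un by (auto simp: split_block_def)
    fix S T assume "S \<in> split_block ` \<pi>" "T \<in> split_block ` \<pi>" "S \<noteq> T"
    then obtain C D where "C \<in> \<pi>" "D \<in> \<pi>" "C \<noteq> D" "S = split_block C" "T = split_block D" by blast
    thus "fst S \<inter> fst T = {}" "snd S \<inter> snd T = {}" using dis[of C D] by (auto simp: split_block_def)
  qed
  moreover have "card S = 1" if S: "({}, S) \<in> split_block ` \<pi> \<or> (S, {}) \<in> split_block ` \<pi>" for S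
  proof -
    obtain C where C: "C \<in> \<pi>" "({}, S) = split_block C \<or> (S, {}) = split_block C" using S by blast
    hence "C \<subseteq> Xs \<union> Ys" using un by blast
    hence "S = C" using C(2) by (auto simp: split_block_def)
    moreover have "card C = 1" using sb[OF C(1)] C(2) by (auto simp: special_block_def split_block_def)
    ultimately show ?thesis by simp
  qed
  ultimately show ?thesis by (simp add: special_bipartition_def)
qed

lemma split_block_Un:
  assumes "S \<in> Pow Xs \<times> Pow Ys"
  shows "split_block (fst S \<union> snd S) = S"
  using assms disjoint_Xs_Ys by (cases S) (auto simp: split_block_def)

lemma special_bipartition_merge:
  assumes \<pi>: "special_bipartition Xs Ys \<pi>"
  shows "(\<lambda>S. fst S \<union> snd S) ` \<pi> \<in> special_partitions"
proof -
  let ?u = "\<lambda>S. fst S \<union> snd S :: 'g set"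
  have sub: "\<pi> \<subseteq> Pow Xs \<times> Pow Ys" and un: "Xs = (\<Union>S\<in>\<pi>. fst S)" "Ys = (\<Union>S\<in>\<pi>. snd S)"
    and dis: "\<And>S T. S \<in> \<pi> \<Longrightarrow> T \<in> \<pi> \<Longrightarrow> S \<noteq> T \<Longrightarrow> fst S \<inter> fst T = {} \<and> snd S \<inter> snd T = {}"
    and c1: "\<And>S. ({}, S) \<in> \<pi> \<Longrightarrow> card S = 1" and c2: "\<And>S. (S, {}) \<in> \<pi> \<Longrightarrow> card S = 1"
    using \<pi> unfolding special_bipartition_def bipartition_def by blast+
  have sub': "fst S \<subseteq> Xs \<and> snd S \<subseteq> Ys" if "S \<in> \<pi>" for S
    using subsetD[OF sub that] by (cases S) simp
  have "({}, {}) \<notin> \<pi>" using c1[of "{}"] by auto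
  hence ne: "?u S \<noteq> {}" if "S \<in> \<pi>" for S using that by (cases S) auto
  have d: "?u S \<inter> ?u T = {}" if "S \<in> \<pi>" "T \<in> \<pi>" "?u S \<noteq> ?u T" for S T
  proof -
    have "fst S \<inter> fst T = {}" "snd S \<inter> snd T = {}" using dis that by blast+
    moreover have "fst S \<subseteq> Xs" "fst T \<subseteq> Xs" "snd S \<subseteq> Ys" "snd T \<subseteq> Ys" using that sub' by blast+
    ultimately show ?thesis using disjoint_Xs_Ys by blast
  qed
  have "partition_on (Xs \<union> Ys) (?u ` \<pi>)"
    unfolding partition_on_def disjoint_def
  proof (intro conjI ballI impI)
    have "\<Union> (?u ` \<pi>) = (\<Union>S\<in>\<pi>. fst S) \<union> (\<Union>S\<in>\<pi>. snd S)" by blast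
    thus "\<Union> (?u ` \<pi>) = Xs \<union> Ys" by (simp only: un[symmetric])
    show "{} \<notin> ?u ` \<pi>" using ne by blast
    show "C \<inter> D = {}" if "C \<in> ?u ` \<pi>" "D \<in> ?u ` \<pi>" "C \<noteq> D" for C D using d that by blast
  qed
  moreover have "special_block (?u S)" if S: "S \<in> \<pi>" for S
  proof -
    have "?u S \<inter> Xs = fst S" "?u S \<inter> Ys = snd S"
      using split_block_Un[of S] S sub by (auto simp: split_block_def prod_eq_iff)
    thus ?thesis using c1[of "snd S"] c2[of "fst S"] S by (cases S) (auto simp: special_block_def)
  qed
  ultimately show ?thesis by (auto simp: special_partitions_def)
qed

lemma bij_split_blocks:
  "bij_betw (\<lambda>\<pi>. split_block ` \<pi>) special_partitions {\<pi>. special_bipartition Xs Ys \<pi>}"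
proof (rule bij_betwI[where g = "\<lambda>\<pi>. (\<lambda>S. fst S \<union> snd S) ` \<pi>"])
  show "(\<lambda>\<pi>. split_block ` \<pi>) \<in> special_partitions \<rightarrow> {\<pi>. special_bipartition Xs Ys \<pi>}"
    using special_bipartition_split by blast
  show "(\<lambda>\<pi>. (\<lambda>S. fst S \<union> snd S) ` \<pi>) \<in> {\<pi>. special_bipartition Xs Ys \<pi>} \<rightarrow> special_partitions"
    using special_bipartition_merge by blast
  show "(\<lambda>S. fst S \<union> snd S) ` split_block ` \<pi> = \<pi>" if "\<pi> \<in> special_partitions" for \<pi>
  proof -
    have "fst (split_block C) \<union> snd (split_block C) = C" if "C \<in> \<pi>" for C
      using that \<open>\<pi> \<in> special_partitions\<close> by (auto simp: special_partitions_def partition_on_def split_block_def)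
    thus ?thesis by (simp add: image_image)
  qed
  show "split_block ` (\<lambda>S. fst S \<union> snd S) ` \<pi> = \<pi>" if "\<pi> \<in> {\<pi>. special_bipartition Xs Ys \<pi>}" for \<pi>
  proof -
    have "split_block (fst S \<union> snd S) = S" if "S \<in> \<pi>" for S
      using that \<open>\<pi> \<in> _\<close> by (intro split_block_Un) (auto simp: special_bipartition_def bipartition_def)
    thus ?thesis by (simp add: image_image)
  qed
qed

lemma inj_on_split_block: "\<pi> \<in> special_partitions \<Longrightarrow> inj_on split_block \<pi>"
proof (rule inj_onI)
  fix C D assume "\<pi> \<in> special_partitions" "C \<in> \<pi>" "D \<in> \<pi>" and e: "split_block C = split_block D"
  hence "C \<subseteq> Xs \<union> Ys" "D \<subseteq> Xs \<union> Ys" by (auto simp: special_partitions_def partition_on_def)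
  thus "C = D" using e by (auto simp: split_block_def)
qed

lemma finite_special_partitions: "finite special_partitions" "\<pi> \<in> special_partitions \<Longrightarrow> finite \<pi>"
proof -
  have V: "finite (Xs \<union> Ys)" using finite_Xs finite_Ys by simp
  show "finite special_partitions"
    using finitely_many_partition_on[OF V] by (auto simp: special_partitions_def)
  show "\<pi> \<in> special_partitions \<Longrightarrow> finite \<pi>"
    using finite_elements[OF V] by (auto simp: special_partitions_def)
qed

text \<open>Only partitions into \<open>d\<close> blocks contribute to the component of degree \<open>d\<close>.\<close>

theorem B_part_product:
  assumes xs: "distinct xs" "set xs = Xs" and ys: "distinct ys" "set ys = Ys"
  shows "B_part p (sym_coset (mon_word xs)) (sym_coset (mon_word ys)) =
    (\<Oplus>\<^bsub>Sym\<^esub> \<pi>\<in>{\<pi>. special_bipartition Xs Ys \<pi> \<and> card \<pi> + p = length xs + length ys}.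
      \<Otimes>\<^bsub>Sym\<^esub> S\<in>\<pi>. sym_embed (w (fst S) (snd S)))"
proof -
  interpret S: cring Sym by (rule cring_Sym)
  have "\<forall>\<pi>\<in>special_partitions. \<exists>Cs. distinct Cs \<and> set Cs = \<pi>"
    using finite_special_partitions(2) finite_distinct_list by blast
  then obtain L where L: "\<And>\<pi>. \<pi> \<in> special_partitions \<Longrightarrow> distinct (L \<pi>) \<and> set (L \<pi>) = \<pi>"
    by (rule bchoice[THEN exE]) blast
  let ?N = "length xs + length ys" and ?h = "\<lambda>\<pi>. mon_word (map block_w (L \<pi>)) :: ('g, 'k) free_alg"
  let ?A = "{\<pi> \<in> special_partitions. card \<pi> + p = ?N}" and ?b = "\<lambda>\<pi>. split_block ` \<pi>"
  let ?F = "\<lambda>\<pi>. \<Otimes>\<^bsub>Sym\<^esub> S\<in>\<pi>. sym_embed (w (fst S) (snd S))"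
  have len: "length (L \<pi>) = card \<pi>" if "\<pi> \<in> special_partitions" for \<pi>
    using L[OF that] distinct_card[of "L \<pi>"] by simp
  have card: "card (?b \<pi>) = card \<pi>" if "\<pi> \<in> special_partitions" for \<pi>
    by (rule card_image[OF inj_on_split_block[OF that]])
  have idx: "{\<pi>. special_bipartition Xs Ys \<pi> \<and> card \<pi> + p = ?N} = ?b ` ?A"
  proof (intro equalityI subsetI)
    fix \<pi>' assume \<pi>': "\<pi>' \<in> {\<pi>. special_bipartition Xs Ys \<pi> \<and> card \<pi> + p = ?N}"
    then obtain \<pi> where "\<pi> \<in> special_partitions" "\<pi>' = ?b \<pi>"
      using bij_betw_imp_surj_on[OF bij_split_blocks] by blast
    thus "\<pi>' \<in> ?b ` ?A" using \<pi>' card[of \<pi>] by simp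
  next
    fix \<pi>' assume "\<pi>' \<in> ?b ` ?A"
    then obtain \<pi> where "\<pi> \<in> special_partitions" "\<pi>' = ?b \<pi>" "card \<pi> + p = ?N" by blast
    thus "\<pi>' \<in> {\<pi>. special_bipartition Xs Ys \<pi> \<and> card \<pi> + p = ?N}"
      using special_bipartition_split card by simp
  qed
  have inj: "inj_on ?b ?A"
    by (rule inj_on_subset[OF bij_betw_imp_inj_on[OF bij_split_blocks]]) blast
  have F: "?F (?b \<pi>) = sym_coset (?h \<pi>)" if \<pi>: "\<pi> \<in> ?A" for \<pi>
  proof -
    have sp: "\<pi> \<in> special_partitions" using \<pi> by simp
    have "distinct (map split_block (L \<pi>))" "set (map split_block (L \<pi>)) = ?b \<pi>"
      using L[OF sp] inj_on_split_block[OF sp] by (simp_all add: distinct_map)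
    hence "?F (?b \<pi>) = sym_coset (mon_word (map (\<lambda>S. w (fst S) (snd S)) (map split_block (L \<pi>))))"
      using finprod_Sym[of "map split_block (L \<pi>)" "\<lambda>S. w (fst S) (snd S)"] by simp
    also have "map (\<lambda>S. w (fst S) (snd S)) (map split_block (L \<pi>)) = map block_w (L \<pi>)"
      by (simp add: split_block_def block_w_def)
    finally show ?thesis .
  qed
  have "finsum Sym ?F (?b ` ?A) = finsum Sym (\<lambda>\<pi>. ?F (?b \<pi>)) ?A"
    by (rule S.finsum_reindex[OF _ inj]) (auto simp: F sym_coset_closed)
  also have "\<dots> = finsum Sym (\<lambda>\<pi>. sym_coset (?h \<pi>)) ?A"
    by (rule S.finsum_cong') (auto simp: F sym_coset_closed)
  also have "\<dots> = sym_coset (\<Sum>\<pi>\<in>?A. ?h \<pi>)"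
    using finite_special_partitions(1) by (intro finsum_Sym) simp
  finally have rhs: "finsum Sym ?F (?b ` ?A) = sym_coset (\<Sum>\<pi>\<in>?A. ?h \<pi>)" .
  have lhs: "B_part p (sym_coset (mon_word xs)) (sym_coset (mon_word ys)) =
    (if p \<le> ?N then sym_coset (hom_part (?N - p) (\<Sum>\<pi>\<in>special_partitions. ?h \<pi>)) else \<zero>\<^bsub>Sym\<^esub>)"
    by (rule B_part_homogeneous[OF symmetrize_product[OF xs ys L]])
  show ?thesis
  proof (cases "p \<le> ?N")
    case True
    have "hom_part (?N - p) (\<Sum>\<pi>\<in>special_partitions. ?h \<pi>) =
        (\<Sum>\<pi>\<in>special_partitions. if card \<pi> + p = ?N then ?h \<pi> else 0)"
      unfolding FA_linear_sum[OF FA_linear_hom_part]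
      using True by (intro sum.cong refl) (auto simp: hom_part_mon len)
    also have "\<dots> = (\<Sum>\<pi>\<in>?A. ?h \<pi>)"
      by (rule sum.inter_filter[OF finite_special_partitions(1), symmetric])
    finally show ?thesis unfolding idx rhs lhs using True by simp
  next
    case False
    hence e: "?A = {}" by auto
    show ?thesis unfolding idx rhs lhs using False by (simp add: e Sym_operations)
  qed
qed

corollary B_part_product_top:
  assumes xs: "distinct xs" "set xs = Xs" "xs \<noteq> []" and ys: "distinct ys" "set ys = Ys" "ys \<noteq> []"
  shows "B_part (length xs + length ys - 1) (sym_coset (mon_word xs)) (sym_coset (mon_word ys)) = sym_embed (w Xs Ys)"
proof -
  interpret S: cring Sym by (rule cring_Sym)
  let ?N = "length xs + length ys"
  have ne: "Xs \<noteq> {}" "Ys \<noteq> {}" "?N \<ge> 1" using xs ys by (auto simp: Suc_le_eq)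
  have "{\<pi>. special_bipartition Xs Ys \<pi> \<and> card \<pi> + (?N - 1) = ?N} = {{(Xs, Ys)}}"
  proof (intro equalityI subsetI)
    fix \<pi> assume "\<pi> \<in> {\<pi>. special_bipartition Xs Ys \<pi> \<and> card \<pi> + (?N - 1) = ?N}"
    hence \<pi>: "special_bipartition Xs Ys \<pi>" "card \<pi> = 1" using ne(3) by auto
    then obtain S where S: "\<pi> = {S}" using card_1_singletonE by blast
    have "Xs = fst S" "Ys = snd S" using \<pi>(1) unfolding special_bipartition_def bipartition_def S by auto
    thus "\<pi> \<in> {{(Xs, Ys)}}" using S by simp
  next
    fix \<pi> assume "\<pi> \<in> {{(Xs, Ys)}}"
    thus "\<pi> \<in> {\<pi>. special_bipartition Xs Ys \<pi> \<and> card \<pi> + (?N - 1) = ?N}"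
      using ne by (auto simp: special_bipartition_def bipartition_def)
  qed
  moreover have "(\<Otimes>\<^bsub>Sym\<^esub> S\<in>{(Xs, Ys)}. sym_embed (w (fst S) (snd S))) = sym_embed (w Xs Ys)"
    using finprod_Sym[of "[(Xs, Ys)]" "\<lambda>S. w (fst S) (snd S)"] by (simp add: sym_embed_def)
  moreover have "finsum Sym F {{(Xs, Ys)}} = F {(Xs, Ys)}" if "F {(Xs, Ys)} \<in> carrier Sym" for F
    using S.finsum_insert[of "{}" "{(Xs, Ys)}" F] that by simp
  ultimately show ?thesis
    unfolding B_part_product[OF xs(1,2) ys(1,2)] by (simp add: sym_embed_def sym_coset_closed)
qed

end

section \<open>The degree derivation of a free Lie algebra\<close>

text \<open>The Lie algebra \<open>g[\<epsilon>] / (\<epsilon>\<^sup>2)\<close>. Homomorphisms into it of the form \<open>s \<mapsto> s + \<epsilon> E s\<close> are the same as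
  derivations \<open>E\<close>.\<close>

lemma dual_number_lie_algebra:
  assumes "lie_algebra sc br"
  shows "lie_algebra (\<lambda>c (a, b). (sc c a, sc c b)) (\<lambda>(a, b) (c, d). (br a c, br a d + br b c))"
proof -
  interpret lie_algebra sc br by fact
  have z: "br 0 x = 0" "br x 0 = 0" for x
    using bracket_add_left[of 0 0 x] bracket_add_right[of x 0 0] by simp_all
  have anti: "br x y + br y x = 0" for x y
  proof -
    have "br x y + br y x = br (x + y) (x + y)"
      by (simp only: bracket_add_left bracket_add_right) (simp add: bracket_self)
    thus ?thesis by (simp only: bracket_self)
  qed
  show ?thesis
  proof (unfold_locales, goal_cases)
    case (10 x y z)
    obtain a a' b b' c c' where [simp]: "x = (a, a')" "y = (b, b')" "z = (c, c')" by (cases x, cases y, cases z)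
    have "(br a (br b c' + br b' c) + br a' (br b c)) + (br b (br c a' + br c' a) + br b' (br c a)) + (br c (br a b' + br a' b) + br c' (br a b)) =
       (br a' (br b c) + br b (br c a') + br c (br a' b)) + (br a (br b' c) + br b' (br c a) + br c (br a b')) + (br a (br b c') + br b (br c' a) + br c' (br a b))"
      by (simp add: bracket_add_right add_ac)
    also have "\<dots> = 0" by (simp only: jacobi) simp
    finally show ?case by (simp add: jacobi zero_prod_def plus_prod_def)
  qed (auto simp: plus_prod_def zero_prod_def scale_left_distrib scale_right_distrib bracket_add_left bracket_add_right
    bracket_scale_left bracket_scale_right bracket_self anti add_ac)
qed

lemma free_lie_induct [case_names gen zero add scale bracket]:
  assumes "\<And>a. Q (gen a)" "Q 0" "\<And>s t. Q s \<Longrightarrow> Q t \<Longrightarrow> Q (s + t)" "\<And>c s. Q s \<Longrightarrow> Q (fl_scale c s)"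
    "\<And>s t. Q s \<Longrightarrow> Q t \<Longrightarrow> Q (fl_bracket s t)"
  shows "Q (s :: ('k::field, 'a) free_lie)"
proof -
  have "Q (abs_free_lie t)" for t
    by (induction t) (use assms in \<open>simp_all flip: gen.abs_eq zero_free_lie.abs_eq
      plus_free_lie.abs_eq fl_scale.abs_eq fl_bracket.abs_eq\<close>)
  hence "Q (abs_free_lie (rep_free_lie s))" .
  thus ?thesis by (simp only: Quotient3_abs_rep[OF Quotient3_free_lie])
qed

text \<open>By the universal property there is a homomorphism into the dual numbers with \<open>gen a \<mapsto> gen a + \<epsilon> gen a\<close>;
  its component at \<open>\<epsilon>\<close> is the derivation.\<close>

lemma free_lie_degree_derivation:
  "\<exists>E :: ('k::field_char_0, 'a) free_lie \<Rightarrow> ('k, 'a) free_lie. (\<forall>a. E (gen a) = gen a) \<and>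
    (\<forall>s t. E (s + t) = E s + E t) \<and> (\<forall>c s. E (fl_scale c s) = fl_scale c (E s)) \<and>
    (\<forall>s t. E (fl_bracket s t) = fl_bracket (E s) t + fl_bracket s (E t))"
proof -
  let ?sc = "\<lambda>c (a, b). (fl_scale c a, fl_scale c b :: ('k, 'a) free_lie)"
  let ?br = "\<lambda>(a, b) (c, d). (fl_bracket a c, fl_bracket a d + fl_bracket b c :: ('k, 'a) free_lie)"
  have lie: "lie_algebra ?sc ?br"
    by (rule dual_number_lie_algebra) (rule free_lie.lie_algebra_axioms)
  obtain \<phi> :: "('k, 'a) free_lie \<Rightarrow> _" where add: "\<And>s t. \<phi> (s + t) = \<phi> s + \<phi> t" and scale: "\<And>c s. \<phi> (fl_scale c s) = ?sc c (\<phi> s)"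
    and bracket: "\<And>s t. \<phi> (fl_bracket s t) = ?br (\<phi> s) (\<phi> t)" and gen: "\<And>a. \<phi> (gen a) = (gen a, gen a)"
    using ex1_implies_ex[OF free_lie_universal[OF lie, of "\<lambda>a. (gen a, gen a)"]] by blast
  have fst: "fst (\<phi> s) = s" for s
  proof (induction s rule: free_lie_induct)
    case zero
    have "\<phi> 0 = 0" using add[of 0 0] by simp
    thus ?case by simp
  qed (simp_all add: gen add scale bracket case_prod_beta)
  show ?thesis
    by (rule exI[of _ "\<lambda>s. snd (\<phi> s)"]) (simp add: gen add scale bracket case_prod_beta fst add.commute)
qed

text \<open>Every element is a sum of eigenvectors for eigenvalues \<open>n \<ge> 1\<close>, because brackets of eigenvectors are
  eigenvectors for the sum of the eigenvalues. Eigenvectors have preimages. An element \<open>s\<close> with \<open>E s = 0\<close> is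
  killed by \<open>(E - 1) \<cdots> (E - N)\<close> for large \<open>N\<close>, but this operator multiplies \<open>s\<close> by \<open>\<plusminus> N!\<close>.\<close>

lemma bij_free_lie_derivation:
  fixes E :: "('k::field_char_0, 'a) free_lie \<Rightarrow> ('k, 'a) free_lie"
  assumes gen: "\<And>a. E (gen a) = gen a" and add: "\<And>s t. E (s + t) = E s + E t"
    and scale: "\<And>c s. E (fl_scale c s) = fl_scale c (E s)"
    and bracket: "\<And>s t. E (fl_bracket s t) = fl_bracket (E s) t + fl_bracket s (E t)"
  shows "bij E"
proof -
  let ?sc = "fl_scale :: 'k \<Rightarrow> ('k, 'a) free_lie \<Rightarrow> ('k, 'a) free_lie"
  have E0: "E 0 = 0" using add[of 0 0] by simp
  (* the eigenspace for the eigenvalue n *)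
  define H where "H n = {v. E v = ?sc (of_nat n) v}" for n
  have H_bracket: "fl_bracket u v \<in> H (m + n)" if "u \<in> H m" "v \<in> H n" for u v m n
    using that by (simp add: H_def bracket free_lie.bracket_scale_left free_lie.bracket_scale_right
      free_lie.scale_left_distrib)
  have H_scale: "?sc c v \<in> H n" if "v \<in> H n" for c v n
    using that by (simp add: H_def scale mult.commute)
  (* the sums of eigenvectors for positive eigenvalues *)
  define G where "G = {v. \<forall>Q. Q 0 \<longrightarrow> (\<forall>n\<ge>1. \<forall>u\<in>H n. \<forall>t. Q t \<longrightarrow> Q (u + t)) \<longrightarrow> Q v}"
  have G0: "0 \<in> G" and G_step: "\<And>n u t. n \<ge> 1 \<Longrightarrow> u \<in> H n \<Longrightarrow> t \<in> G \<Longrightarrow> u + t \<in> G"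
    unfolding G_def by blast+
  have G_induct: "Q v" if "v \<in> G" "Q 0" "\<And>n u t. n \<ge> 1 \<Longrightarrow> u \<in> H n \<Longrightarrow> Q t \<Longrightarrow> Q (u + t)" for Q v
    using that unfolding G_def by blast
  have G_H: "u \<in> G" if "n \<ge> 1" "u \<in> H n" for u n using G_step[OF that G0] by simp
  have G_add: "s + t \<in> G" if "s \<in> G" "t \<in> G" for s t
    using that(1) by (rule G_induct) (use that(2) G_step in \<open>auto simp: add.assoc\<close>)
  have G_scale: "?sc c s \<in> G" if "s \<in> G" for c s
    using that by (rule G_induct) (use G0 G_step H_scale in \<open>auto simp: free_lie.scale_right_distrib\<close>)
  have br0: "fl_bracket 0 v = (0 :: ('k, 'a) free_lie)" "fl_bracket v 0 = (0 :: ('k, 'a) free_lie)" for v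
    using free_lie.bracket_add_left[of 0 0 v] free_lie.bracket_add_right[of v 0 0] by simp_all
  have G_bracket: "fl_bracket s t \<in> G" if "s \<in> G" "t \<in> G" for s t
    using that(1)
  proof (rule G_induct)
    fix n u s assume u: "n \<ge> 1" "u \<in> H n" and s: "fl_bracket s t \<in> G"
    have "fl_bracket u t \<in> G"
      using \<open>t \<in> G\<close>
    proof (rule G_induct)
      fix m v t' assume "m \<ge> 1" "v \<in> H m" "fl_bracket u t' \<in> G"
      thus "fl_bracket u (v + t') \<in> G"
        unfolding free_lie.bracket_add_right using u by (intro G_step[of "n + m"] H_bracket) simp_all
    qed (simp add: br0 G0)
    thus "fl_bracket (u + s) t \<in> G" using s by (simp add: free_lie.bracket_add_left G_add)
  qed (simp add: br0 G0)
  have G: "s \<in> G" for s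
  proof (induction s rule: free_lie_induct)
    case (gen a)
    show ?case by (rule G_H[of 1]) (simp_all add: H_def assms(1))
  qed (simp_all add: G0 G_add G_scale G_bracket)
  have "\<exists>h. s = E h" for s
    using G[of s]
  proof (rule G_induct)
    show "\<exists>h. 0 = E h" using E0 by (intro exI[of _ 0]) simp
    fix n u t assume n: "1 \<le> n" and u: "u \<in> H n" and "\<exists>h. t = E h"
    then obtain h where "E h = t" by blast
    moreover have "E (?sc (1 / of_nat n) u) = u" using n u by (simp add: H_def scale)
    ultimately have "E (?sc (1 / of_nat n) u + h) = u + t" by (simp add: add)
    thus "\<exists>h. u + t = E h" by (intro exI) (rule sym)
  qed
  hence surj: "surj E" by (simp only: surj_def) blast
  (* T n = (E - n) ... (E - 1) *)
  define T where "T = rec_nat (\<lambda>v. v) (\<lambda>n f v. E (f v) - ?sc (of_nat (Suc n)) (f v))"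
  have T: "T 0 v = v" "T (Suc n) v = E (T n v) - ?sc (of_nat (Suc n)) (T n v)" for n v
    by (simp_all add: T_def)
  have T_add: "T n (u + v) = T n u + T n v" for n u v
    by (induction n) (simp_all add: T add free_lie.scale_right_distrib del: of_nat_Suc)
  have T_0: "T n 0 = 0" for n by (induction n) (simp_all add: T E0)
  have T_H: "T n v \<in> H m" if "v \<in> H m" for n m v
  proof (induction n)
    case (Suc n)
    hence "E (T n v) - ?sc (of_nat (Suc n)) (T n v) = ?sc (of_nat m - of_nat (Suc n)) (T n v)"
      by (simp add: H_def free_lie.scale_left_diff_distrib del: of_nat_Suc)
    thus ?case using H_scale[OF Suc] by (simp only: T)
  qed (use that in \<open>simp add: T\<close>)
  have T_mono: "T M v = 0" if "T N v = 0" "N \<le> M" for M N v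
    using that(2) by (induction M rule: dec_induct) (simp_all add: that(1) T E0)
  have T_nil: "\<exists>N. T N s = 0" for s
    using G[of s]
  proof (rule G_induct)
    show "\<exists>N. T N 0 = 0" using T_0 by blast
    fix n u t assume n: "1 \<le> n" and u: "u \<in> H n" and "\<exists>N. T N t = 0"
    then obtain N where N: "T N t = 0" by blast
    obtain k where k: "n = Suc k" using n by (cases n) auto
    have "T n u = 0" using T_H[OF u, of k] by (simp add: k T H_def del: of_nat_Suc)
    hence "T (max n N) (u + t) = 0" using T_mono[of n u "max n N"] T_mono[OF N, of "max n N"] by (simp add: T_add)
    thus "\<exists>N. T N (u + t) = 0" by blast
  qed
  have T_ker: "\<exists>c. c \<noteq> 0 \<and> T n s = ?sc c s" if "E s = 0" for n s
  proof (induction n)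
    case 0
    show ?case by (rule exI[of _ 1]) (simp add: T)
  next
    case (Suc n)
    then obtain c where c: "c \<noteq> 0" "T n s = ?sc c s" by blast
    have "T (Suc n) s = - ?sc (of_nat (Suc n)) (?sc c s)"
      by (simp add: T c scale that del: of_nat_Suc)
    hence "T (Suc n) s = ?sc (- (of_nat (Suc n) * c)) s" by (simp add: free_lie.scale_minus_left del: of_nat_Suc)
    moreover have "- (of_nat (Suc n) * c) \<noteq> 0" using c(1) by (simp del: of_nat_Suc)
    ultimately show ?case by blast
  qed
  have ker: "s = 0" if Es: "E s = 0" for s
  proof -
    obtain N where N: "T N s = 0" using T_nil by blast
    obtain c where "c \<noteq> 0" "T N s = ?sc c s" using T_ker[OF Es] by blast
    thus ?thesis using N by simp
  qed
  have "inj E"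
  proof (rule injI)
    fix s t assume "E s = E t"
    moreover have "E (s - t) + E t = E s" using add[of "s - t" t] by simp
    ultimately have "E (s - t) = 0" by simp
    thus "s = t" using ker[of "s - t"] by simp
  qed
  thus ?thesis using surj by (simp add: bij_def)
qed

text \<open>Generators are separated by homomorphisms to the one-dimensional abelian Lie algebra.\<close>

lemma gen_eq_iff: "(gen a :: ('k::field_char_0, 'a) free_lie) = gen b \<longleftrightarrow> a = b"
proof -
  have "lie_algebra (*) (\<lambda>_ _. 0 :: 'k)"
    by unfold_locales (simp_all add: algebra_simps)
  from ex1_implies_ex[OF free_lie_universal[OF this, of "\<lambda>x. if x = a then 1 else 0"]]
  obtain \<phi> :: "('k, 'a) free_lie \<Rightarrow> 'k" where "\<And>x. \<phi> (gen x) = (if x = a then 1 else 0)" by blast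
  from this[of a] this[of b] show ?thesis by (auto split: if_splits)
qed

theorem theorem1p1:
  fixes x :: "nat \<Rightarrow> 'x" and y :: "nat \<Rightarrow> 'y" and n m p :: nat
    and Xs Ys :: "('k::field_char_0, 'x + 'y) free_lie set"
  assumes "n \<ge> 1" and "m \<ge> 1" and "p \<ge> 1"
    and "bij_betw x {1..n} UNIV" and "bij_betw y {1..m} UNIV"
    and "Xs = (\<lambda>i. gen (Inl (x i))) ` {1..n}" and "Ys = (\<lambda>j. gen (Inr (y j))) ` {1..m}"
  shows "free_lie.B_part p
      (\<Otimes>\<^bsub>free_lie.Sym\<^esub> i\<in>{1..n}. free_lie.sym_embed (gen (Inl (x i))))
      (\<Otimes>\<^bsub>free_lie.Sym\<^esub> j\<in>{1..m}. free_lie.sym_embed (gen (Inr (y j)))) =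
    (\<Oplus>\<^bsub>free_lie.Sym\<^esub> \<pi>\<in>{\<pi>. special_bipartition Xs Ys \<pi> \<and> card \<pi> + p = n + m}.
      \<Otimes>\<^bsub>free_lie.Sym\<^esub> S\<in>\<pi>. free_lie.sym_embed (free_lie.w (fst S) (snd S))) \<and>
    free_lie.B_part (n + m - 1)
      (\<Otimes>\<^bsub>free_lie.Sym\<^esub> i\<in>{1..n}. free_lie.sym_embed (gen (Inl (x i))))
      (\<Otimes>\<^bsub>free_lie.Sym\<^esub> j\<in>{1..m}. free_lie.sym_embed (gen (Inr (y j)))) =
    free_lie.sym_embed (free_lie.w Xs Ys)"
proof -
  obtain E :: "('k, 'x + 'y) free_lie \<Rightarrow> ('k, 'x + 'y) free_lie"
    where E': "(\<forall>a. E (gen a) = gen a) \<and> (\<forall>s t. E (s + t) = E s + E t) \<and>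
      (\<forall>c s. E (fl_scale c s) = fl_scale c (E s)) \<and>
      (\<forall>s t. E (fl_bracket s t) = fl_bracket (E s) t + fl_bracket s (E t))"
    using free_lie_degree_derivation by (rule exE)
  hence gen: "\<And>a. E (gen a) = gen a" and E: "\<And>s t. E (s + t) = E s + E t"
      "\<And>c s. E (fl_scale c s) = fl_scale c (E s)"
      "\<And>s t. E (fl_bracket s t) = fl_bracket (E s) t + fl_bracket s (E t)"
    by simp_all
  interpret exp_product fl_scale fl_bracket E Xs Ys
  proof unfold_locales
    show "E (s + t) = E s + E t" "E (fl_scale c s) = fl_scale c (E s)"
      "E (fl_bracket s t) = fl_bracket (E s) t + fl_bracket s (E t)" for s t c by (rule E)+
    show "bij E" by (rule bij_free_lie_derivation[OF gen E])
    show "Xs \<inter> Ys = {}" unfolding assms(6,7) by (auto simp: gen_eq_iff)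
    show "E v = v" if "v \<in> Xs \<union> Ys" for v
      using that unfolding assms(6,7) by (elim UnE imageE) (simp_all only: gen)
    show "finite Xs" "finite Ys" unfolding assms(6,7) by simp_all
  qed
  let ?I = "[1..<Suc n]" and ?J = "[1..<Suc m]"
  let ?f = "\<lambda>i. gen (Inl (x i)) :: ('k, 'x + 'y) free_lie" and ?g = "\<lambda>j. gen (Inr (y j)) :: ('k, 'x + 'y) free_lie"
  have I: "set ?I = {1..n}" "distinct ?I" and J: "set ?J = {1..m}" "distinct ?J" by auto
  have X: "(\<Otimes>\<^bsub>free_lie.Sym\<^esub> i\<in>{1..n}. free_lie.sym_embed (gen (Inl (x i)))) = sym_coset (mon_word (map ?f ?I))"
    using finprod_Sym[OF I(2), of ?f] unfolding I(1) .
  have Y: "(\<Otimes>\<^bsub>free_lie.Sym\<^esub> j\<in>{1..m}. free_lie.sym_embed (gen (Inr (y j)))) = sym_coset (mon_word (map ?g ?J))"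
    using finprod_Sym[OF J(2), of ?g] unfolding J(1) .
  have inj: "inj_on ?f (set ?I)" "inj_on ?g (set ?J)"
    unfolding I(1) J(1)
    using inj_onD[OF bij_betw_imp_inj_on[OF assms(4)]] inj_onD[OF bij_betw_imp_inj_on[OF assms(5)]]
    by (intro inj_onI; simp only: gen_eq_iff sum.inject)+
  have fs: "distinct (map ?f ?I)" "distinct (map ?g ?J)"
    using I(2) J(2) inj by (simp_all only: distinct_map simp_thms)
  have st: "set (map ?f ?I) = Xs" "set (map ?g ?J) = Ys"
    unfolding set_map I J assms(6,7) by (rule refl)+
  have len: "length (map ?f ?I) = n" "length (map ?g ?J) = m" by simp_all
  have ne: "map ?f ?I \<noteq> []" "map ?g ?J \<noteq> []"
    unfolding length_greater_0_conv[symmetric] len using assms(1,2) by linarith+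
  show ?thesis
    unfolding X Y
    using B_part_product[OF fs(1) st(1) fs(2) st(2), of p, unfolded len]
      B_part_product_top[OF fs(1) st(1) ne(1) fs(2) st(2) ne(2), unfolded len] by (rule conjI)
qed

end
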